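(* Let $T>0$ and let $\omega\subsetneq\Omega$ be a fixed open set. If $\mathcal{O}=\omega\times(0,T)$, then the system $$ \begin{cases} y_t-\Delta y_t-\Delta y=v\chi_{\mathcal{O}} & \text{in } Q,\\ y=0 & \text{on }\Sigma,\\ y(\cdot,0)=y_0 & \text{in }\Omega\end{cases} $$ is not null controllable at time $T$; that is, there exists $y_0\in H^2(\Omega)\cap H^1_0(\Omega)$ such that the null controllability of the system fails.
   Context: $\Omega\subset\mathbb{R}^N$ ($N\ge 1$) is a bounded connected open set whose boundary is regular enough, $Q=\Omega\times(0,T)$, $\Sigma=\partial\Omega\times(0,T)$, and $\mathcal{O}$ is a nonempty subset of $Q$. $\chi_{\mathcal{O}}\in C^\infty(Q)$ is a function with $\operatorname{supp}\chi_{\mathcal{O}}\subset\overline{\mathcal{O}}$. Null controllability at time $T$ for the initial datum $y_0$ means: there exists a control $v\in L^2(\mathcal{O})$ such that the associated solution satisfies $y(\cdot,T)=0$ in $\Omega$.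
   Formalization: The strict inclusion of ω in Ω is strengthened to: Ω∖ω has positive Lebesgue measure. Without this the claim is false, e.g. ω = Ω minus a point with χ = 1, where every datum is controllable. "Regular enough" boundary is taken as C². *)

theory Defs
  imports "HOL-Analysis.Analysis"
begin

section \<open>Smooth functions, test functions, boundary regularity\<close>

fun Ck_on :: "nat \<Rightarrow> ('a::euclidean_space \<Rightarrow> real) \<Rightarrow> 'a set \<Rightarrow> bool" where
  "Ck_on 0 f S \<longleftrightarrow> continuous_on S f"
| "Ck_on (Suc k) f S \<longleftrightarrow>
     (\<exists>g. (\<forall>x\<in>S. GDERIV f x :> g x) \<and> (\<forall>i\<in>Basis. Ck_on k (\<lambda>x. g x \<bullet> i) S))"

definition smooth_on :: "('a::euclidean_space \<Rightarrow> real) \<Rightarrow> 'a set \<Rightarrow> bool" where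
  "smooth_on f S \<longleftrightarrow> (\<forall>k. Ck_on k f S)"

definition test_functions :: "'a::euclidean_space set \<Rightarrow> ('a \<Rightarrow> real) set" where
  "test_functions \<Omega> = {\<phi>. smooth_on \<phi> UNIV \<and> compact (closure (support_on UNIV \<phi>))
                           \<and> closure (support_on UNIV \<phi>) \<subseteq> \<Omega>}"

(* Boundary of class C^2: near each boundary point the set is the sublevel set of a C^2 function
   with nonvanishing gradient there. *)
definition C2_boundary :: "'a::euclidean_space set \<Rightarrow> bool" where
  "C2_boundary \<Omega> \<longleftrightarrow>
     (\<forall>p\<in>frontier \<Omega>. \<exists>U \<rho> g. open U \<and> p \<in> U \<and> Ck_on 2 \<rho> U \<and>
        GDERIV \<rho> p :> g \<and> g \<noteq> 0 \<and> \<Omega> \<inter> U = {x \<in> U. \<rho> x < 0})"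


section \<open>Sobolev spaces\<close>

(* Elements of the function spaces are functions, not classes of functions modulo null sets;
   their values outside the underlying set are irrelevant. *)
definition L2_space :: "'a::euclidean_space set \<Rightarrow> ('a \<Rightarrow> real) set" where
  "L2_space S = {u. u \<in> borel_measurable (lebesgue_on S) \<and>
                    integrable (lebesgue_on S) (\<lambda>x. (u x)\<^sup>2)}"

definition weak_partial ::
    "'a::euclidean_space set \<Rightarrow> 'a \<Rightarrow> ('a \<Rightarrow> real) \<Rightarrow> ('a \<Rightarrow> real) \<Rightarrow> bool" where
  "weak_partial \<Omega> i u g \<longleftrightarrow>
     (\<forall>\<phi>\<in>test_functions \<Omega>.
        (LINT x|lebesgue_on \<Omega>. u x * frechet_derivative \<phi> (at x) i)
          = - (LINT x|lebesgue_on \<Omega>. g x * \<phi> x))"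

(* A representative of the weak partial derivative, which is unique up to null sets;
   only meaningful if some weak partial derivative in L^2 exists. *)
definition wpartial :: "'a::euclidean_space set \<Rightarrow> 'a \<Rightarrow> ('a \<Rightarrow> real) \<Rightarrow> 'a \<Rightarrow> real" where
  "wpartial \<Omega> i u = (SOME g. g \<in> L2_space \<Omega> \<and> weak_partial \<Omega> i u g)"

definition wlaplacian :: "'a::euclidean_space set \<Rightarrow> ('a \<Rightarrow> real) \<Rightarrow> 'a \<Rightarrow> real" where
  "wlaplacian \<Omega> u x = (\<Sum>i\<in>Basis. wpartial \<Omega> i (wpartial \<Omega> i u) x)"

fun Sobolev_H :: "nat \<Rightarrow> 'a::euclidean_space set \<Rightarrow> ('a \<Rightarrow> real) set" where
  "Sobolev_H 0 \<Omega> = L2_space \<Omega>"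
| "Sobolev_H (Suc k) \<Omega> =
     {u \<in> L2_space \<Omega>. \<forall>i\<in>Basis. \<exists>g\<in>Sobolev_H k \<Omega>. weak_partial \<Omega> i u g}"

fun Sobolev_sqnorm :: "nat \<Rightarrow> 'a::euclidean_space set \<Rightarrow> ('a \<Rightarrow> real) \<Rightarrow> real" where
  "Sobolev_sqnorm 0 \<Omega> u = (LINT x|lebesgue_on \<Omega>. (u x)\<^sup>2)"
| "Sobolev_sqnorm (Suc k) \<Omega> u =
     (LINT x|lebesgue_on \<Omega>. (u x)\<^sup>2) + (\<Sum>i\<in>Basis. Sobolev_sqnorm k \<Omega> (wpartial \<Omega> i u))"

definition Sobolev_norm :: "nat \<Rightarrow> 'a::euclidean_space set \<Rightarrow> ('a \<Rightarrow> real) \<Rightarrow> real" where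
  "Sobolev_norm k \<Omega> u = sqrt (Sobolev_sqnorm k \<Omega> u)"

definition Sobolev_H10 :: "'a::euclidean_space set \<Rightarrow> ('a \<Rightarrow> real) set" where
  "Sobolev_H10 \<Omega> =
     {u \<in> Sobolev_H 1 \<Omega>. \<exists>\<phi> :: nat \<Rightarrow> 'a \<Rightarrow> real. (\<forall>n. \<phi> n \<in> test_functions \<Omega>) \<and>
        (\<lambda>n. Sobolev_norm 1 \<Omega> (\<lambda>x. \<phi> n x - u x)) \<longlonglongrightarrow> 0}"

definition H2_H10 :: "'a::euclidean_space set \<Rightarrow> ('a \<Rightarrow> real) set" where
  "H2_H10 \<Omega> = Sobolev_H 2 \<Omega> \<inter> Sobolev_H10 \<Omega>"


section \<open>The controlled equation\<close>

(* C([0,T]; V) with V the intersection of H^2 and H^1_0, normed by the H^2 norm *)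
definition C_time :: "real \<Rightarrow> 'a::euclidean_space set \<Rightarrow> (real \<Rightarrow> 'a \<Rightarrow> real) set" where
  "C_time T \<Omega> =
     {y. \<forall>t\<in>{0..T}. y t \<in> H2_H10 \<Omega> \<and>
        ((\<lambda>s. Sobolev_norm 2 \<Omega> (\<lambda>x. y s x - y t x)) \<longlongrightarrow> 0) (at t within {0..T})}"

(* L^2(0,T; V).  As V is a separable Hilbert space, joint measurability yields strong
   measurability of the V-valued function. *)
definition L2_time :: "real \<Rightarrow> 'a::euclidean_space set \<Rightarrow> (real \<Rightarrow> 'a \<Rightarrow> real) set" where
  "L2_time T \<Omega> =
     {z. (\<lambda>(x, t). z t x) \<in> borel_measurable (lebesgue_on (\<Omega> \<times> {0<..<T})) \<and>
         (AE t in lebesgue_on {0<..<T}. z t \<in> H2_H10 \<Omega>) \<and>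
         (\<lambda>t. Sobolev_norm 2 \<Omega> (z t)) \<in> L2_space {0<..<T}}"

(* z is the time derivative of y *)
definition has_time_derivative ::
    "real \<Rightarrow> 'a::euclidean_space set \<Rightarrow> (real \<Rightarrow> 'a \<Rightarrow> real) \<Rightarrow> (real \<Rightarrow> 'a \<Rightarrow> real) \<Rightarrow> bool" where
  "has_time_derivative T \<Omega> y z \<longleftrightarrow>
     (\<forall>t\<in>{0..T}. AE x in lebesgue_on \<Omega>. y t x = y 0 x + (LINT s|lebesgue_on {0..t}. z s x))"

(* Solutions y in H^1(0,T; V) of
     y_t - Laplace y_t - Laplace y = f in Q,   y = 0 on Sigma,   y(.,0) = y0,
   the natural class for y0 in V and f in L^2(Q).  The boundary condition is the membership of
   y(t) in H^1_0, contained in C_time. *)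
definition is_solution ::
    "real \<Rightarrow> 'a::euclidean_space set \<Rightarrow> ('a \<times> real \<Rightarrow> real) \<Rightarrow> ('a \<Rightarrow> real) \<Rightarrow>
     (real \<Rightarrow> 'a \<Rightarrow> real) \<Rightarrow> bool" where
  "is_solution T \<Omega> f y0 y \<longleftrightarrow>
     y \<in> C_time T \<Omega> \<and>
     (AE x in lebesgue_on \<Omega>. y 0 x = y0 x) \<and>
     (\<exists>z\<in>L2_time T \<Omega>. has_time_derivative T \<Omega> y z \<and>
        (AE t in lebesgue_on {0<..<T}. AE x in lebesgue_on \<Omega>.
           z t x - wlaplacian \<Omega> (z t) x - wlaplacian \<Omega> (y t) x = f (x, t)))"

(* The control is extended by 0 outside \<O>; this matters because chi need only be supported in
   the closure of \<O>. *)
definition null_controllable ::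
    "real \<Rightarrow> 'a::euclidean_space set \<Rightarrow> ('a \<times> real) set \<Rightarrow> ('a \<times> real \<Rightarrow> real) \<Rightarrow>
     ('a \<Rightarrow> real) \<Rightarrow> bool" where
  "null_controllable T \<Omega> \<O> chi y0 \<longleftrightarrow>
     (\<exists>v\<in>L2_space \<O>. \<exists>y. is_solution T \<Omega> (\<lambda>p. indicat_real \<O> p * v p * chi p) y0 y \<and>
        (AE x in lebesgue_on \<Omega>. y T x = 0))"

end

theory Submission
  imports Defs
begin

text \<open>
  Let \<open>K\<close> be the complement of \<open>\<omega>\<close> in \<open>\<Omega>\<close>, let \<open>y\<close> be a trajectory with \<open>y(T) = 0\<close>, and let
  \<open>z\<close> be its time derivative. On \<open>K\<close> the equation reads \<open>z - \<Delta>z - \<Delta>y = 0\<close>. Multiply by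
  \<open>exp t\<close> and integrate over \<open>(0, T)\<close>. As \<open>y(t)\<close> is minus the integral of \<open>z\<close> over \<open>(t, T)\<close>,
  exchanging the integrals turns the weight of \<open>\<Delta>y\<close> into the weight \<open>- (exp t - 1)\<close> of \<open>\<Delta>z\<close>.
  So the terms with \<open>exp t\<close> cancel, and there remains \<open>Z = - \<Delta>y(0)\<close> on \<open>K\<close>, where \<open>Z\<close> is the
  integral of \<open>exp t * z(t)\<close>. So the Laplacian of a controllable datum
  is on \<open>K\<close> as regular as \<open>Z\<close>, a mean of functions in \<open>H\<^sup>1\<^sub>0\<close>.

  This regularity is used in a form that makes sense on a set \<open>K\<close> of positive measure that may
  have empty interior: the integral of \<open>Z\<^sup>2\<close> over a slab \<open>\<bar>x \<bullet> e - a\<bar> \<le> r\<close> is at most a constant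
  times \<open>r\<close>, as for every function in \<open>H\<^sup>1\<^sub>0\<close> (lemmas \<open>Sobolev_H10_slab\<close> and \<open>exp_mean_slab\<close>). The
  datum that violates it is \<open>\<eta>(x) * \<bar>x \<bullet> e - a\<bar> powr (7/4)\<close> with a cutoff \<open>\<eta>\<close> (lemma
  \<open>singular_datum\<close>). It belongs to \<open>H\<^sup>2\<close> and \<open>H\<^sup>1\<^sub>0\<close>, and its Laplacian is of size
  \<open>\<bar>x \<bullet> e - a\<bar> powr (- 1/4)\<close> near the hyperplane. Were it controllable, then the part of \<open>K\<close> in the slab
  on which \<open>\<eta>\<close> is bounded below would have measure at most a constant times \<open>r powr (3/2)\<close> for all small \<open>r\<close>. A covering argument
  (lemma \<open>thick_hyperplane_exists\<close>) shows that this fails for some \<open>a\<close>, because \<open>K\<close> is not a null set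
  and the cutoff can be chosen bounded below on a part of \<open>K\<close> that is not null either.

  The identity on \<open>K\<close> is obtained in weak form (lemma \<open>exp_mean_uncontrolled\<close>): Laplacians are moved to
  test functions on \<open>\<Omega>\<close>, and only then do the test functions approximate indicators of subsets of
  \<open>K\<close>. This rests on the density of test functions, which also gives the uniqueness of weak
  derivatives.
\<close>

section \<open>Smooth functions and test functions\<close>

lemma Ck_on_imp_continuous_on: "Ck_on k f S \<Longrightarrow> continuous_on S f"
proof (cases k)
  case (Suc m)
  assume "Ck_on k f S"
  then obtain g where g: "\<forall>x\<in>S. GDERIV f x :> g x" unfolding Suc by auto
  have "isCont f x" if "x \<in> S" for x
    using g that by (auto simp: gderiv_def dest: has_derivative_continuous)
  then show "continuous_on S f" by (simp add: continuous_at_imp_continuous_on)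
qed simp

lemma Ck_on_Suc_imp: "Ck_on (Suc k) f S \<Longrightarrow> Ck_on k f S"
proof (induction k arbitrary: f)
  case 0
  then show ?case using Ck_on_imp_continuous_on by (metis Ck_on.simps(1))
next
  case (Suc k)
  then obtain g where g: "\<forall>x\<in>S. GDERIV f x :> g x" "\<forall>i\<in>Basis. Ck_on (Suc k) (\<lambda>x. g x \<bullet> i) S"
    by (auto simp only: Ck_on.simps(2)[of "Suc k"])
  then show ?case using Suc.IH by auto
qed

lemma Ck_on_const: "Ck_on k (\<lambda>x. c) S"
proof (induction k arbitrary: c)
  case (Suc k)
  then show ?case by (auto intro!: exI[of _ "\<lambda>x. 0"] GDERIV_const)
qed simp

lemma Ck_on_inner: "Ck_on k (\<lambda>x. x \<bullet> v) S"
proof (cases k)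
  case (Suc m)
  have "GDERIV (\<lambda>x. x \<bullet> v) x :> v" for x
    unfolding gderiv_def by (auto intro!: derivative_eq_intros simp: inner_commute)
  then show ?thesis unfolding Suc by (auto intro!: exI[of _ "\<lambda>x. v"] Ck_on_const)
qed (auto intro!: continuous_intros)

lemma Ck_on_add: "Ck_on k f S \<Longrightarrow> Ck_on k g S \<Longrightarrow> Ck_on k (\<lambda>x. f x + g x) S"
proof (induction k arbitrary: f g)
  case (Suc k)
  then obtain f' g' where *: "\<forall>x\<in>S. GDERIV f x :> f' x" "\<forall>i\<in>Basis. Ck_on k (\<lambda>x. f' x \<bullet> i) S"
    "\<forall>x\<in>S. GDERIV g x :> g' x" "\<forall>i\<in>Basis. Ck_on k (\<lambda>x. g' x \<bullet> i) S" by auto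
  then show ?case
    by (auto intro!: exI[of _ "\<lambda>x. f' x + g' x"] GDERIV_add Suc.IH simp: inner_add_left)
qed (auto intro: continuous_on_add)

lemma Ck_on_mult: "Ck_on k f S \<Longrightarrow> Ck_on k g S \<Longrightarrow> Ck_on k (\<lambda>x. f x * g x) S"
proof (induction k arbitrary: f g)
  case (Suc k)
  then obtain f' g' where *: "\<forall>x\<in>S. GDERIV f x :> f' x" "\<forall>i\<in>Basis. Ck_on k (\<lambda>x. f' x \<bullet> i) S"
    "\<forall>x\<in>S. GDERIV g x :> g' x" "\<forall>i\<in>Basis. Ck_on k (\<lambda>x. g' x \<bullet> i) S" by auto
  moreover have "Ck_on k f S" "Ck_on k g S" using Suc.prems Ck_on_Suc_imp by blast+
  ultimately show ?case
    by (auto intro!: exI[of _ "\<lambda>x. f x *\<^sub>R g' x + g x *\<^sub>R f' x"] GDERIV_mult Suc.IH Ck_on_add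
        simp: inner_add_left)
qed (auto intro: continuous_on_mult)

lemma Ck_on_sum:
  "(\<And>i. i \<in> I \<Longrightarrow> Ck_on k (f i) S) \<Longrightarrow> Ck_on k (\<lambda>x. \<Sum>i\<in>I. f i x) S"
proof (induction I rule: infinite_finite_induct)
  case (insert i I)
  then show ?case by (simp add: Ck_on_add)
qed (auto simp: Ck_on_const)

text \<open>The derivatives of the outer function form a sequence \<open>h\<close>, because the gradient of
  \<open>h n \<circ> u\<close> contains \<open>h (Suc n) \<circ> u\<close> and the induction has to apply to it.\<close>

lemma Ck_on_compose:
  assumes h: "\<And>n s. s \<in> A \<Longrightarrow> (h n has_real_derivative h (Suc n) s) (at s)"
    and u: "Ck_on k u S" "\<And>x. x \<in> S \<Longrightarrow> u x \<in> A"
  shows "Ck_on k (\<lambda>x. h n (u x)) S"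
  using u(1)
proof (induction k arbitrary: n)
  case 0
  have "continuous_on A (h n)"
    by (meson h DERIV_isCont continuous_at_imp_continuous_on)
  then show ?case using 0 u(2) by (auto intro: continuous_on_compose2)
next
  case (Suc k)
  then obtain g where g: "\<forall>x\<in>S. GDERIV u x :> g x" "\<forall>i\<in>Basis. Ck_on k (\<lambda>x. g x \<bullet> i) S" by auto
  have "Ck_on k u S" using Suc.prems Ck_on_Suc_imp by blast
  then have "Ck_on k (\<lambda>x. h (Suc n) (u x)) S" by (rule Suc.IH)
  with g show ?case
    by (auto intro!: exI[of _ "\<lambda>x. h (Suc n) (u x) *\<^sub>R g x"]
        GDERIV_DERIV_compose[where g = "h n"] Ck_on_mult h u(2))
qed

lemma smooth_on_add: "smooth_on f S \<Longrightarrow> smooth_on g S \<Longrightarrow> smooth_on (\<lambda>x. f x + g x) S"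
  and smooth_on_mult: "smooth_on f S \<Longrightarrow> smooth_on g S \<Longrightarrow> smooth_on (\<lambda>x. f x * g x) S"
  and smooth_on_const: "smooth_on (\<lambda>x. c) S"
  and smooth_on_inner: "smooth_on (\<lambda>x. x \<bullet> v) S"
  by (auto simp: smooth_on_def Ck_on_add Ck_on_mult Ck_on_const Ck_on_inner)

lemma smooth_on_sum:
  "(\<And>i. i \<in> I \<Longrightarrow> smooth_on (f i) S) \<Longrightarrow> smooth_on (\<lambda>x. \<Sum>i\<in>I. f i x) S"
  by (auto simp: smooth_on_def intro: Ck_on_sum)

lemma smooth_on_compose:
  assumes "\<And>n s. s \<in> A \<Longrightarrow> (h n has_real_derivative h (Suc n) s) (at s)"
    and "smooth_on u S" "\<And>x. x \<in> S \<Longrightarrow> u x \<in> A"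
  shows "smooth_on (\<lambda>x. h n (u x)) S"
  using assms Ck_on_compose[of A h _ u S n] by (auto simp: smooth_on_def)

definition pderivative :: "'a::euclidean_space \<Rightarrow> ('a \<Rightarrow> real) \<Rightarrow> 'a \<Rightarrow> real" where
  "pderivative i f x = frechet_derivative f (at x) i"

lemma GDERIV_pderivative: "GDERIV f x :> D \<Longrightarrow> pderivative i f x = D \<bullet> i"
  unfolding gderiv_def pderivative_def using frechet_derivative_at by (metis inner_commute)

lemma smooth_on_imp_GDERIV:
  assumes "smooth_on f S" "x \<in> S"
  obtains D where "GDERIV f x :> D"
proof -
  have "Ck_on (Suc 0) f S" using assms by (simp only: smooth_on_def)
  then show thesis using that assms(2) by auto
qed

lemma smooth_on_pderivative:
  assumes "smooth_on f UNIV" "i \<in> Basis"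
  shows "smooth_on (pderivative i f) UNIV"
  unfolding smooth_on_def
proof
  fix k
  have "Ck_on (Suc k) f UNIV" using assms by (simp only: smooth_on_def)
  then obtain g where g: "\<forall>x. GDERIV f x :> g x" "\<forall>i\<in>Basis. Ck_on k (\<lambda>x. g x \<bullet> i) UNIV" by auto
  have "pderivative i f = (\<lambda>x. g x \<bullet> i)" using g(1) GDERIV_pderivative by blast
  then show "Ck_on k (pderivative i f) UNIV" using g(2) assms(2) by simp
qed

lemma smooth_on_imp_continuous_on: "smooth_on f S \<Longrightarrow> continuous_on S f"
  using Ck_on_imp_continuous_on smooth_on_def by blast

lemma test_functionsI:
  assumes "smooth_on \<phi> UNIV" "compact C" "C \<subseteq> \<Omega>" "\<And>x. x \<notin> C \<Longrightarrow> \<phi> x = 0"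
  shows "\<phi> \<in> test_functions \<Omega>"
proof -
  have "support_on UNIV \<phi> \<subseteq> C" using assms(4) by (auto simp: support_on_def)
  then have "closure (support_on UNIV \<phi>) \<subseteq> C"
    using assms(2) by (simp add: closure_minimal compact_imp_closed)
  moreover have "compact (closure (support_on UNIV \<phi>))"
    using calculation assms(2) by (meson bounded_subset closed_closure compact_eq_bounded_closed)
  ultimately show ?thesis using assms unfolding test_functions_def by auto
qed

lemma test_functionsE:
  assumes "\<phi> \<in> test_functions \<Omega>"
  obtains C where "smooth_on \<phi> UNIV" "compact C" "C \<subseteq> \<Omega>" "\<And>x. x \<notin> C \<Longrightarrow> \<phi> x = 0"
proof
  let ?C = "closure (support_on UNIV \<phi>)"
  show "smooth_on \<phi> UNIV" "compact ?C" "?C \<subseteq> \<Omega>"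
    using assms by (auto simp: test_functions_def)
  show "\<phi> x = 0" if "x \<notin> ?C" for x
    using that closure_subset[of "support_on UNIV \<phi>"] by (auto simp: support_on_def)
qed

lemma test_functions_add:
  assumes "\<phi> \<in> test_functions \<Omega>" "\<psi> \<in> test_functions \<Omega>"
  shows "(\<lambda>x. \<phi> x + \<psi> x) \<in> test_functions \<Omega>"
proof -
  obtain C D where "smooth_on \<phi> UNIV" "compact C" "C \<subseteq> \<Omega>" "\<And>x. x \<notin> C \<Longrightarrow> \<phi> x = 0"
    "smooth_on \<psi> UNIV" "compact D" "D \<subseteq> \<Omega>" "\<And>x. x \<notin> D \<Longrightarrow> \<psi> x = 0"
    using assms test_functionsE by metis
  then show ?thesis by (intro test_functionsI[of _ "C \<union> D"] smooth_on_add) auto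
qed

lemma test_functions_mult:
  assumes "\<phi> \<in> test_functions \<Omega>" "smooth_on \<psi> UNIV"
  shows "(\<lambda>x. \<phi> x * \<psi> x) \<in> test_functions \<Omega>"
proof -
  obtain C where "smooth_on \<phi> UNIV" "compact C" "C \<subseteq> \<Omega>" "\<And>x. x \<notin> C \<Longrightarrow> \<phi> x = 0"
    using assms test_functionsE by metis
  then show ?thesis using assms(2) by (intro test_functionsI[of _ "C"] smooth_on_mult) auto
qed

lemma test_functions_zero: "(\<lambda>x. 0) \<in> test_functions \<Omega>"
  by (rule test_functionsI[of _ "{}"]) (auto simp: smooth_on_const)

lemma test_functions_sum:
  "(\<And>i. i \<in> I \<Longrightarrow> f i \<in> test_functions \<Omega>) \<Longrightarrow> (\<lambda>x. \<Sum>i\<in>I. f i x) \<in> test_functions \<Omega>"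
proof (induction I rule: infinite_finite_induct)
  case (insert i I)
  then show ?case by (simp add: test_functions_add)
qed (auto simp: test_functions_zero)

lemma test_functions_mono: "S \<subseteq> T \<Longrightarrow> test_functions S \<subseteq> test_functions T"
  by (auto simp: test_functions_def)

lemma test_functions_pderivative:
  assumes "\<phi> \<in> test_functions \<Omega>" "i \<in> Basis"
  shows "pderivative i \<phi> \<in> test_functions \<Omega>"
proof -
  obtain C where C: "smooth_on \<phi> UNIV" "compact C" "C \<subseteq> \<Omega>" "\<And>x. x \<notin> C \<Longrightarrow> \<phi> x = 0"
    using assms test_functionsE by metis
  have "pderivative i \<phi> x = 0" if "x \<notin> C" for x
  proof -
    have "GDERIV \<phi> x :> 0"
      unfolding gderiv_def
    proof (rule has_derivative_transform_within_open)
      show "((\<lambda>x. 0) has_derivative (\<lambda>h. h \<bullet> 0)) (at x)" by simp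
      show "open (- C)" using C(2) by (simp add: compact_imp_closed open_Compl)
    qed (use C(4) that in auto)
    then show ?thesis using GDERIV_pderivative by fastforce
  qed
  then show ?thesis using C assms(2) by (intro test_functionsI[of _ C] smooth_on_pderivative)
qed

lemma pderivative_add:
  assumes "smooth_on f UNIV" "smooth_on g UNIV"
  shows "pderivative i (\<lambda>x. f x + g x) = (\<lambda>x. pderivative i f x + pderivative i g x)"
proof
  fix x
  obtain D where D: "GDERIV f x :> D" using smooth_on_imp_GDERIV[OF assms(1) UNIV_I] by blast
  obtain E where E: "GDERIV g x :> E" using smooth_on_imp_GDERIV[OF assms(2) UNIV_I] by blast
  show "pderivative i (\<lambda>x. f x + g x) x = pderivative i f x + pderivative i g x"
    unfolding GDERIV_pderivative[OF D] GDERIV_pderivative[OF E] GDERIV_pderivative[OF GDERIV_add[OF D E]]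
    by (simp add: inner_add_left)
qed

lemma pderivative_mult:
  assumes "smooth_on f UNIV" "smooth_on g UNIV"
  shows "pderivative i (\<lambda>x. f x * g x) = (\<lambda>x. pderivative i f x * g x + f x * pderivative i g x)"
proof
  fix x
  obtain D where D: "GDERIV f x :> D" using smooth_on_imp_GDERIV[OF assms(1) UNIV_I] by blast
  obtain E where E: "GDERIV g x :> E" using smooth_on_imp_GDERIV[OF assms(2) UNIV_I] by blast
  show "pderivative i (\<lambda>x. f x * g x) x = pderivative i f x * g x + f x * pderivative i g x"
    unfolding GDERIV_pderivative[OF D] GDERIV_pderivative[OF E] GDERIV_pderivative[OF GDERIV_mult[OF D E]]
    by (simp add: inner_add_left)
qed

lemma test_functions_bounded:
  assumes "\<phi> \<in> test_functions \<Omega>"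
  obtains B where "\<And>x. \<bar>\<phi> x\<bar> \<le> B"
proof -
  obtain C where C: "smooth_on \<phi> UNIV" "compact C" "\<And>x. x \<notin> C \<Longrightarrow> \<phi> x = 0"
    using assms test_functionsE by metis
  have "compact (\<phi> ` C)"
    using C by (meson compact_continuous_image continuous_on_subset smooth_on_imp_continuous_on subset_UNIV)
  then obtain B where "\<forall>y\<in>\<phi> ` C. \<bar>y\<bar> \<le> B" using compact_imp_bounded bounded_real by metis
  then have "\<bar>\<phi> x\<bar> \<le> max B 0" for x using C(3) by (cases "x \<in> C") (auto simp: le_max_iff_disj)
  then show thesis using that by blast
qed

lemma test_functions_measurable: "\<phi> \<in> test_functions \<Omega> \<Longrightarrow> \<phi> \<in> borel_measurable borel"
  by (meson borel_measurable_continuous_onI smooth_on_imp_continuous_on test_functionsE)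

lemma test_functions_outside: "\<phi> \<in> test_functions \<Omega> \<Longrightarrow> x \<notin> \<Omega> \<Longrightarrow> \<phi> x = 0"
  by (meson subsetD test_functionsE)

lemma integrable_bounded_compact_support:
  fixes f :: "'a::euclidean_space \<Rightarrow> real"
  assumes "f \<in> borel_measurable borel" "bounded C" "\<And>x. x \<notin> C \<Longrightarrow> f x = 0" "\<And>x. \<bar>f x\<bar> \<le> B"
  shows "integrable lborel f"
proof -
  obtain a where a: "C \<subseteq> cbox (-a) a" using bounded_subset_cbox_symmetric[OF assms(2)] by blast
  have "integrable lborel (\<lambda>x. B * indicator (cbox (-a) a) x :: real)"
    by (intro integrable_mult_right integrable_real_indicator) (auto simp: emeasure_lborel_cbox_eq)
  then show ?thesis
  proof (rule Bochner_Integration.integrable_bound)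
    show "AE x in lborel. norm (f x) \<le> norm (B * indicator (cbox (-a) a) x :: real)"
      using a assms(3,4) by (intro always_eventually allI) (auto simp: indicator_def intro: order_trans[OF _ abs_ge_self])
  qed (use assms in simp)
qed

lemma test_functions_integrable:
  fixes \<phi> :: "'a::euclidean_space \<Rightarrow> real"
  assumes "\<phi> \<in> test_functions \<Omega>" shows "integrable lborel \<phi>"
proof -
  obtain C where "smooth_on \<phi> UNIV" "compact C" "\<And>x. x \<notin> C \<Longrightarrow> \<phi> x = 0"
    using assms test_functionsE by metis
  moreover obtain B where "\<And>x. \<bar>\<phi> x\<bar> \<le> B" using assms test_functions_bounded by metis
  ultimately show ?thesis
    using integrable_bounded_compact_support[of \<phi> C B] compact_imp_bounded test_functions_measurable[OF assms] by blast
qed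

section \<open>Bump functions\<close>

text \<open>Polynomials \<open>P\<^sub>n\<close> such that \<open>P\<^sub>n (1 / s) * exp (- 1 / s)\<close> is the \<open>n\<close>-th derivative of
  \<open>exp (- 1 / s)\<close> for \<open>s > 0\<close>; the recursion is the product rule.\<close>

fun bump_poly :: "nat \<Rightarrow> real poly" where
  "bump_poly 0 = 1"
| "bump_poly (Suc n) = [:0, 0, 1:] * (bump_poly n - pderiv (bump_poly n))"

definition exp_bump :: "nat \<Rightarrow> real \<Rightarrow> real" where
  "exp_bump n s = (if s > 0 then poly (bump_poly n) (1 / s) * exp (- (1 / s)) else 0)"

lemma tendsto_poly_exp_minus: "((\<lambda>t. poly p t * exp (- t)) \<longlongrightarrow> (0::real)) at_top"
proof -
  have "((\<lambda>t. \<Sum>i\<le>degree p. coeff p i * (t ^ i / exp t)) \<longlongrightarrow> (\<Sum>i\<le>degree p. coeff p i * 0)) at_top"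
    by (intro tendsto_intros tendsto_power_div_exp_0)
  moreover have "(\<Sum>i\<le>degree p. coeff p i * (t ^ i / exp t)) = poly p t * exp (- t)" for t
    by (simp add: poly_altdef sum_distrib_right exp_minus divide_inverse mult.assoc)
  ultimately show ?thesis by simp
qed

text \<open>Only \<open>s = 0\<close> is delicate: there the difference quotients from the right are again a polynomial
  in \<open>1 / s\<close> times \<open>exp (- 1 / s)\<close>, and the exponential wins.\<close>

lemma exp_bump_DERIV: "(exp_bump n has_real_derivative exp_bump (Suc n) s) (at s)"
proof -
  consider "s > 0" | "s < 0" | "s = 0" by linarith
  then show ?thesis
  proof cases
    case 1
    have "((\<lambda>s. poly (bump_poly n) (1 / s) * exp (- (1 / s))) has_real_derivative exp_bump (Suc n) s) (at s)"
      using 1 by (auto intro!: derivative_eq_intros DERIV_chain2[OF poly_DERIV] simp: exp_bump_def field_simps power2_eq_square)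
    then show ?thesis
      by (rule has_field_derivative_transform_within_open[of _ _ _ "{0<..}"]) (use 1 in \<open>auto simp: exp_bump_def\<close>)
  next
    case 2
    have "((\<lambda>s. 0) has_real_derivative exp_bump (Suc n) s) (at s)"
      using 2 by (auto simp: exp_bump_def)
    then show ?thesis
      by (rule has_field_derivative_transform_within_open[of _ _ _ "{..<0}"]) (use 2 in \<open>auto simp: exp_bump_def\<close>)
  next
    case 3
    have "((\<lambda>h. exp_bump n h / h) \<longlongrightarrow> 0) (at_right 0)"
    proof -
      have "((\<lambda>h. poly ([:0, 1:] * bump_poly n) (inverse h) * exp (- inverse h)) \<longlongrightarrow> (0::real)) (at_right 0)"
        using filterlim_compose[OF tendsto_poly_exp_minus filterlim_inverse_at_top_right] .
      moreover have "\<forall>\<^sub>F h in at_right (0::real). poly ([:0, 1:] * bump_poly n) (inverse h) * exp (- inverse h) = exp_bump n h / h"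
        by (rule eventually_at_rightI[of 0 1]) (auto simp: exp_bump_def field_simps)
      ultimately show ?thesis by (rule Lim_transform_eventually)
    qed
    moreover have "((\<lambda>h. exp_bump n h / h) \<longlongrightarrow> 0) (at_left 0)"
      by (rule tendsto_eventually, rule eventually_at_leftI[of "-1"]) (auto simp: exp_bump_def)
    ultimately have "((\<lambda>h. exp_bump n h / h) \<longlongrightarrow> 0) (at 0)" using filterlim_split_at by blast
    then show ?thesis unfolding 3 has_field_derivative_iff by (simp add: exp_bump_def)
  qed
qed

definition ball_bump :: "'a::euclidean_space \<Rightarrow> real \<Rightarrow> 'a \<Rightarrow> real" where
  "ball_bump c r x = exp_bump 0 (r\<^sup>2 - (dist c x)\<^sup>2)"

lemma ball_bump_nonneg: "ball_bump c r x \<ge> 0"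
  by (auto simp: ball_bump_def exp_bump_def)

lemma ball_bump_pos: "x \<in> ball c r \<Longrightarrow> ball_bump c r x > 0"
  using power_strict_mono[of "dist c x" r 2] by (simp add: ball_bump_def exp_bump_def)

lemma ball_bump_outside: "r \<ge> 0 \<Longrightarrow> x \<notin> ball c r \<Longrightarrow> ball_bump c r x = 0"
  using power_mono[of r "dist c x" 2] by (simp add: ball_bump_def exp_bump_def not_less)

lemma smooth_ball_bump: "smooth_on (ball_bump c r) UNIV"
proof -
  have eq: "ball_bump c r = (\<lambda>x. exp_bump 0 (r\<^sup>2 + (\<Sum>i\<in>Basis. (x \<bullet> i + (- (c \<bullet> i))) * ((- 1) * (x \<bullet> i + (- (c \<bullet> i)))))))"
  proof
    fix x
    have "(dist c x)\<^sup>2 = (\<Sum>i\<in>Basis. ((x - c) \<bullet> i)\<^sup>2)"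
      unfolding dist_norm power2_norm_eq_inner
      by (subst euclidean_inner) (simp add: power2_eq_square inner_diff_left algebra_simps)
    moreover have "(\<Sum>i\<in>Basis. (x \<bullet> i + (- (c \<bullet> i))) * ((- 1) * (x \<bullet> i + (- (c \<bullet> i)))))
        = - (\<Sum>i\<in>Basis. ((x - c) \<bullet> i)\<^sup>2)"
      unfolding sum_negf[symmetric]
      by (rule sum.cong) (simp_all add: inner_diff_left power2_eq_square algebra_simps)
    ultimately show "ball_bump c r x = exp_bump 0 (r\<^sup>2 + (\<Sum>i\<in>Basis. (x \<bullet> i + (- (c \<bullet> i))) * ((- 1) * (x \<bullet> i + (- (c \<bullet> i))))))"
      by (simp only: ball_bump_def diff_conv_add_uminus)
  qed
  show ?thesis unfolding eq
    by (rule smooth_on_compose[where A = UNIV])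
      (intro smooth_on_add smooth_on_const smooth_on_sum smooth_on_mult smooth_on_inner exp_bump_DERIV UNIV_I)+
qed

lemma ball_bump_test_function:
  assumes "r > 0" "cball c r \<subseteq> \<Omega>" shows "ball_bump c r \<in> test_functions \<Omega>"
  using assms by (intro test_functionsI[of _ "cball c r"] smooth_ball_bump) (auto intro!: ball_bump_outside)

section \<open>Approximation of indicator functions by test functions\<close>

text \<open>Sum the bumps of a finite cover of \<open>C\<close> by balls; compactness gives the lower bound.\<close>

lemma test_function_positive_on_compact:
  assumes "compact C" "open U" "C \<subseteq> U"
  obtains f \<delta> where "f \<in> test_functions U" "\<And>x. f x \<ge> 0" "\<delta> > 0" "\<And>x. x \<in> C \<Longrightarrow> f x \<ge> \<delta>"
proof -
  have "\<exists>r>0. cball x r \<subseteq> U" if "x \<in> C" for x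
    using assms that open_contains_cball by blast
  then obtain r where r: "\<And>x. x \<in> C \<Longrightarrow> r x > 0 \<and> cball x (r x) \<subseteq> U" by metis
  have "C \<subseteq> (\<Union>c\<in>C. ball c (r c))" using r by force
  then obtain D where D: "D \<subseteq> C" "finite D" "C \<subseteq> (\<Union>c\<in>D. ball c (r c))"
    using compactE_image[OF assms(1), of C "\<lambda>c. ball c (r c)"] by auto
  define f where "f x = (\<Sum>c\<in>D. ball_bump c (r c) x)" for x
  have test: "f \<in> test_functions U"
    unfolding f_def[abs_def] using D(1) r by (intro test_functions_sum ball_bump_test_function) auto
  have nonneg: "f x \<ge> 0" for x unfolding f_def by (simp add: ball_bump_nonneg sum_nonneg)
  have pos: "f x > 0" if x: "x \<in> C" for x
  proof -
    obtain c where "c \<in> D" "x \<in> ball c (r c)" using D(3) x by auto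
    then show ?thesis unfolding f_def using D(2)
      by (intro sum_pos2[of D c]) (auto intro: ball_bump_pos ball_bump_nonneg)
  qed
  show thesis
  proof (cases "C = {}")
    case True
    then show thesis using that[OF test nonneg, of 1] by simp
  next
    case False
    have "continuous_on C f"
      using test test_functionsE smooth_on_imp_continuous_on continuous_on_subset by (metis subset_UNIV)
    then obtain y where "y \<in> C" "\<forall>x\<in>C. f y \<le> f x"
      using continuous_attains_inf[OF assms(1) False] by blast
    then show thesis using that[OF test nonneg, of "f y"] pos by auto
  qed
qed

text \<open>The function is \<open>1 - exp (- k * f)\<close> for a positive test function \<open>f\<close> and a large constant \<open>k\<close>:
  it vanishes exactly where \<open>f\<close> does and tends to 1 elsewhere as \<open>k\<close> grows.\<close>

lemma test_function_between:
  assumes "compact C" "open U" "C \<subseteq> U" "\<epsilon> > 0"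
  obtains \<phi> where "\<phi> \<in> test_functions U" "\<And>x. 0 \<le> \<phi> x" "\<And>x. \<phi> x \<le> 1" "\<And>x. x \<in> C \<Longrightarrow> \<phi> x \<ge> 1 - \<epsilon>"
proof -
  obtain f \<delta> where f: "f \<in> test_functions U" "\<And>x. f x \<ge> 0" and \<delta>: "\<delta> > 0" "\<And>x. x \<in> C \<Longrightarrow> f x \<ge> \<delta>"
    using test_function_positive_on_compact assms by metis
  obtain D where D: "smooth_on f UNIV" "compact D" "D \<subseteq> U" "\<And>x. x \<notin> D \<Longrightarrow> f x = 0"
    using f(1) test_functionsE by metis
  obtain k where k: "exp (- k * \<delta>) \<le> \<epsilon>"
  proof
    show "exp (- (- ln \<epsilon> / \<delta>) * \<delta>) \<le> \<epsilon>" using \<delta>(1) assms(4) by simp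
  qed
  define k' where "k' = max k 0"
  define h where "h n s = (if n = 0 then 1 else 0) - (- k') ^ n * exp (- k' * s)" for n :: nat and s
  have h: "(h n has_real_derivative h (Suc n) s) (at s)" for n s
    unfolding h_def by (auto intro!: derivative_eq_intros)
  have h0: "h 0 s = 1 - exp (- (k' * s))" for s by (simp add: h_def)
  have smooth: "smooth_on (\<lambda>x. h 0 (f x)) UNIV"
    by (rule smooth_on_compose[where A = UNIV]) (auto intro: h D(1))
  show thesis
  proof
    show "(\<lambda>x. h 0 (f x)) \<in> test_functions U"
      by (rule test_functionsI[OF smooth D(2,3)]) (simp add: D(4) h0)
    show "0 \<le> h 0 (f x)" "h 0 (f x) \<le> 1" for x
      using f(2)[of x] by (auto simp: h0 k'_def)
    show "h 0 (f x) \<ge> 1 - \<epsilon>" if "x \<in> C" for x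
    proof -
      have "k * \<delta> \<le> k' * f x" using \<delta>(1) \<delta>(2)[OF that] by (intro mult_mono) (auto simp: k'_def)
      then have "exp (- (k' * f x)) \<le> exp (- k * \<delta>)" by simp
      then show ?thesis using k by (simp only: h0)
    qed
  qed
qed

lemma fsigma_ascending_compact:
  fixes S :: "'a::euclidean_space set"
  assumes "fsigma S"
  obtains F :: "nat \<Rightarrow> 'a set" where "\<forall>n. compact (F n)" "incseq F" "(\<Union>n. F n) = S"
proof -
  obtain G :: "nat \<Rightarrow> 'a set" where G: "range G \<subseteq> Collect compact" "S = \<Union>(range G)"
    using assms fsigma_Union_compact by metis
  show thesis
  proof (rule that[of "\<lambda>n. \<Union>i\<le>n. G i"])
    show "\<forall>n. compact (\<Union>i\<le>n. G i)" using G(1) by (intro allI compact_UN) auto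
    show "incseq (\<lambda>n. \<Union>i\<le>n. G i)" by (force simp: incseq_def)
  qed (use G(2) in auto)
qed

lemma sets_lebesgue_open: "open S \<Longrightarrow> S \<in> sets lebesgue"
  by (simp add: borel_open sets_completionI_sets)

lemma borel_measurable_lebesgue_on: "f \<in> borel_measurable borel \<Longrightarrow> f \<in> borel_measurable (lebesgue_on S)"
  by (rule measurable_restrict_space1) (simp add: measurable_completion)

text \<open>Up to null sets, both \<open>E\<close> and its complement are increasing unions of compact sets \<open>F n\<close> and \<open>G n\<close>.
  The \<open>n\<close>-th function is close to 1 on \<open>F n\<close> and supported off \<open>G n\<close>, so that almost every point is
  decided from some \<open>n\<close> on. The sets in question may well have empty interior.\<close>

lemma indicator_limit_of_test_functions:
  fixes \<Omega> :: "'a::euclidean_space set"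
  assumes "open \<Omega>" "E \<in> sets lebesgue" "E \<subseteq> \<Omega>"
  obtains \<phi> :: "nat \<Rightarrow> 'a \<Rightarrow> real" where "\<And>n. \<phi> n \<in> test_functions \<Omega>" "\<And>n x. 0 \<le> \<phi> n x" "\<And>n x. \<phi> n x \<le> 1"
    "AE x in lebesgue. (\<lambda>n. \<phi> n x) \<longlonglongrightarrow> indicator E x"
proof -
  obtain C1 N1 where 1: "fsigma C1" "N1 \<in> null_sets lebesgue" "C1 \<union> N1 = E" using lebesgue_set_almost_fsigma[OF assms(2)] by metis
  have "- E \<in> sets lebesgue" using assms(2) sets.compl_sets by (auto simp: Compl_eq_Diff_UNIV)
  then obtain C2 N2 where 2: "fsigma C2" "N2 \<in> null_sets lebesgue" "C2 \<union> N2 = - E" using lebesgue_set_almost_fsigma by metis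
  obtain F where F: "\<forall>n. compact (F n)" "incseq F" "(\<Union>n. F n) = C1"
    by (rule fsigma_ascending_compact[OF 1(1)])
  obtain G where G: "\<forall>n. compact (G n)" "incseq G" "(\<Union>n. G n) = C2"
    by (rule fsigma_ascending_compact[OF 2(1)])
  have "\<exists>\<phi>. \<phi> \<in> test_functions (\<Omega> - G n) \<and> (\<forall>x. 0 \<le> \<phi> x \<and> \<phi> x \<le> 1) \<and> (\<forall>x\<in>F n. \<phi> x \<ge> 1 - 1 / real (Suc n))" for n
  proof -
    have *: "open (\<Omega> - G n)" using G(1) assms(1) by (simp add: compact_imp_closed open_Diff)
    have "F n \<subseteq> E" "G n \<subseteq> - E" using F(3) G(3) 1(3) 2(3) by blast+
    then have "F n \<subseteq> \<Omega> - G n" using assms(3) by blast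
    then show ?thesis using test_function_between[OF F(1)[rule_format] *, of n "1 / real (Suc n)"]
      by (metis divide_pos_pos of_nat_0_less_iff zero_less_Suc zero_less_one)
  qed
  then obtain \<phi> where \<phi>: "\<And>n. \<phi> n \<in> test_functions (\<Omega> - G n)" "\<And>n x. 0 \<le> \<phi> n x \<and> \<phi> n x \<le> 1"
    "\<And>n x. x \<in> F n \<Longrightarrow> \<phi> n x \<ge> 1 - 1 / real (Suc n)" by metis
  have lim: "(\<lambda>n. \<phi> n x) \<longlonglongrightarrow> indicator E x" if N: "x \<notin> N1" "x \<notin> N2" for x
  proof (cases "x \<in> E")
    case True
    then obtain m where "x \<in> F m" using 1(3) F(3) N(1) by blast
    then have ev: "\<forall>\<^sub>F n in sequentially. 1 - 1 / real (Suc n) \<le> \<phi> n x"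
      using incseqD[OF F(2)] by (intro eventually_sequentiallyI[of m] \<phi>(3)) blast
    have "(\<lambda>n. 1 - 1 / real (Suc n)) \<longlonglongrightarrow> 1 - 0"
      by (intro tendsto_intros LIMSEQ_Suc[OF lim_inverse_n'])
    then have "(\<lambda>n. \<phi> n x) \<longlonglongrightarrow> 1"
      using \<phi>(2) by (intro tendsto_sandwich[OF ev _ _ tendsto_const]) auto
    then show ?thesis using True by simp
  next
    case False
    then obtain m where m: "x \<in> G m" using 2(3) G(3) N(2) by blast
    have "\<phi> n x = 0" if "n \<ge> m" for n
      using m incseqD[OF G(2) that] test_functions_outside[OF \<phi>(1), of x] by auto
    then have "(\<lambda>n. \<phi> n x) \<longlonglongrightarrow> 0"
      by (intro tendsto_eventually eventually_sequentiallyI[of m])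
    then show ?thesis using False by simp
  qed
  show thesis
  proof (rule that[of \<phi>])
    show "\<phi> n \<in> test_functions \<Omega>" for n using \<phi>(1) test_functions_mono[of "\<Omega> - G n" \<Omega>] by blast
    have "AE x in lebesgue. x \<notin> N1" "AE x in lebesgue. x \<notin> N2"
      using 1(2) 2(2) by (auto intro: AE_not_in)
    then show "AE x in lebesgue. (\<lambda>n. \<phi> n x) \<longlonglongrightarrow> indicator E x" by eventually_elim (rule lim)
  qed (use \<phi>(2) in auto)
qed

section \<open>Weak derivatives\<close>

lemma abs_le_1_square: "\<bar>u\<bar> \<le> 1 + (u::real)\<^sup>2"
  using zero_le_power2[of "\<bar>u\<bar> - 1"] zero_le_power2[of u] by (simp add: power2_diff)

lemma L2_spaceD: "u \<in> L2_space S \<Longrightarrow> integrable (lebesgue_on S) (\<lambda>x. (u x)\<^sup>2)"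
  "u \<in> L2_space S \<Longrightarrow> u \<in> borel_measurable (lebesgue_on S)"
  by (auto simp: L2_space_def)

lemma L2_space_integrable:
  assumes "S \<in> lmeasurable" "u \<in> L2_space S"
  shows "integrable (lebesgue_on S) u"
proof -
  interpret finite_measure "lebesgue_on S" using assms(1) by (rule finite_measure_lebesgue_on)
  have u: "u \<in> borel_measurable (lebesgue_on S)" "integrable (lebesgue_on S) (\<lambda>x. (u x)\<^sup>2)"
    using assms(2) by (auto simp: L2_space_def)
  have "integrable (lebesgue_on S) (\<lambda>x. 1 + (u x)\<^sup>2)" using u(2) by simp
  then show ?thesis
  proof (rule Bochner_Integration.integrable_bound[OF _ u(1)], intro always_eventually allI)
    show "norm (u x) \<le> norm (1 + (u x)\<^sup>2)" for x
      using abs_le_1_square[of "u x"] by simp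
  qed
qed

lemma L2_space_add:
  assumes "u \<in> L2_space S" "v \<in> L2_space S"
  shows "(\<lambda>x. a * u x + b * v x) \<in> L2_space S"
proof -
  have m: "u \<in> borel_measurable (lebesgue_on S)" "integrable (lebesgue_on S) (\<lambda>x. (u x)\<^sup>2)"
    "v \<in> borel_measurable (lebesgue_on S)" "integrable (lebesgue_on S) (\<lambda>x. (v x)\<^sup>2)"
    using assms by (auto simp: L2_space_def)
  then have [measurable]: "u \<in> borel_measurable (lebesgue_on S)" "v \<in> borel_measurable (lebesgue_on S)" by auto
  have "integrable (lebesgue_on S) (\<lambda>x. 2 * (a\<^sup>2 * (u x)\<^sup>2) + 2 * (b\<^sup>2 * (v x)\<^sup>2))" using m by simp
  then have "integrable (lebesgue_on S) (\<lambda>x. (a * u x + b * v x)\<^sup>2)"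
  proof (rule Bochner_Integration.integrable_bound, measurable, intro always_eventually allI)
    show "norm ((a * u x + b * v x)\<^sup>2) \<le> norm (2 * (a\<^sup>2 * (u x)\<^sup>2) + 2 * (b\<^sup>2 * (v x)\<^sup>2))" for x
    proof -
      have "(a * u x + b * v x)\<^sup>2 \<le> 2 * (a\<^sup>2 * (u x)\<^sup>2) + 2 * (b\<^sup>2 * (v x)\<^sup>2)"
        using zero_le_power2[of "a * u x - b * v x"]
        by (simp add: power2_sum power2_diff power_mult_distrib)
      then show ?thesis using abs_ge_self order_trans by simp
    qed
  qed
  then show ?thesis by (simp add: L2_space_def)
qed

lemma L2_space_mult_bounded:
  assumes "u \<in> L2_space S" "\<phi> \<in> borel_measurable borel" "\<And>x. \<bar>\<phi> x\<bar> \<le> B"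
  shows "(\<lambda>x. u x * \<phi> x) \<in> L2_space S"
proof -
  have [measurable]: "u \<in> borel_measurable (lebesgue_on S)" "\<phi> \<in> borel_measurable (lebesgue_on S)"
    and i: "integrable (lebesgue_on S) (\<lambda>x. (u x)\<^sup>2)"
    using assms by (auto simp: L2_space_def borel_measurable_lebesgue_on)
  from i have "integrable (lebesgue_on S) (\<lambda>x. B\<^sup>2 * (u x)\<^sup>2)" by simp
  then have "integrable (lebesgue_on S) (\<lambda>x. (u x * \<phi> x)\<^sup>2)"
  proof (rule Bochner_Integration.integrable_bound, measurable, intro always_eventually allI)
    show "norm ((u x * \<phi> x)\<^sup>2) \<le> norm (B\<^sup>2 * (u x)\<^sup>2)" for x
      using abs_le_square_iff[of "\<phi> x" B] assms(3)[of x] by (simp add: power_mult_distrib mult.commute[of "(u x)\<^sup>2"] mult_right_mono)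
  qed
  then show ?thesis by (simp add: L2_space_def)
qed

lemma test_functions_measurable_on:
  "\<phi> \<in> test_functions \<Omega> \<Longrightarrow> \<phi> \<in> borel_measurable (lebesgue_on S)"
  by (intro borel_measurable_lebesgue_on test_functions_measurable)

lemma L2_space_mult_test:
  assumes "u \<in> L2_space S" "\<phi> \<in> test_functions \<Omega>"
  shows "(\<lambda>x. u x * \<phi> x) \<in> L2_space S"
  using test_functions_bounded[OF assms(2)] L2_space_mult_bounded[OF assms(1) test_functions_measurable[OF assms(2)]] by metis

lemma AE_zero_if_all_integrals_zero:
  fixes f :: "'a \<Rightarrow> real"
  assumes "integrable M f" "\<And>E. E \<in> sets M \<Longrightarrow> (LINT x|M. indicator E x * f x) = 0"
  shows "AE x in M. f x = 0"
  using density_unique_real[of M f "\<lambda>x. 0"] assms by (simp add: set_lebesgue_integral_def)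

text \<open>Test functions approximate indicator functions boundedly almost everywhere, so that by dominated
  convergence the integral of \<open>g\<close> over every measurable set vanishes.\<close>

lemma AE_zero_if_orthogonal_to_test_functions:
  fixes \<Omega> :: "'a::euclidean_space set"
  assumes "open \<Omega>" "bounded \<Omega>" "integrable (lebesgue_on \<Omega>) g"
    and "\<And>\<phi>. \<phi> \<in> test_functions \<Omega> \<Longrightarrow> (LINT x|lebesgue_on \<Omega>. g x * \<phi> x) = 0"
  shows "AE x in lebesgue_on \<Omega>. g x = 0"
proof (rule AE_zero_if_all_integrals_zero[OF assms(3)])
  fix E assume "E \<in> sets (lebesgue_on \<Omega>)"
  moreover have \<Omega>: "\<Omega> \<in> sets lebesgue" using assms(1) by (rule sets_lebesgue_open)
  ultimately have E: "E \<in> sets lebesgue" "E \<subseteq> \<Omega>" by (auto simp: sets_restrict_space_iff)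
  obtain \<phi> :: "nat \<Rightarrow> 'a \<Rightarrow> real" where \<phi>: "\<And>n. \<phi> n \<in> test_functions \<Omega>" "\<And>n x. 0 \<le> \<phi> n x" "\<And>n x. \<phi> n x \<le> 1"
    "AE x in lebesgue. (\<lambda>n. \<phi> n x) \<longlonglongrightarrow> indicator E x"
    using indicator_limit_of_test_functions[OF assms(1) E] by metis
  have [measurable]: "\<phi> n \<in> borel_measurable (lebesgue_on \<Omega>)" for n
    using test_functions_measurable[OF \<phi>(1)] by (rule borel_measurable_lebesgue_on)
  have [measurable]: "g \<in> borel_measurable (lebesgue_on \<Omega>)" "E \<in> sets (lebesgue_on \<Omega>)"
    using assms(3) \<open>E \<in> sets (lebesgue_on \<Omega>)\<close> by auto
  have "(\<lambda>n. LINT x|lebesgue_on \<Omega>. g x * \<phi> n x) \<longlonglongrightarrow> (LINT x|lebesgue_on \<Omega>. g x * indicator E x)"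
  proof (rule integral_dominated_convergence[where w = "\<lambda>x. \<bar>g x\<bar>"])
    have "AE x in lebesgue_on \<Omega>. (\<lambda>n. \<phi> n x) \<longlonglongrightarrow> indicator E x"
      using \<phi>(4) \<Omega> by (auto simp: AE_restrict_space_iff elim: eventually_mono)
    then show "AE x in lebesgue_on \<Omega>. (\<lambda>n. g x * \<phi> n x) \<longlonglongrightarrow> g x * indicator E x"
      by eventually_elim (intro tendsto_intros)
    show "AE x in lebesgue_on \<Omega>. norm (g x * \<phi> n x) \<le> \<bar>g x\<bar>" for n
      using \<phi>(2,3)[of n] by (intro always_eventually allI) (auto simp: abs_mult mult_left_le)
    show "integrable (lebesgue_on \<Omega>) (\<lambda>x. \<bar>g x\<bar>)" using assms(3) by simp
  qed measurable
  then have "(LINT x|lebesgue_on \<Omega>. g x * indicator E x) = 0"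
    unfolding assms(4)[OF \<phi>(1)] by (simp add: LIMSEQ_const_iff)
  then show "(LINT x|lebesgue_on \<Omega>. indicator E x * g x) = 0" by (simp add: mult.commute)
qed

lemma integral_lebesgue_on_eq_lborel:
  fixes f :: "'a::euclidean_space \<Rightarrow> real"
  assumes "\<Omega> \<in> sets lebesgue" "f \<in> borel_measurable borel" "\<And>x. x \<notin> \<Omega> \<Longrightarrow> f x = 0"
  shows "integral\<^sup>L (lebesgue_on \<Omega>) f = integral\<^sup>L lborel f"
proof -
  have "(\<lambda>x. indicator \<Omega> x *\<^sub>R f x) = f" using assms(3) by (auto simp: fun_eq_iff indicator_def)
  then show ?thesis using assms by (simp add: integral_restrict_space integral_completion)
qed

lemma integrable_lebesgue_on_iff_lborel:
  fixes f :: "'a::euclidean_space \<Rightarrow> real"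
  assumes "\<Omega> \<in> sets lebesgue" "f \<in> borel_measurable borel" "\<And>x. x \<notin> \<Omega> \<Longrightarrow> f x = 0"
  shows "integrable (lebesgue_on \<Omega>) f \<longleftrightarrow> integrable lborel f"
proof -
  have "(\<lambda>x. indicator \<Omega> x *\<^sub>R f x) = f" using assms(3) by (auto simp: fun_eq_iff indicator_def)
  then show ?thesis using assms by (simp add: integrable_restrict_space integrable_completion)
qed

lemma DERIV_along_line:
  assumes "smooth_on \<psi> UNIV"
  shows "((\<lambda>\<sigma>. \<psi> (x + \<sigma> *\<^sub>R i)) has_real_derivative pderivative i \<psi> (x + \<sigma> *\<^sub>R i)) (at \<sigma>)"
proof -
  obtain D where D: "GDERIV \<psi> (x + \<sigma> *\<^sub>R i) :> D" using smooth_on_imp_GDERIV[OF assms UNIV_I] by blast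
  have "((\<lambda>\<sigma>. x + \<sigma> *\<^sub>R i) has_derivative (\<lambda>h. h *\<^sub>R i)) (at \<sigma>)"
    by (auto intro!: derivative_eq_intros)
  from has_derivative_compose[OF this D[unfolded gderiv_def]]
  show ?thesis unfolding GDERIV_pderivative[OF D] has_field_derivative_def
    by (rule has_derivative_eq_rhs) (auto simp: inner_commute mult.commute)
qed

lemma lborel_integral_translate:
  fixes f :: "'a::euclidean_space \<Rightarrow> real"
  assumes "f \<in> borel_measurable borel"
  shows "(LINT x|lborel. f (x + v)) = integral\<^sup>L lborel f"
proof -
  have "integral\<^sup>L (distr lborel borel ((+) v)) f = (LINT x|lborel. f (v + x))"
    using assms by (intro integral_distr) auto
  then show ?thesis by (simp add: lborel_distr_plus add.commute)
qed

lemma lborel_nn_integral_translate: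
  fixes f :: "'a::euclidean_space \<Rightarrow> ennreal"
  assumes "f \<in> borel_measurable borel"
  shows "(\<integral>\<^sup>+x. f (x + v) \<partial>lborel) = integral\<^sup>N lborel f"
proof -
  have "integral\<^sup>N (distr lborel borel ((+) v)) f = (\<integral>\<^sup>+x. f (v + x) \<partial>lborel)"
    using assms by (intro nn_integral_distr) auto
  then show ?thesis by (simp add: lborel_distr_plus add.commute)
qed

text \<open>Difference quotients have integral zero by translation invariance, and by the mean value
  theorem they are dominated by the supremum of the derivative.\<close>

lemma integral_pderivative_eq_0:
  fixes \<psi> :: "'a::euclidean_space \<Rightarrow> real"
  assumes "\<psi> \<in> test_functions \<Omega>" "i \<in> Basis"
  shows "integral\<^sup>L lborel (pderivative i \<psi>) = 0"
proof -
  obtain C where C: "smooth_on \<psi> UNIV" "compact C" "\<And>x. x \<notin> C \<Longrightarrow> \<psi> x = 0"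
    using assms test_functionsE by metis
  obtain B where B: "\<And>x. \<bar>pderivative i \<psi> x\<bar> \<le> B"
    using test_functions_bounded[OF test_functions_pderivative[OF assms]] by metis
  obtain r where r: "\<And>x. x \<in> C \<Longrightarrow> norm x \<le> r" using compact_imp_bounded[OF C(2)] bounded_iff by metis
  have [measurable]: "\<psi> \<in> borel_measurable borel" "pderivative i \<psi> \<in> borel_measurable borel"
    using test_functions_measurable test_functions_pderivative[OF assms] assms(1) by blast+
  define q where "q n x = (\<psi> (x + (1 / Suc n) *\<^sub>R i) - \<psi> x) * Suc n" for n x
  have [measurable]: "q n \<in> borel_measurable borel" for n unfolding q_def by measurable
  have int: "integrable lborel \<psi>" by (rule test_functions_integrable[OF assms(1)])
  have int': "integrable lborel (\<lambda>x. \<psi> (x + v))" for v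
  proof -
    have "integrable (distr lborel borel ((+) v)) \<psi>" using int by (simp add: lborel_distr_plus)
    then show ?thesis by (subst (asm) integrable_distr_eq) (auto simp: add.commute)
  qed
  have "integral\<^sup>L lborel (q n) = 0" for n
    unfolding q_def using int int' by (simp add: lborel_integral_translate)
  moreover have "(\<lambda>n. integral\<^sup>L lborel (q n)) \<longlonglongrightarrow> integral\<^sup>L lborel (pderivative i \<psi>)"
  proof (rule integral_dominated_convergence[where w = "\<lambda>x. B * indicator (cball 0 (r + 1)) x"])
    show "integrable lborel (\<lambda>x. B * indicator (cball (0 :: 'a) (r + 1)) x :: real)"
      using emeasure_lborel_cball_finite[of "0 :: 'a" "r + 1"]
      by (intro integrable_mult_right integrable_real_indicator) (auto simp: infinity_ennreal_def)
    show "AE x in lborel. (\<lambda>n. q n x) \<longlonglongrightarrow> pderivative i \<psi> x"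
    proof (intro always_eventually allI)
      fix x
      have "((\<lambda>h. (\<psi> (x + h *\<^sub>R i) - \<psi> x) / h) \<longlongrightarrow> pderivative i \<psi> x) (at 0)"
        using DERIV_along_line[OF C(1), of x i 0] by (simp add: has_field_derivative_iff)
      moreover have "filterlim (\<lambda>n. 1 / real (Suc n)) (at 0) sequentially"
        by (rule filterlim_atI[OF LIMSEQ_Suc[OF lim_inverse_n']]) auto
      ultimately have "((\<lambda>n. (\<psi> (x + (1 / real (Suc n)) *\<^sub>R i) - \<psi> x) / (1 / real (Suc n))) \<longlongrightarrow> pderivative i \<psi> x) sequentially"
        by (rule filterlim_compose)
      then show "(\<lambda>n. q n x) \<longlonglongrightarrow> pderivative i \<psi> x" by (simp add: q_def)
    qed
    show "AE x in lborel. norm (q n x) \<le> B * indicator (cball 0 (r + 1)) x" for n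
    proof (intro always_eventually allI)
      fix x
      show "norm (q n x) \<le> B * indicator (cball 0 (r + 1)) x"
      proof (cases "x \<in> cball 0 (r + 1)")
        case True
        have "\<exists>\<xi>::real. 0 < \<xi> \<and> \<xi> < 1 / Suc n \<and> \<psi> (x + (1 / Suc n) *\<^sub>R i) - \<psi> (x + 0 *\<^sub>R i)
            = (1 / Suc n - 0) * pderivative i \<psi> (x + \<xi> *\<^sub>R i)"
          by (rule MVT2) (auto intro: DERIV_along_line[OF C(1)])
        then obtain \<xi> :: real where "\<psi> (x + (1 / Suc n) *\<^sub>R i) - \<psi> (x + 0 *\<^sub>R i)
            = (1 / Suc n - 0) * pderivative i \<psi> (x + \<xi> *\<^sub>R i)" by metis
        then have "q n x = pderivative i \<psi> (x + \<xi> *\<^sub>R i)" by (simp add: q_def field_simps)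
        then show ?thesis using B True by simp
      next
        case False
        have "x \<notin> C" using False r by force
        moreover have "x + (1 / Suc n) *\<^sub>R i \<notin> C"
        proof
          assume "x + (1 / Suc n) *\<^sub>R i \<in> C"
          then have "norm (x + (1 / Suc n) *\<^sub>R i) \<le> r" by (rule r)
          moreover have "norm ((1 / Suc n) *\<^sub>R i) \<le> 1" using assms(2) by simp
          moreover have "norm x \<le> norm (x + (1 / Suc n) *\<^sub>R i) + norm ((1 / Suc n) *\<^sub>R i)"
            using norm_triangle_ineq4[of "x + (1 / Suc n) *\<^sub>R i" "(1 / Suc n) *\<^sub>R i"] by simp
          ultimately have "norm x \<le> r + 1" by linarith
          then show False using False by simp
        qed
        ultimately show ?thesis using False by (simp add: q_def C(3))
      qed
    qed
  qed measurable
  ultimately show ?thesis by (simp add: LIMSEQ_const_iff)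
qed

lemma integration_by_parts:
  assumes "u \<in> test_functions \<Omega>" "smooth_on \<phi> UNIV" "i \<in> Basis"
  shows "(LINT x|lborel. u x * pderivative i \<phi> x) = - (LINT x|lborel. pderivative i u x * \<phi> x)"
proof -
  have s: "smooth_on u UNIV" using assms(1) test_functionsE by metis
  have i1: "integrable lborel (\<lambda>x. u x * pderivative i \<phi> x)"
    by (intro test_functions_integrable[OF test_functions_mult[OF assms(1)]] smooth_on_pderivative assms(2,3))
  have i2: "integrable lborel (\<lambda>x. pderivative i u x * \<phi> x)"
    by (intro test_functions_integrable[OF test_functions_mult[OF test_functions_pderivative[OF assms(1)]]] assms(2,3))
  have "integral\<^sup>L lborel (pderivative i (\<lambda>x. u x * \<phi> x)) = 0"
    by (intro integral_pderivative_eq_0[OF test_functions_mult[OF assms(1)]] assms(2,3))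
  then show ?thesis unfolding pderivative_mult[OF s assms(2)] using i1 i2 by simp
qed

lemma weak_partial_iff:
  "weak_partial \<Omega> i u g \<longleftrightarrow> (\<forall>\<phi>\<in>test_functions \<Omega>.
     (LINT x|lebesgue_on \<Omega>. u x * pderivative i \<phi> x) = - (LINT x|lebesgue_on \<Omega>. g x * \<phi> x))"
  by (simp add: weak_partial_def pderivative_def)

lemma test_function_L2:
  assumes "\<phi> \<in> test_functions \<Omega>" "S \<in> sets lebesgue"
  shows "\<phi> \<in> L2_space S"
proof -
  have "integrable lborel (\<lambda>x. (\<phi> x)\<^sup>2)"
    unfolding power2_eq_square using assms(1) test_functionsE by (metis test_functions_integrable test_functions_mult)
  moreover have m: "\<phi> \<in> borel_measurable borel" using test_functions_measurable[OF assms(1)] .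
  ultimately have "integrable lebesgue (\<lambda>x. (\<phi> x)\<^sup>2)" by (subst integrable_completion) auto
  then have "integrable (lebesgue_on S) (\<lambda>x. (\<phi> x)\<^sup>2)"
    using assms(2) integrable_mult_indicator[of S lebesgue "\<lambda>x. (\<phi> x)\<^sup>2"] by (simp add: integrable_restrict_space)
  then show ?thesis using borel_measurable_lebesgue_on[OF m] by (simp add: L2_space_def)
qed

lemma weak_partial_test_function:
  assumes "open \<Omega>" "u \<in> test_functions \<Omega>" "i \<in> Basis"
  shows "weak_partial \<Omega> i u (pderivative i u)"
  unfolding weak_partial_iff
proof
  fix \<phi> assume \<phi>: "\<phi> \<in> test_functions \<Omega>"
  have \<Omega>: "\<Omega> \<in> sets lebesgue" using assms(1) by (rule sets_lebesgue_open)
  have [measurable]: "u \<in> borel_measurable borel" "\<phi> \<in> borel_measurable borel"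
    "pderivative i u \<in> borel_measurable borel" "pderivative i \<phi> \<in> borel_measurable borel"
    using test_functions_measurable test_functions_pderivative assms(2,3) \<phi> by blast+
  have "smooth_on \<phi> UNIV" using \<phi> test_functionsE by metis
  from integration_by_parts[OF assms(2) this assms(3)]
  show "(LINT x|lebesgue_on \<Omega>. u x * pderivative i \<phi> x) = - (LINT x|lebesgue_on \<Omega>. pderivative i u x * \<phi> x)"
    using test_functions_outside[OF assms(2)] test_functions_outside[OF \<phi>] \<Omega>
    by (simp add: integral_lebesgue_on_eq_lborel)
qed

lemma integrable_L2_mult_test:
  assumes "open \<Omega>" "bounded \<Omega>" "u \<in> L2_space \<Omega>" "\<phi> \<in> test_functions \<Omega>"
  shows "integrable (lebesgue_on \<Omega>) (\<lambda>x. u x * \<phi> x)"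
  using assms by (intro L2_space_integrable L2_space_mult_test) (auto simp: lmeasurable_open)

text \<open>This makes the choice in \<open>wpartial\<close> harmless: it agrees almost everywhere with every weak
  derivative in \<open>L\<^sup>2\<close> that is known by other means.\<close>

lemma weak_partial_unique:
  assumes \<Omega>: "open \<Omega>" "bounded \<Omega>" and "g \<in> L2_space \<Omega>" "weak_partial \<Omega> i u g"
    and "h \<in> L2_space \<Omega>" "weak_partial \<Omega> i u h"
  shows "AE x in lebesgue_on \<Omega>. g x = h x"
proof -
  have "AE x in lebesgue_on \<Omega>. 1 * g x + (- 1) * h x = 0"
  proof (rule AE_zero_if_orthogonal_to_test_functions[OF \<Omega>])
    show "integrable (lebesgue_on \<Omega>) (\<lambda>x. 1 * g x + (- 1) * h x)"
      using assms by (intro L2_space_integrable L2_space_add) (auto simp: lmeasurable_open)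
    show "(LINT x|lebesgue_on \<Omega>. (1 * g x + (- 1) * h x) * \<phi> x) = 0" if "\<phi> \<in> test_functions \<Omega>" for \<phi>
      using integrable_L2_mult_test[OF \<Omega> assms(3) that] integrable_L2_mult_test[OF \<Omega> assms(5) that]
        assms(4,6) that by (simp add: weak_partial_iff left_diff_distrib)
  qed
  then show ?thesis by simp
qed

lemma wpartial_L2:
  assumes "g \<in> L2_space \<Omega>" "weak_partial \<Omega> i u g"
  shows "wpartial \<Omega> i u \<in> L2_space \<Omega>" "weak_partial \<Omega> i u (wpartial \<Omega> i u)"
  using someI[of "\<lambda>g. g \<in> L2_space \<Omega> \<and> weak_partial \<Omega> i u g" g] assms
  by (auto simp: wpartial_def)

lemma wpartial_AE_eq:
  assumes "open \<Omega>" "bounded \<Omega>" "g \<in> L2_space \<Omega>" "weak_partial \<Omega> i u g"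
  shows "AE x in lebesgue_on \<Omega>. wpartial \<Omega> i u x = g x"
  using weak_partial_unique[OF assms(1,2) wpartial_L2[OF assms(3,4)] assms(3,4)] .

lemma weak_partial_add:
  assumes \<Omega>: "open \<Omega>" "bounded \<Omega>" and i: "i \<in> Basis"
    and "u \<in> L2_space \<Omega>" "g \<in> L2_space \<Omega>" "weak_partial \<Omega> i u g"
    and "v \<in> L2_space \<Omega>" "h \<in> L2_space \<Omega>" "weak_partial \<Omega> i v h"
  shows "weak_partial \<Omega> i (\<lambda>x. a * u x + b * v x) (\<lambda>x. a * g x + b * h x)"
  unfolding weak_partial_iff
proof
  fix \<phi> assume \<phi>: "\<phi> \<in> test_functions \<Omega>"
  note \<phi>' = test_functions_pderivative[OF \<phi> i]
  show "(LINT x|lebesgue_on \<Omega>. (a * u x + b * v x) * pderivative i \<phi> x) = - (LINT x|lebesgue_on \<Omega>. (a * g x + b * h x) * \<phi> x)"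
    using integrable_L2_mult_test[OF \<Omega> assms(4) \<phi>'] integrable_L2_mult_test[OF \<Omega> assms(7) \<phi>']
      integrable_L2_mult_test[OF \<Omega> assms(5) \<phi>] integrable_L2_mult_test[OF \<Omega> assms(8) \<phi>] assms(6,9) \<phi>
    by (simp add: weak_partial_iff distrib_right mult.assoc)
qed

lemma weak_partial_cong_AE:
  assumes "i \<in> Basis" "u \<in> L2_space \<Omega>" "v \<in> L2_space \<Omega>" "AE x in lebesgue_on \<Omega>. u x = v x" "weak_partial \<Omega> i u g"
  shows "weak_partial \<Omega> i v g"
  unfolding weak_partial_iff
proof
  fix \<phi> assume \<phi>: "\<phi> \<in> test_functions \<Omega>"
  have [measurable]: "pderivative i \<phi> \<in> borel_measurable (lebesgue_on \<Omega>)"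
    "u \<in> borel_measurable (lebesgue_on \<Omega>)" "v \<in> borel_measurable (lebesgue_on \<Omega>)"
    using test_functions_measurable_on[OF test_functions_pderivative[OF \<phi> assms(1)]]
     assms(2,3) by (auto simp: L2_space_def)
  have "AE x in lebesgue_on \<Omega>. v x * pderivative i \<phi> x = u x * pderivative i \<phi> x"
    using assms(4) by eventually_elim simp
  then have "(LINT x|lebesgue_on \<Omega>. v x * pderivative i \<phi> x) = (LINT x|lebesgue_on \<Omega>. u x * pderivative i \<phi> x)"
    by (intro integral_cong_AE) measurable
  then show "(LINT x|lebesgue_on \<Omega>. v x * pderivative i \<phi> x) = - (LINT x|lebesgue_on \<Omega>. g x * \<phi> x)"
    using assms(5) \<phi> by (simp add: weak_partial_iff)
qed

lemma Sobolev_H_imp_L2: "u \<in> Sobolev_H k \<Omega> \<Longrightarrow> u \<in> L2_space \<Omega>"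
  by (cases k) auto

lemma Sobolev_H_wpartial:
  assumes "u \<in> Sobolev_H (Suc k) \<Omega>" "i \<in> Basis"
  shows "wpartial \<Omega> i u \<in> L2_space \<Omega>" "weak_partial \<Omega> i u (wpartial \<Omega> i u)"
proof -
  obtain g where "g \<in> Sobolev_H k \<Omega>" "weak_partial \<Omega> i u g" using assms by auto
  then show "wpartial \<Omega> i u \<in> L2_space \<Omega>" "weak_partial \<Omega> i u (wpartial \<Omega> i u)"
    using wpartial_L2 Sobolev_H_imp_L2 by blast+
qed

text \<open>The membership is witnessed by some weak derivative; the one picked by \<open>wpartial\<close> equals it only
  almost everywhere, so higher weak derivatives have to be transported along that equality.\<close>

lemma Sobolev_H_Suc_wpartial:
  assumes \<Omega>: "open \<Omega>" "bounded \<Omega>" and u: "u \<in> Sobolev_H (Suc k) \<Omega>" and i: "i \<in> Basis"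
  shows "wpartial \<Omega> i u \<in> Sobolev_H k \<Omega>"
proof -
  obtain g where g: "g \<in> Sobolev_H k \<Omega>" "weak_partial \<Omega> i u g" using u i by auto
  note w = Sobolev_H_wpartial[OF u i]
  have ae: "AE x in lebesgue_on \<Omega>. g x = wpartial \<Omega> i u x"
    using weak_partial_unique[OF \<Omega> Sobolev_H_imp_L2[OF g(1)] g(2) w] .
  show ?thesis
  proof (cases k)
    case (Suc m)
    have "\<exists>h\<in>Sobolev_H m \<Omega>. weak_partial \<Omega> j (wpartial \<Omega> i u) h" if j: "j \<in> Basis" for j
    proof -
      obtain h where "h \<in> Sobolev_H m \<Omega>" "weak_partial \<Omega> j g h" using g(1) j Suc by auto
      then show ?thesis using weak_partial_cong_AE[OF j Sobolev_H_imp_L2[OF g(1)] w(1) ae] by blast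
    qed
    then show ?thesis using w(1) Suc by simp
  qed (use w in simp)
qed

text \<open>This identifies weak derivatives of functions that are not smooth but limits of test functions.\<close>

lemma weak_partial_limit:
  assumes \<Omega>: "open \<Omega>" and i: "i \<in> Basis"
    and f: "\<And>n. f n \<in> test_functions \<Omega>"
    and lim: "AE x in lebesgue_on \<Omega>. (\<lambda>n. f n x) \<longlonglongrightarrow> u x" "AE x in lebesgue_on \<Omega>. (\<lambda>n. pderivative i (f n) x) \<longlonglongrightarrow> g x"
    and m: "u \<in> borel_measurable (lebesgue_on \<Omega>)" "g \<in> borel_measurable (lebesgue_on \<Omega>)"
    and w: "integrable (lebesgue_on \<Omega>) w" "\<And>n. AE x in lebesgue_on \<Omega>. \<bar>f n x\<bar> \<le> w x"
      "\<And>n. AE x in lebesgue_on \<Omega>. \<bar>pderivative i (f n) x\<bar> \<le> w x"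
  shows "weak_partial \<Omega> i u g"
  unfolding weak_partial_iff
proof
  fix \<phi> assume \<phi>: "\<phi> \<in> test_functions \<Omega>"
  note \<phi>' = test_functions_pderivative[OF \<phi> i]
  note [measurable] = m test_functions_measurable_on[OF \<phi>]
     test_functions_measurable_on[OF \<phi>']
     test_functions_measurable_on[OF f]
     test_functions_measurable_on[OF test_functions_pderivative[OF f i]]
  obtain B B' where B: "\<And>x. \<bar>\<phi> x\<bar> \<le> B" "\<And>x. \<bar>pderivative i \<phi> x\<bar> \<le> B'"
    using test_functions_bounded[OF \<phi>] test_functions_bounded[OF \<phi>'] by metis
  have *: "\<bar>a * b\<bar> \<le> w x * C" if "\<bar>a\<bar> \<le> w x" "\<bar>b\<bar> \<le> C" for a b C x
    unfolding abs_mult using that by (intro mult_mono) auto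
  have "(\<lambda>n. LINT x|lebesgue_on \<Omega>. f n x * pderivative i \<phi> x) \<longlonglongrightarrow> (LINT x|lebesgue_on \<Omega>. u x * pderivative i \<phi> x)"
  proof (rule integral_dominated_convergence[where w = "\<lambda>x. w x * B'"])
    show "AE x in lebesgue_on \<Omega>. (\<lambda>n. f n x * pderivative i \<phi> x) \<longlonglongrightarrow> u x * pderivative i \<phi> x"
      using lim(1) by eventually_elim (intro tendsto_intros)
    show "AE x in lebesgue_on \<Omega>. norm (f n x * pderivative i \<phi> x) \<le> w x * B'" for n
      using w(2)[of n] by eventually_elim (auto intro!: * B(2))
    show "integrable (lebesgue_on \<Omega>) (\<lambda>x. w x * B')" using w(1) by simp
  qed measurable
  moreover have "(\<lambda>n. LINT x|lebesgue_on \<Omega>. pderivative i (f n) x * \<phi> x) \<longlonglongrightarrow> (LINT x|lebesgue_on \<Omega>. g x * \<phi> x)"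
  proof (rule integral_dominated_convergence[where w = "\<lambda>x. w x * B"])
    show "AE x in lebesgue_on \<Omega>. (\<lambda>n. pderivative i (f n) x * \<phi> x) \<longlonglongrightarrow> g x * \<phi> x"
      using lim(2) by eventually_elim (intro tendsto_intros)
    show "AE x in lebesgue_on \<Omega>. norm (pderivative i (f n) x * \<phi> x) \<le> w x * B" for n
      using w(3)[of n] by eventually_elim (auto intro!: * B(1))
    show "integrable (lebesgue_on \<Omega>) (\<lambda>x. w x * B)" using w(1) by simp
  qed measurable
  moreover have "(LINT x|lebesgue_on \<Omega>. f n x * pderivative i \<phi> x) = - (LINT x|lebesgue_on \<Omega>. pderivative i (f n) x * \<phi> x)" for n
    using weak_partial_test_function[OF \<Omega> f i] \<phi> by (simp add: weak_partial_iff)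
  ultimately show "(LINT x|lebesgue_on \<Omega>. u x * pderivative i \<phi> x) = - (LINT x|lebesgue_on \<Omega>. g x * \<phi> x)"
    using LIMSEQ_unique[OF _ tendsto_minus] by (metis (no_types, lifting) ext)
qed

section \<open>Functions in the Sobolev space on thin slabs\<close>

text \<open>By Tonelli and the translation \<open>x \<mapsto> x - \<sigma> *\<^sub>R e\<close> the left side becomes the integral of \<open>q x\<close> against
  \<open>h (x \<bullet> e - \<sigma>)\<close> integrated over \<open>\<sigma>\<close>. With \<open>h\<close> the indicator of a short interval this bounds integrals
  over thin slabs; with \<open>h\<close> a singular power it gives integrability across a hyperplane.\<close>

lemma nn_integral_slab:
  fixes q :: "'a::euclidean_space \<Rightarrow> ennreal" and h :: "real \<Rightarrow> ennreal"
  assumes [measurable]: "h \<in> borel_measurable borel" "q \<in> borel_measurable borel" and e: "e \<in> Basis"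
  shows "(\<integral>\<^sup>+x. h (x \<bullet> e) * (\<integral>\<^sup>+\<sigma>. indicator {0..D} \<sigma> * q (x + \<sigma> *\<^sub>R e) \<partial>lborel) \<partial>lborel)
    \<le> integral\<^sup>N lborel h * integral\<^sup>N lborel q"
proof -
  have "(\<integral>\<^sup>+x. h (x \<bullet> e) * (\<integral>\<^sup>+\<sigma>. indicator {0..D} \<sigma> * q (x + \<sigma> *\<^sub>R e) \<partial>lborel) \<partial>lborel)
      = (\<integral>\<^sup>+x. (\<integral>\<^sup>+\<sigma>. h (x \<bullet> e) * (indicator {0..D} \<sigma> * q (x + \<sigma> *\<^sub>R e)) \<partial>lborel) \<partial>lborel)"
    by (intro nn_integral_cong nn_integral_cmult[symmetric]) measurable
  also have "\<dots> = (\<integral>\<^sup>+\<sigma>. (\<integral>\<^sup>+x. h (x \<bullet> e) * (indicator {0..D} \<sigma> * q (x + \<sigma> *\<^sub>R e)) \<partial>lborel) \<partial>lborel)"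
    by (rule lborel_pair.Fubini'[symmetric]) measurable
  also have "\<dots> = (\<integral>\<^sup>+\<sigma>. (\<integral>\<^sup>+x. h (x \<bullet> e - \<sigma>) * (indicator {0..D} \<sigma> * q x) \<partial>lborel) \<partial>lborel)"
  proof (rule nn_integral_cong)
    fix \<sigma> :: real
    have "(\<integral>\<^sup>+x. h ((x + \<sigma> *\<^sub>R e) \<bullet> e - \<sigma>) * (indicator {0..D} \<sigma> * q (x + \<sigma> *\<^sub>R e)) \<partial>lborel)
        = (\<integral>\<^sup>+x. h (x \<bullet> e - \<sigma>) * (indicator {0..D} \<sigma> * q x) \<partial>lborel)"
      by (rule lborel_nn_integral_translate) measurable
    then show "(\<integral>\<^sup>+x. h (x \<bullet> e) * (indicator {0..D} \<sigma> * q (x + \<sigma> *\<^sub>R e)) \<partial>lborel)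
        = (\<integral>\<^sup>+x. h (x \<bullet> e - \<sigma>) * (indicator {0..D} \<sigma> * q x) \<partial>lborel)"
      using e by (simp add: inner_add_left)
  qed
  also have "\<dots> = (\<integral>\<^sup>+x. (\<integral>\<^sup>+\<sigma>. h (x \<bullet> e - \<sigma>) * (indicator {0..D} \<sigma> * q x) \<partial>lborel) \<partial>lborel)"
    by (rule lborel_pair.Fubini') measurable
  also have "\<dots> \<le> (\<integral>\<^sup>+x. (\<integral>\<^sup>+\<sigma>. h (x \<bullet> e - \<sigma>) * q x \<partial>lborel) \<partial>lborel)"
    by (intro nn_integral_mono) (auto simp: indicator_def)
  also have "\<dots> = (\<integral>\<^sup>+x. (\<integral>\<^sup>+\<sigma>. h (x \<bullet> e - \<sigma>) \<partial>lborel) * q x \<partial>lborel)"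
    by (intro nn_integral_cong nn_integral_multc) measurable
  also have "\<dots> = (\<integral>\<^sup>+x. integral\<^sup>N lborel h * q x \<partial>lborel)"
  proof (intro nn_integral_cong)
    fix x :: 'a
    show "(\<integral>\<^sup>+\<sigma>. h (x \<bullet> e - \<sigma>) \<partial>lborel) * q x = integral\<^sup>N lborel h * q x"
      using nn_integral_real_affine[of h "-1" "x \<bullet> e"] by simp
  qed
  also have "\<dots> = integral\<^sup>N lborel h * integral\<^sup>N lborel q"
    by (intro nn_integral_cmult) measurable
  finally show ?thesis .
qed

text \<open>The Cauchy-Schwarz inequality against the constant 1.\<close>

lemma square_integral_le:
  fixes g :: "real \<Rightarrow> real"
  assumes [measurable]: "g \<in> borel_measurable borel" "A \<in> sets borel"
  shows "ennreal ((LINT s|lborel. g s * indicator A s)\<^sup>2) \<le> emeasure lborel A * (\<integral>\<^sup>+s. indicator A s * ennreal ((g s)\<^sup>2) \<partial>lborel)"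
proof -
  have "ennreal \<bar>LINT s|lborel. g s * indicator A s\<bar> \<le> (\<integral>\<^sup>+s. indicator A s * ennreal \<bar>g s * indicator A s\<bar> \<partial>lborel)"
  proof (cases "integrable lborel (\<lambda>s. g s * indicator A s)")
    case True
    have "ennreal (norm (LINT s|lborel. g s * indicator A s)) \<le> (\<integral>\<^sup>+s. ennreal (norm (g s * indicator A s)) \<partial>lborel)"
      using True by (rule integral_norm_bound_ennreal)
    also have "\<dots> = (\<integral>\<^sup>+s. indicator A s * ennreal \<bar>g s * indicator A s\<bar> \<partial>lborel)"
      by (intro nn_integral_cong) (auto simp: indicator_def)
    finally show ?thesis by simp
  qed (simp add: not_integrable_integral_eq)
  then have "(ennreal \<bar>LINT s|lborel. g s * indicator A s\<bar>)\<^sup>2 \<le> (\<integral>\<^sup>+s. indicator A s * ennreal \<bar>g s * indicator A s\<bar> \<partial>lborel)\<^sup>2"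
    by (intro power_mono) auto
  also have "\<dots> \<le> (\<integral>\<^sup>+s. (indicator A s)\<^sup>2 \<partial>lborel) * (\<integral>\<^sup>+s. (ennreal \<bar>g s * indicator A s\<bar>)\<^sup>2 \<partial>lborel)"
    by (rule Cauchy_Schwarz_nn_integral) measurable
  also have "(\<integral>\<^sup>+s. (indicator A s)\<^sup>2 \<partial>lborel) = (\<integral>\<^sup>+s. indicator A s \<partial>lborel)"
    by (intro nn_integral_cong) (auto simp: indicator_def)
  also have "\<dots> = emeasure lborel A" by simp
  also have "(\<integral>\<^sup>+s. (ennreal \<bar>g s * indicator A s\<bar>)\<^sup>2 \<partial>lborel) = (\<integral>\<^sup>+s. indicator A s * ennreal ((g s)\<^sup>2) \<partial>lborel)"
    by (intro nn_integral_cong) (auto simp: indicator_def ennreal_power)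
  finally show ?thesis by (simp add: ennreal_power)
qed

text \<open>Integrate the derivative along a segment in direction \<open>e\<close> that ends outside the support.\<close>

lemma test_function_square_le:
  fixes \<phi> :: "'a::euclidean_space \<Rightarrow> real"
  assumes \<phi>: "\<phi> \<in> test_functions \<Omega>" and e: "e \<in> Basis" and D: "D \<ge> 0" "\<phi> (x + D *\<^sub>R e) = 0"
  shows "ennreal ((\<phi> x)\<^sup>2) \<le> ennreal D * (\<integral>\<^sup>+\<sigma>. indicator {0..D} \<sigma> * ennreal ((pderivative e \<phi> (x + \<sigma> *\<^sub>R e))\<^sup>2) \<partial>lborel)"
proof -
  have s: "smooth_on \<phi> UNIV" using \<phi> test_functionsE by metis
  have c: "continuous_on UNIV (pderivative e \<phi>)"
    using test_functions_pderivative[OF \<phi> e] test_functionsE smooth_on_imp_continuous_on by metis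
  have c': "continuous_on UNIV (\<lambda>\<sigma>. pderivative e \<phi> (x + \<sigma> *\<^sub>R e))"
    by (rule continuous_on_compose2[OF c]) (auto intro!: continuous_intros)
  have "has_bochner_integral lborel (\<lambda>\<sigma>. pderivative e \<phi> (x + \<sigma> *\<^sub>R e) * indicator {0..D} \<sigma>) (\<phi> (x + D *\<^sub>R e) - \<phi> (x + 0 *\<^sub>R e))"
    by (rule has_bochner_integral_FTC_Icc_real[OF D(1) DERIV_along_line[OF s]])
      (use c' in \<open>auto simp: continuous_on_eq_continuous_at\<close>)
  then have "(LINT \<sigma>|lborel. pderivative e \<phi> (x + \<sigma> *\<^sub>R e) * indicator {0..D} \<sigma>) = - \<phi> x"
    using D(2) by (simp add: has_bochner_integral_iff)
  then show ?thesis
    using square_integral_le[of "\<lambda>\<sigma>. pderivative e \<phi> (x + \<sigma> *\<^sub>R e)" "{0..D}"] D(1) c'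
    by (simp add: borel_measurable_continuous_onI)
qed

lemma test_function_slab:
  fixes \<Omega> :: "'a::euclidean_space set"
  assumes \<Omega>: "open \<Omega>" "bounded \<Omega>" and e: "e \<in> Basis"
  shows "\<exists>D\<ge>0. \<forall>\<phi>\<in>test_functions \<Omega>. \<forall>I\<in>sets borel. \<forall>l\<ge>0. emeasure lborel I \<le> ennreal l \<longrightarrow>
    (LINT x|lebesgue_on \<Omega>. indicator I (x \<bullet> e) * (\<phi> x)\<^sup>2) \<le> D * l * (LINT x|lebesgue_on \<Omega>. (pderivative e \<phi> x)\<^sup>2)"
proof -
  obtain R where R: "R > 0" "\<And>x. x \<in> \<Omega> \<Longrightarrow> norm x \<le> R" using \<Omega>(2) bounded_pos by metis
  \<comment> \<open>larger than the diameter of \<open>\<Omega>\<close>, so that \<open>x + D *\<^sub>R e\<close> lies outside for every \<open>x\<close> in \<open>\<Omega>\<close>\<close>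
  define D where "D = 3 * R"
  have D: "D \<ge> 0" using R by (simp add: D_def)
  have out: "x + D *\<^sub>R e \<notin> \<Omega>" if "x \<in> \<Omega>" for x
  proof
    assume "x + D *\<^sub>R e \<in> \<Omega>"
    then have "norm (x + D *\<^sub>R e) \<le> R" "norm x \<le> R" using R that by auto
    then have "norm (D *\<^sub>R e) \<le> R + R" using norm_triangle_ineq4[of "x + D *\<^sub>R e" x] by simp
    then show False using R e by (simp add: D_def)
  qed
  have main: "(LINT x|lebesgue_on \<Omega>. indicator I (x \<bullet> e) * (\<phi> x)\<^sup>2) \<le> D * l * (LINT x|lebesgue_on \<Omega>. (pderivative e \<phi> x)\<^sup>2)"
    if \<phi>: "\<phi> \<in> test_functions \<Omega>" and [measurable]: "I \<in> sets borel" and l: "l \<ge> 0" "emeasure lborel I \<le> ennreal l" for \<phi> I l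
  proof -
    note \<phi>' = test_functions_pderivative[OF \<phi> e]
    have [measurable]: "\<phi> \<in> borel_measurable borel" "pderivative e \<phi> \<in> borel_measurable borel"
      using \<phi> \<phi>' test_functions_measurable by blast+
    have \<Omega>': "\<Omega> \<in> sets lebesgue" using \<Omega>(1) by (rule sets_lebesgue_open)
    have *: "ennreal (indicator I (x \<bullet> e) * (\<phi> x)\<^sup>2)
      \<le> ennreal D * (indicator I (x \<bullet> e) * (\<integral>\<^sup>+\<sigma>. indicator {0..D} \<sigma> * ennreal ((pderivative e \<phi> (x + \<sigma> *\<^sub>R e))\<^sup>2) \<partial>lborel))" for x
    proof (cases "x \<in> \<Omega> \<and> x \<bullet> e \<in> I")
      case True
      have "\<phi> (x + D *\<^sub>R e) = 0" using out True test_functions_outside[OF \<phi>] by blast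
      from test_function_square_le[OF \<phi> e D this] show ?thesis using True by simp
    next
      case False
      then have "indicator I (x \<bullet> e) * (\<phi> x)\<^sup>2 = 0" using test_functions_outside[OF \<phi>, of x] by auto
      then show ?thesis unfolding \<open>_ = 0\<close> by simp
    qed
    have "(\<integral>\<^sup>+x. ennreal (indicator I (x \<bullet> e) * (\<phi> x)\<^sup>2) \<partial>lborel)
      \<le> (\<integral>\<^sup>+x. ennreal D * (indicator I (x \<bullet> e) * (\<integral>\<^sup>+\<sigma>. indicator {0..D} \<sigma> * ennreal ((pderivative e \<phi> (x + \<sigma> *\<^sub>R e))\<^sup>2) \<partial>lborel)) \<partial>lborel)"
      by (intro nn_integral_mono *)
    also have "\<dots> = ennreal D * (\<integral>\<^sup>+x. indicator I (x \<bullet> e) * (\<integral>\<^sup>+\<sigma>. indicator {0..D} \<sigma> * ennreal ((pderivative e \<phi> (x + \<sigma> *\<^sub>R e))\<^sup>2) \<partial>lborel) \<partial>lborel)"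
      by (rule nn_integral_cmult) measurable
    also have "\<dots> \<le> ennreal D * ((\<integral>\<^sup>+s. indicator I s \<partial>lborel) * (\<integral>\<^sup>+x. ennreal ((pderivative e \<phi> x)\<^sup>2) \<partial>lborel))"
      by (intro mult_left_mono nn_integral_slab e) measurable
    also have "\<dots> \<le> ennreal D * (ennreal l * (\<integral>\<^sup>+x. ennreal ((pderivative e \<phi> x)\<^sup>2) \<partial>lborel))"
      using l by (intro mult_left_mono mult_right_mono) auto
    also have "(\<integral>\<^sup>+x. ennreal ((pderivative e \<phi> x)\<^sup>2) \<partial>lborel) = ennreal (LINT x|lborel. (pderivative e \<phi> x)\<^sup>2)"
      unfolding power2_eq_square using test_functionsE[OF \<phi>']
      by (intro nn_integral_eq_integral test_functions_integrable[OF test_functions_mult[OF \<phi>']]) auto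
    also have "ennreal D * (ennreal l * \<dots>) = ennreal (D * l * (LINT x|lborel. (pderivative e \<phi> x)\<^sup>2))"
      using D l by (simp add: ennreal_mult mult.assoc)
    finally have le: "(\<integral>\<^sup>+x. ennreal (indicator I (x \<bullet> e) * (\<phi> x)\<^sup>2) \<partial>lborel) \<le> ennreal (D * l * (LINT x|lborel. (pderivative e \<phi> x)\<^sup>2))" .
    have "(LINT x|lborel. indicator I (x \<bullet> e) * (\<phi> x)\<^sup>2) = enn2real (\<integral>\<^sup>+x. ennreal (indicator I (x \<bullet> e) * (\<phi> x)\<^sup>2) \<partial>lborel)"
      by (rule integral_eq_nn_integral) auto
    also have "\<dots> \<le> D * l * (LINT x|lborel. (pderivative e \<phi> x)\<^sup>2)"
      using le D l by (simp add: enn2real_leI)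
    finally show ?thesis using test_functions_outside[OF \<phi>] test_functions_outside[OF \<phi>'] \<Omega>'
      by (simp add: integral_lebesgue_on_eq_lborel)
  qed
  show ?thesis using D main by blast
qed

lemma Sobolev_sqnorm_nonneg: "Sobolev_sqnorm k \<Omega> u \<ge> 0"
  by (induction k arbitrary: u) (auto intro!: add_nonneg_nonneg sum_nonneg integral_nonneg_AE)

lemma Sobolev_sqnorm_Suc_ge:
  shows "(LINT x|lebesgue_on \<Omega>. (u x)\<^sup>2) \<le> Sobolev_sqnorm k \<Omega> u"
    and "i \<in> Basis \<Longrightarrow> Sobolev_sqnorm k \<Omega> (wpartial \<Omega> i u) \<le> Sobolev_sqnorm (Suc k) \<Omega> u"
proof -
  show "(LINT x|lebesgue_on \<Omega>. (u x)\<^sup>2) \<le> Sobolev_sqnorm k \<Omega> u"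
    by (cases k) (auto intro!: sum_nonneg Sobolev_sqnorm_nonneg)
  show "Sobolev_sqnorm k \<Omega> (wpartial \<Omega> i u) \<le> Sobolev_sqnorm (Suc k) \<Omega> u" if "i \<in> Basis"
    using member_le_sum[OF that, of "\<lambda>i. Sobolev_sqnorm k \<Omega> (wpartial \<Omega> i u)"] Sobolev_sqnorm_nonneg
    by (auto intro!: add_increasing integral_nonneg_AE)
qed

lemma square_sum_le: "(a + b)\<^sup>2 \<le> 2 * a\<^sup>2 + 2 * (b::real)\<^sup>2"
  using zero_le_power2[of "a - b"] by (simp add: power2_sum power2_diff)

text \<open>A weak form of the trace theorem: a slab whose cross-section \<open>I\<close> has length \<open>l\<close> carries at most the
  fraction \<open>D * l\<close> of the Dirichlet energy in direction \<open>e\<close>. It passes from test functions to their limits; the two uses of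
  \<open>(a + b)\<^sup>2 \<le> 2 * a\<^sup>2 + 2 * b\<^sup>2\<close> cost a factor 4 in the constant.\<close>

lemma Sobolev_H10_slab:
  fixes \<Omega> :: "'a::euclidean_space set"
  assumes \<Omega>: "open \<Omega>" "bounded \<Omega>" and e: "e \<in> Basis"
  shows "\<exists>D\<ge>0. \<forall>u\<in>Sobolev_H10 \<Omega>. \<forall>I\<in>sets borel. \<forall>l\<ge>0. emeasure lborel I \<le> ennreal l \<longrightarrow>
    (LINT x|lebesgue_on \<Omega>. indicator I (x \<bullet> e) * (u x)\<^sup>2) \<le> D * l * (LINT x|lebesgue_on \<Omega>. (wpartial \<Omega> e u x)\<^sup>2)"
proof -
  obtain D where D: "D \<ge> 0" "\<forall>\<phi>\<in>test_functions \<Omega>. \<forall>I\<in>sets borel. \<forall>l\<ge>0. emeasure lborel I \<le> ennreal l \<longrightarrow>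
    (LINT x|lebesgue_on \<Omega>. indicator I (x \<bullet> e) * (\<phi> x)\<^sup>2) \<le> D * l * (LINT x|lebesgue_on \<Omega>. (pderivative e \<phi> x)\<^sup>2)"
    using test_function_slab[OF assms] by auto
  have main: "(LINT x|lebesgue_on \<Omega>. indicator I (x \<bullet> e) * (u x)\<^sup>2) \<le> (4 * D) * l * (LINT x|lebesgue_on \<Omega>. (wpartial \<Omega> e u x)\<^sup>2)"
    if u: "u \<in> Sobolev_H10 \<Omega>" and I[measurable]: "I \<in> sets borel" and l: "l \<ge> 0" "emeasure lborel I \<le> ennreal l" for u I l
  proof -
    let ?M = "lebesgue_on \<Omega>"
    have \<Omega>': "\<Omega> \<in> sets lebesgue" using \<Omega>(1) by (rule sets_lebesgue_open)
    from u obtain \<phi> :: "nat \<Rightarrow> 'a \<Rightarrow> real" where u1: "u \<in> Sobolev_H (Suc 0) \<Omega>" and \<phi>: "\<And>n. \<phi> n \<in> test_functions \<Omega>"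
      and lim: "(\<lambda>n. Sobolev_norm (Suc 0) \<Omega> (\<lambda>x. \<phi> n x - u x)) \<longlonglongrightarrow> 0"
      unfolding Sobolev_H10_def One_nat_def by blast
    define s where "s n = Sobolev_sqnorm (Suc 0) \<Omega> (\<lambda>x. \<phi> n x - u x)" for n
    have s: "s \<longlonglongrightarrow> 0"
    proof -
      have "(\<lambda>n. (Sobolev_norm (Suc 0) \<Omega> (\<lambda>x. \<phi> n x - u x))\<^sup>2) \<longlonglongrightarrow> 0\<^sup>2" using lim by (intro tendsto_intros)
      then show ?thesis by (simp add: Sobolev_norm_def Sobolev_sqnorm_nonneg s_def[abs_def] del: Sobolev_sqnorm.simps)
    qed
    let ?w = "wpartial \<Omega> e u"
    note w = Sobolev_H_wpartial[OF u1 e] and uL = Sobolev_H_imp_L2[OF u1]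
    note [measurable] = L2_spaceD(2)[OF w(1)] L2_spaceD(2)[OF uL]
    have xe[measurable]: "(\<lambda>x. x \<bullet> e) \<in> borel_measurable ?M" by (rule borel_measurable_lebesgue_on) simp
    have bound: "(LINT x|?M. indicator I (x \<bullet> e) * (u x)\<^sup>2) \<le> (2 + 4 * D * l) * s n + 4 * D * l * (LINT x|?M. (?w x)\<^sup>2)" for n
    proof -
      let ?v = "\<lambda>x. \<phi> n x - u x"
      note \<phi>L = test_function_L2[OF \<phi>[of n] \<Omega>'] and \<phi>'L = test_function_L2[OF test_functions_pderivative[OF \<phi>[of n] e] \<Omega>']
      note [measurable] = L2_spaceD(2)[OF \<phi>L] L2_spaceD(2)[OF \<phi>'L]
      have vL: "?v \<in> L2_space \<Omega>" using L2_space_add[OF \<phi>L uL, of 1 "-1"] by simp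
      have "weak_partial \<Omega> e (\<lambda>x. 1 * \<phi> n x + (-1) * u x) (\<lambda>x. 1 * pderivative e (\<phi> n) x + (-1) * ?w x)"
        by (rule weak_partial_add[OF \<Omega> e \<phi>L \<phi>'L weak_partial_test_function[OF \<Omega>(1) \<phi> e] uL w])
      then have vw: "weak_partial \<Omega> e ?v (\<lambda>x. pderivative e (\<phi> n) x - ?w x)" by simp
      have vw': "(\<lambda>x. pderivative e (\<phi> n) x - ?w x) \<in> L2_space \<Omega>" using L2_space_add[OF \<phi>'L w(1), of 1 "-1"] by simp
      let ?z = "wpartial \<Omega> e ?v"
      note z = wpartial_L2[OF vw' vw] and zae = wpartial_AE_eq[OF \<Omega> vw' vw]
      note [measurable] = L2_spaceD(2)[OF z(1)]
      have s1: "(LINT x|?M. (?v x)\<^sup>2) \<le> s n" unfolding s_def by (rule Sobolev_sqnorm_Suc_ge(1))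
      have s2: "(LINT x|?M. (?z x)\<^sup>2) \<le> s n" using Sobolev_sqnorm_Suc_ge(2)[OF e, of 0 \<Omega> ?v] by (simp only: s_def Sobolev_sqnorm.simps(1))
      have i1: "integrable ?M (\<lambda>x. indicator I (x \<bullet> e) * f x)" if "integrable ?M f" for f :: "'a \<Rightarrow> real"
        by (rule Bochner_Integration.integrable_bound[OF that]) (use that in \<open>auto simp: indicator_def\<close>)
      have "(LINT x|?M. indicator I (x \<bullet> e) * (u x)\<^sup>2) \<le> (LINT x|?M. 2 * (?v x)\<^sup>2 + 2 * (indicator I (x \<bullet> e) * (\<phi> n x)\<^sup>2))"
      proof (rule integral_mono)
        show "indicator I (x \<bullet> e) * (u x)\<^sup>2 \<le> 2 * (?v x)\<^sup>2 + 2 * (indicator I (x \<bullet> e) * (\<phi> n x)\<^sup>2)" for x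
          using square_sum_le[of "- ?v x" "\<phi> n x"] by (auto simp: indicator_def power2_commute)
      qed (use L2_spaceD(1)[OF uL] L2_spaceD(1)[OF vL] L2_spaceD(1)[OF \<phi>L] in \<open>auto intro!: i1\<close>)
      also have "\<dots> = 2 * (LINT x|?M. (?v x)\<^sup>2) + 2 * (LINT x|?M. indicator I (x \<bullet> e) * (\<phi> n x)\<^sup>2)"
        using L2_spaceD(1)[OF vL] i1[OF L2_spaceD(1)[OF \<phi>L]] by simp
      also have "(LINT x|?M. indicator I (x \<bullet> e) * (\<phi> n x)\<^sup>2) \<le> D * l * (LINT x|?M. (pderivative e (\<phi> n) x)\<^sup>2)"
        by (rule D(2)[rule_format, OF \<phi> I l])
      also have "(LINT x|?M. (pderivative e (\<phi> n) x)\<^sup>2) \<le> (LINT x|?M. 2 * (?z x)\<^sup>2 + 2 * (?w x)\<^sup>2)"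
      proof (rule integral_mono_AE)
        show "AE x in ?M. (pderivative e (\<phi> n) x)\<^sup>2 \<le> 2 * (?z x)\<^sup>2 + 2 * (?w x)\<^sup>2"
          using zae
        proof eventually_elim
          case (elim x)
          then have "pderivative e (\<phi> n) x = ?z x + ?w x" by simp
          then show ?case using square_sum_le by metis
        qed
      qed (use L2_spaceD(1)[OF \<phi>'L] L2_spaceD(1)[OF z(1)] L2_spaceD(1)[OF w(1)] in auto)
      also have "\<dots> = 2 * (LINT x|?M. (?z x)\<^sup>2) + 2 * (LINT x|?M. (?w x)\<^sup>2)"
        using L2_spaceD(1)[OF z(1)] L2_spaceD(1)[OF w(1)] by simp
      finally have "(LINT x|?M. indicator I (x \<bullet> e) * (u x)\<^sup>2)
        \<le> 2 * (LINT x|?M. (?v x)\<^sup>2) + 2 * (D * l * (2 * (LINT x|?M. (?z x)\<^sup>2) + 2 * (LINT x|?M. (?w x)\<^sup>2)))"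
        using D(1) l(1) by (simp add: mult_left_mono)
      also have "\<dots> \<le> 2 * s n + 2 * (D * l * (2 * s n + 2 * (LINT x|?M. (?w x)\<^sup>2)))"
        using s1 s2 D(1) l(1) by (intro add_mono mult_left_mono) auto
      finally show ?thesis by (simp add: algebra_simps)
    qed
    have "(\<lambda>n. (2 + 4 * D * l) * s n + 4 * D * l * (LINT x|?M. (?w x)\<^sup>2)) \<longlonglongrightarrow> (2 + 4 * D * l) * 0 + 4 * D * l * (LINT x|?M. (?w x)\<^sup>2)"
      by (intro tendsto_intros s)
    then have "(LINT x|?M. indicator I (x \<bullet> e) * (u x)\<^sup>2) \<le> (2 + 4 * D * l) * 0 + 4 * D * l * (LINT x|?M. (?w x)\<^sup>2)"
      by (rule LIMSEQ_le_const) (use bound in blast)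
    then show ?thesis by simp
  qed
  show ?thesis using D(1) main by (intro exI[of _ "4 * D"]) auto
qed

section \<open>Limits of test functions in the second Sobolev space\<close>

lemma L2_space_dominated:
  assumes "w \<in> L2_space S" "u \<in> borel_measurable (lebesgue_on S)" "AE x in lebesgue_on S. \<bar>u x\<bar> \<le> w x"
  shows "u \<in> L2_space S"
proof -
  have "integrable (lebesgue_on S) (\<lambda>x. (u x)\<^sup>2)"
  proof (rule Bochner_Integration.integrable_bound[OF L2_spaceD(1)[OF assms(1)]])
    show "AE x in lebesgue_on S. norm ((u x)\<^sup>2) \<le> norm ((w x)\<^sup>2)"
      using assms(3) by eventually_elim (simp add: abs_le_square_iff[symmetric])
  qed (use assms(2) in measurable)
  then show ?thesis using assms(2) by (simp add: L2_space_def)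
qed

lemma AE_abs_limit_le:
  fixes f :: "nat \<Rightarrow> 'a \<Rightarrow> real"
  assumes "AE x in M. (\<lambda>n. f n x) \<longlonglongrightarrow> u x" "\<And>n. AE x in M. \<bar>f n x\<bar> \<le> w x"
  shows "AE x in M. \<bar>u x\<bar> \<le> w x"
proof -
  have "AE x in M. \<forall>n. \<bar>f n x\<bar> \<le> w x" using assms(2) by (simp add: AE_all_countable)
  with assms(1) show ?thesis
  proof eventually_elim
    case (elim x)
    show ?case by (rule LIMSEQ_le_const2[OF tendsto_rabs[OF elim(1)]]) (use elim(2) in blast)
  qed
qed

lemma L2_convergence_dominated:
  fixes u :: "'a::euclidean_space \<Rightarrow> real"
  assumes w: "w \<in> L2_space S" and f: "\<And>n. f n \<in> borel_measurable (lebesgue_on S)" "u \<in> borel_measurable (lebesgue_on S)"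
    and lim: "AE x in lebesgue_on S. (\<lambda>n. f n x) \<longlonglongrightarrow> u x" "\<And>n. AE x in lebesgue_on S. \<bar>f n x\<bar> \<le> w x"
  shows "(\<lambda>n. LINT x|lebesgue_on S. (f n x - u x)\<^sup>2) \<longlonglongrightarrow> 0"
proof -
  note [measurable] = f
  have ub: "AE x in lebesgue_on S. \<bar>u x\<bar> \<le> w x" by (rule AE_abs_limit_le[OF lim])
  have "(\<lambda>n. LINT x|lebesgue_on S. (f n x - u x)\<^sup>2) \<longlonglongrightarrow> (LINT x|lebesgue_on S. 0)"
  proof (rule integral_dominated_convergence[where w = "\<lambda>x. 4 * (w x)\<^sup>2"])
    show "integrable (lebesgue_on S) (\<lambda>x. 4 * (w x)\<^sup>2)" using L2_spaceD(1)[OF w] by simp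
    show "AE x in lebesgue_on S. (\<lambda>n. (f n x - u x)\<^sup>2) \<longlonglongrightarrow> 0"
      using lim(1)
    proof eventually_elim
      case (elim x)
      then have "(\<lambda>n. (f n x - u x)\<^sup>2) \<longlonglongrightarrow> (u x - u x)\<^sup>2" by (intro tendsto_intros)
      then show ?case by simp
    qed
    show "AE x in lebesgue_on S. norm ((f n x - u x)\<^sup>2) \<le> 4 * (w x)\<^sup>2" for n
      using lim(2)[of n] ub
    proof eventually_elim
      case (elim x)
      then have "\<bar>f n x - u x\<bar> \<le> \<bar>2 * w x\<bar>" by linarith
      then have "(f n x - u x)\<^sup>2 \<le> (2 * w x)\<^sup>2" by (simp add: abs_le_square_iff)
      then show ?case by (simp add: power_mult_distrib)
    qed
  qed measurable
  then show ?thesis by simp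
qed

definition laplacian :: "('a::euclidean_space \<Rightarrow> real) \<Rightarrow> 'a \<Rightarrow> real" where
  "laplacian \<phi> x = (\<Sum>i\<in>Basis. pderivative i (pderivative i \<phi>) x)"

lemma laplacian_test_function: "\<phi> \<in> test_functions \<Omega> \<Longrightarrow> laplacian \<phi> \<in> test_functions \<Omega>"
  unfolding laplacian_def[abs_def] by (intro test_functions_sum test_functions_pderivative)

lemma weak_laplacian:
  assumes \<Omega>: "open \<Omega>" "bounded \<Omega>" and \<phi>: "\<phi> \<in> test_functions \<Omega>" and u: "u \<in> L2_space \<Omega>"
    and g: "\<And>i. i \<in> Basis \<Longrightarrow> weak_partial \<Omega> i u (g i)" "\<And>i. i \<in> Basis \<Longrightarrow> weak_partial \<Omega> i (g i) (h i)"
    and h: "\<And>i. i \<in> Basis \<Longrightarrow> h i \<in> L2_space \<Omega>"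
  shows "(LINT x|lebesgue_on \<Omega>. u x * laplacian \<phi> x) = (LINT x|lebesgue_on \<Omega>. (\<Sum>i\<in>Basis. h i x) * \<phi> x)"
proof -
  have 1: "(LINT x|lebesgue_on \<Omega>. u x * pderivative i (pderivative i \<phi>) x) = (LINT x|lebesgue_on \<Omega>. h i x * \<phi> x)"
    if i: "i \<in> Basis" for i
    using g(1)[OF i] g(2)[OF i] \<phi> test_functions_pderivative[OF \<phi> i] by (simp add: weak_partial_iff)
  have "(LINT x|lebesgue_on \<Omega>. u x * laplacian \<phi> x) = (\<Sum>i\<in>Basis. LINT x|lebesgue_on \<Omega>. u x * pderivative i (pderivative i \<phi>) x)"
    unfolding laplacian_def sum_distrib_left
    by (intro Bochner_Integration.integral_sum integrable_L2_mult_test[OF \<Omega> u] test_functions_pderivative \<phi>)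
  also have "\<dots> = (\<Sum>i\<in>Basis. LINT x|lebesgue_on \<Omega>. h i x * \<phi> x)" using 1 by (rule sum.cong[OF refl])
  also have "\<dots> = (LINT x|lebesgue_on \<Omega>. (\<Sum>i\<in>Basis. h i x) * \<phi> x)"
    unfolding sum_distrib_right
    by (intro Bochner_Integration.integral_sum[symmetric] integrable_L2_mult_test[OF \<Omega> h \<phi>])
  finally show ?thesis .
qed

text \<open>A criterion that yields membership, the boundary condition and the distributional Laplacian at
  once: pointwise convergence of all derivatives up to order two under one square integrable
  majorant \<open>w\<close>.\<close>

lemma H2_H10_limit:
  fixes \<Omega> :: "'a::euclidean_space set"
  assumes \<Omega>: "open \<Omega>" "bounded \<Omega>" and f: "\<And>n. f n \<in> test_functions \<Omega>" and w: "w \<in> L2_space \<Omega>"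
    and m: "u \<in> borel_measurable (lebesgue_on \<Omega>)" "\<And>i. i \<in> Basis \<Longrightarrow> g i \<in> borel_measurable (lebesgue_on \<Omega>)"
      "\<And>i j. i \<in> Basis \<Longrightarrow> j \<in> Basis \<Longrightarrow> h i j \<in> borel_measurable (lebesgue_on \<Omega>)"
    and lim: "AE x in lebesgue_on \<Omega>. (\<lambda>n. f n x) \<longlonglongrightarrow> u x"
      "\<And>i. i \<in> Basis \<Longrightarrow> AE x in lebesgue_on \<Omega>. (\<lambda>n. pderivative i (f n) x) \<longlonglongrightarrow> g i x"
      "\<And>i j. i \<in> Basis \<Longrightarrow> j \<in> Basis \<Longrightarrow> AE x in lebesgue_on \<Omega>. (\<lambda>n. pderivative j (pderivative i (f n)) x) \<longlonglongrightarrow> h i j x"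
    and bd: "\<And>n. AE x in lebesgue_on \<Omega>. \<bar>f n x\<bar> \<le> w x"
      "\<And>i n. i \<in> Basis \<Longrightarrow> AE x in lebesgue_on \<Omega>. \<bar>pderivative i (f n) x\<bar> \<le> w x"
      "\<And>i j n. i \<in> Basis \<Longrightarrow> j \<in> Basis \<Longrightarrow> AE x in lebesgue_on \<Omega>. \<bar>pderivative j (pderivative i (f n)) x\<bar> \<le> w x"
  shows "u \<in> H2_H10 \<Omega>"
    and "\<And>\<phi>. \<phi> \<in> test_functions \<Omega> \<Longrightarrow>
      (LINT x|lebesgue_on \<Omega>. u x * laplacian \<phi> x) = (LINT x|lebesgue_on \<Omega>. (\<Sum>i\<in>Basis. h i i x) * \<phi> x)"
proof -
  let ?M = "lebesgue_on \<Omega>"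
  have \<Omega>': "\<Omega> \<in> sets lebesgue" using \<Omega>(1) by (rule sets_lebesgue_open)
  have wi: "integrable ?M w" using w \<Omega> by (intro L2_space_integrable) (auto simp: lmeasurable_open)
  have uL: "u \<in> L2_space \<Omega>" by (rule L2_space_dominated[OF w m(1) AE_abs_limit_le[OF lim(1) bd(1)]])
  have gL: "g i \<in> L2_space \<Omega>" if "i \<in> Basis" for i
    by (rule L2_space_dominated[OF w m(2)[OF that] AE_abs_limit_le[OF lim(2) bd(2)]]) (use that in auto)
  have hL: "h i j \<in> L2_space \<Omega>" if "i \<in> Basis" "j \<in> Basis" for i j
    by (rule L2_space_dominated[OF w m(3)[OF that] AE_abs_limit_le[OF lim(3) bd(3)]]) (use that in auto)
  have ug: "weak_partial \<Omega> i u (g i)" if i: "i \<in> Basis" for i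
    by (rule weak_partial_limit[OF \<Omega>(1) i f lim(1) lim(2)[OF i] m(1) m(2)[OF i] wi bd(1) bd(2)[OF i]])
  have gh: "weak_partial \<Omega> j (g i) (h i j)" if i: "i \<in> Basis" and j: "j \<in> Basis" for i j
    by (rule weak_partial_limit[OF \<Omega>(1) j test_functions_pderivative[OF f i] lim(2)[OF i] lim(3)[OF i j] m(2)[OF i] m(3)[OF i j] wi
          bd(2)[OF i] bd(3)[OF i j]])
  show "(LINT x|?M. u x * laplacian \<phi> x) = (LINT x|?M. (\<Sum>i\<in>Basis. h i i x) * \<phi> x)" if "\<phi> \<in> test_functions \<Omega>" for \<phi>
    using weak_laplacian[OF \<Omega> that uL, of g "\<lambda>i. h i i"] ug gh hL by blast
  have g1: "g i \<in> Sobolev_H (Suc 0) \<Omega>" if "i \<in> Basis" for i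
    using gL[OF that] gh[OF that] hL[OF that] by auto
  have u2: "u \<in> Sobolev_H (Suc (Suc 0)) \<Omega>"
    unfolding Sobolev_H.simps(2)[of "Suc 0"] using uL ug g1 by blast
  have u1: "u \<in> Sobolev_H (Suc 0) \<Omega>" using uL ug gL by auto
  have "(\<lambda>n. Sobolev_sqnorm (Suc 0) \<Omega> (\<lambda>x. f n x - u x)) \<longlonglongrightarrow> 0"
  proof -
    have eq: "(LINT x|?M. (wpartial \<Omega> i (\<lambda>x. f n x - u x) x)\<^sup>2) = (LINT x|?M. (pderivative i (f n) x - g i x)\<^sup>2)"
      if i: "i \<in> Basis" for i n
    proof -
      note f' = test_functions_pderivative[OF f i, of n]
      have "weak_partial \<Omega> i (\<lambda>x. 1 * f n x + (-1) * u x) (\<lambda>x. 1 * pderivative i (f n) x + (-1) * g i x)"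
        by (rule weak_partial_add[OF \<Omega> i test_function_L2[OF f \<Omega>'] test_function_L2[OF f' \<Omega>']
             weak_partial_test_function[OF \<Omega>(1) f i] uL gL[OF i] ug[OF i]])
      then have wk: "weak_partial \<Omega> i (\<lambda>x. f n x - u x) (\<lambda>x. pderivative i (f n) x - g i x)" by simp
      have L: "(\<lambda>x. pderivative i (f n) x - g i x) \<in> L2_space \<Omega>"
        using L2_space_add[OF test_function_L2[OF f' \<Omega>'] gL[OF i], of 1 "-1"] by simp
      note [measurable] = L2_spaceD(2)[OF L] L2_spaceD(2)[OF wpartial_L2(1)[OF L wk]]
      show ?thesis
      proof (rule integral_cong_AE)
        show "AE x in ?M. (wpartial \<Omega> i (\<lambda>x. f n x - u x) x)\<^sup>2 = (pderivative i (f n) x - g i x)\<^sup>2"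
          using wpartial_AE_eq[OF \<Omega> L wk] by eventually_elim simp
      qed measurable
    qed
    have "(\<lambda>n. LINT x|?M. (f n x - u x)\<^sup>2) \<longlonglongrightarrow> 0"
      by (rule L2_convergence_dominated[OF w test_functions_measurable_on[OF f] m(1) lim(1) bd(1)])
    moreover have "(\<lambda>n. LINT x|?M. (pderivative i (f n) x - g i x)\<^sup>2) \<longlonglongrightarrow> 0" if i: "i \<in> Basis" for i
      by (rule L2_convergence_dominated[OF w test_functions_measurable_on[OF test_functions_pderivative[OF f i]]
           m(2)[OF i] lim(2)[OF i] bd(2)[OF i]])
    ultimately have "(\<lambda>n. (LINT x|?M. (f n x - u x)\<^sup>2) + (\<Sum>i\<in>Basis. LINT x|?M. (pderivative i (f n) x - g i x)\<^sup>2))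
       \<longlonglongrightarrow> 0 + (\<Sum>i\<in>(Basis :: 'a set). 0)"
      by (intro tendsto_add tendsto_sum)
    then show ?thesis using eq by simp
  qed
  then have "(\<lambda>n. sqrt (Sobolev_sqnorm (Suc 0) \<Omega> (\<lambda>x. f n x - u x))) \<longlonglongrightarrow> sqrt 0" by (rule tendsto_real_sqrt)
  then have "(\<lambda>n. Sobolev_norm (Suc 0) \<Omega> (\<lambda>x. f n x - u x)) \<longlonglongrightarrow> 0" unfolding Sobolev_norm_def by simp
  then have "u \<in> Sobolev_H10 \<Omega>" using u1 f unfolding Sobolev_H10_def One_nat_def by blast
  then show "u \<in> H2_H10 \<Omega>" using u2 by (simp only: H2_H10_def numeral_2_eq_2 IntI)
qed

section \<open>An initial datum whose Laplacian is singular on a hyperplane\<close>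

lemma nn_integral_powr_finite:
  fixes S :: real
  assumes "S \<ge> 0"
  shows "(\<integral>\<^sup>+t. ennreal (indicator {-S..S} t * (t\<^sup>2) powr (-1/4)) \<partial>lborel) < \<infinity>"
proof -
  define f :: "real \<Rightarrow> real" where "f t = indicator {0..S} t * t powr (-1/2)" for t
  have [measurable]: "f \<in> borel_measurable borel" unfolding f_def by measurable
  have "((\<lambda>t. t powr (-1/2)) has_integral (S powr (-1/2 + 1) / (-1/2 + 1))) {0..S}"
    by (rule has_integral_powr_from_0) (use assms in auto)
  then have "((\<lambda>t. indicator {0..S} t * t powr (-1/2)) has_integral (S powr (-1/2 + 1) / (-1/2 + 1))) UNIV"
    using has_integral_restrict_UNIV[of "{0..S}" "\<lambda>t. t powr (-1/2)"]
    by (simp add: indicator_def of_bool_def if_distrib[of "\<lambda>x. x * _"] cong: if_cong)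
  then have "(\<integral>\<^sup>+t. ennreal (f t) \<partial>lborel) = ennreal (S powr (-1/2 + 1) / (-1/2 + 1))"
    unfolding f_def[symmetric] by (intro nn_integral_has_integral_lborel) (auto simp: f_def)
  then have fin: "(\<integral>\<^sup>+t. ennreal (f t) \<partial>lborel) < \<infinity>" by simp
  have "(\<integral>\<^sup>+t. ennreal (indicator {-S..S} t * (t\<^sup>2) powr (-1/4)) \<partial>lborel) \<le> (\<integral>\<^sup>+t. ennreal (f t) + ennreal (f (- t)) \<partial>lborel)"
  proof (rule nn_integral_mono)
    fix t :: real
    have *: "(t\<^sup>2) powr (-1/4) = \<bar>t\<bar> powr (-1/2)"
    proof (cases "t = 0")
      case False
      then have "t\<^sup>2 = \<bar>t\<bar> powr 2" by (simp add: powr_numeral)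
      have "(t\<^sup>2) powr (-1/4) = \<bar>t\<bar> powr (2 * (-1/4))"
        unfolding \<open>t\<^sup>2 = _\<close> by (rule powr_powr)
      then show ?thesis by simp
    qed simp
    show "ennreal (indicator {-S..S} t * (t\<^sup>2) powr (-1/4)) \<le> ennreal (f t) + ennreal (f (- t))"
      unfolding * by (cases "t \<ge> 0") (auto simp: f_def indicator_def)
  qed
  also have "\<dots> = (\<integral>\<^sup>+t. ennreal (f t) \<partial>lborel) + (\<integral>\<^sup>+t. ennreal (f (- t)) \<partial>lborel)"
    by (rule nn_integral_add) measurable
  also have "(\<integral>\<^sup>+t. ennreal (f (- t)) \<partial>lborel) = (\<integral>\<^sup>+t. ennreal (f t) \<partial>lborel)"
    using nn_integral_real_affine[of "\<lambda>t. ennreal (f t)" "-1" 0] by simp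
  finally show ?thesis using fin by (simp add: order.strict_trans1)
qed

text \<open>Apply \<open>nn_integral_slab\<close> to the singular power and to the indicator of a ball that contains the unit
  segment in direction \<open>e\<close> from every point of \<open>\<Omega>\<close>, so that the inner integral is 1 there.\<close>

lemma integrable_hyperplane_singularity:
  fixes \<Omega> :: "'a::euclidean_space set"
  assumes \<Omega>: "open \<Omega>" "bounded \<Omega>" and e: "e \<in> Basis"
  shows "integrable (lebesgue_on \<Omega>) (\<lambda>x. ((x \<bullet> e - a)\<^sup>2) powr (-1/4))"
proof -
  obtain R where R: "R > 0" "\<And>x. x \<in> \<Omega> \<Longrightarrow> norm x \<le> R" using \<Omega>(2) bounded_pos by metis
  define S where "S = R + \<bar>a\<bar>"
  define h where "h s = ennreal (indicator {-S..S} (s - a) * ((s - a)\<^sup>2) powr (-1/4))" for s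
  have [measurable]: "h \<in> borel_measurable borel" unfolding h_def by measurable
  have h: "integral\<^sup>N lborel h < \<infinity>"
    using nn_integral_real_affine[of h 1 a] nn_integral_powr_finite[of S] R by (simp add: h_def[abs_def] S_def)
  define q :: "'a \<Rightarrow> ennreal" where "q = indicator (cball 0 (R + 1))"
  have [measurable]: "q \<in> borel_measurable borel" unfolding q_def by (intro borel_measurable_indicator) simp
  have q: "integral\<^sup>N lborel q < \<infinity>" unfolding q_def using emeasure_lborel_cball_finite by simp
  define f where "f x = indicator \<Omega> x * ((x \<bullet> e - a)\<^sup>2) powr (-1/4)" for x
  note [measurable] = borel_open[OF \<Omega>(1)]
  have [measurable]: "f \<in> borel_measurable borel" unfolding f_def by measurable
  have "(\<integral>\<^sup>+x. ennreal (f x) \<partial>lborel)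
    \<le> (\<integral>\<^sup>+x. h (x \<bullet> e) * (\<integral>\<^sup>+\<sigma>. indicator {0..1} \<sigma> * q (x + \<sigma> *\<^sub>R e) \<partial>lborel) \<partial>lborel)"
  proof (rule nn_integral_mono)
    fix x
    show "ennreal (f x) \<le> h (x \<bullet> e) * (\<integral>\<^sup>+\<sigma>. indicator {0..1} \<sigma> * q (x + \<sigma> *\<^sub>R e) \<partial>lborel)"
    proof (cases "x \<in> \<Omega>")
      case True
      then have "\<bar>x \<bullet> e\<bar> \<le> R" using R(2)[OF True] Basis_le_norm[OF e, of x] by simp
      then have "x \<bullet> e - a \<in> {-S..S}" unfolding S_def by (simp add: abs_le_iff) linarith
      then have 1: "ennreal (f x) = h (x \<bullet> e)" using True by (simp add: f_def h_def)
      have "q (x + \<sigma> *\<^sub>R e) = 1" if "\<sigma> \<in> {0..1}" for \<sigma>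
        using R(2)[OF True] norm_triangle_ineq[of x "\<sigma> *\<^sub>R e"] e that by (auto simp: q_def)
      then have "(\<integral>\<^sup>+\<sigma>. indicator {0..1} \<sigma> * q (x + \<sigma> *\<^sub>R e) \<partial>lborel) = (\<integral>\<^sup>+\<sigma>. indicator {0..1::real} \<sigma> \<partial>lborel)"
        by (intro nn_integral_cong) (auto simp: indicator_def)
      then show ?thesis using 1 by simp
    qed (simp add: f_def)
  qed
  also have "\<dots> \<le> integral\<^sup>N lborel h * integral\<^sup>N lborel q" by (intro nn_integral_slab e) measurable
  also have "\<dots> < \<infinity>" using h q by (simp add: ennreal_mult_less_top)
  finally have "integrable lborel f"
    by (intro integrableI_bounded) (auto simp: f_def)
  then have "integrable (lebesgue_on \<Omega>) f"
    using \<Omega>(1) by (subst integrable_lebesgue_on_iff_lborel) (auto simp: sets_lebesgue_open f_def)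
  then show ?thesis
    by (rule Bochner_Integration.integrable_cong[OF refl, THEN iffD1, rotated]) (simp add: f_def)
qed

lemma powr_family_DERIV:
  fixes a :: real
  assumes "s > 0"
  shows "((\<lambda>s. (\<Prod>i<n. a - real i) * s powr (a - real n)) has_real_derivative
    (\<Prod>i<Suc n. a - real i) * s powr (a - real (Suc n))) (at s)"
proof -
  have "((\<lambda>s. s powr (a - real n)) has_real_derivative (a - real n) * s powr (a - real n - 1)) (at s)"
    by (rule has_real_derivative_powr[OF assms])
  from DERIV_cmult[OF this, of "\<Prod>i<n. a - real i"] show ?thesis
    by (simp add: mult.assoc algebra_simps)
qed

lemma smooth_ridge_powr:
  assumes "\<delta> > 0"
  shows "smooth_on (\<lambda>x :: 'a::euclidean_space. ((x \<bullet> e - a)\<^sup>2 + \<delta>) powr q) UNIV"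
proof -
  have u: "smooth_on (\<lambda>x :: 'a. (x \<bullet> e + (- a)) * (x \<bullet> e + (- a)) + \<delta>) UNIV"
    by (intro smooth_on_add smooth_on_mult smooth_on_inner smooth_on_const)
  have "smooth_on (\<lambda>x :: 'a. (\<Prod>i<0. q - real i) * ((x \<bullet> e + (- a)) * (x \<bullet> e + (- a)) + \<delta>) powr (q - real 0)) UNIV"
    by (rule smooth_on_compose[where A = "{0<..}" and h = "\<lambda>n s. (\<Prod>i<n. q - real i) * s powr (q - real n)"])
      (use u assms in \<open>auto intro: powr_family_DERIV simp del: prod.lessThan_Suc of_nat_Suc simp: add_nonneg_pos\<close>)
  then show ?thesis by (simp add: power2_eq_square)
qed

lemma pderivative_ridge:
  assumes "(f has_real_derivative f') (at (x \<bullet> e - a))"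
  shows "pderivative i (\<lambda>x. f (x \<bullet> e - a)) x = f' * (e \<bullet> i)"
proof -
  have "GDERIV (\<lambda>x. x \<bullet> e - a) x :> e"
    unfolding gderiv_def by (auto intro!: derivative_eq_intros simp: inner_commute)
  from GDERIV_pderivative[OF GDERIV_DERIV_compose[OF this assms]] show ?thesis by simp
qed

text \<open>The profile \<open>\<bar>s\<bar> powr (7/4)\<close> (for \<open>\<delta> = 0\<close>) with its smooth regularisation (for \<open>\<delta> > 0\<close>); the two
  functions that follow are its first and second derivatives. The exponent is chosen such that the
  second derivative, of size \<open>\<bar>s\<bar> powr (- 1/4)\<close>, is unbounded but has an integrable square.\<close>

definition profile0 :: "real \<Rightarrow> real \<Rightarrow> real" where
  "profile0 \<delta> s = (s\<^sup>2 + \<delta>) powr (7/8)"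

definition profile1 :: "real \<Rightarrow> real \<Rightarrow> real" where
  "profile1 \<delta> s = 7/4 * s * (s\<^sup>2 + \<delta>) powr (-1/8)"

definition profile2 :: "real \<Rightarrow> real \<Rightarrow> real" where
  "profile2 \<delta> s = 7/4 * (s\<^sup>2 + \<delta>) powr (-1/8) - 7/16 * s\<^sup>2 * (s\<^sup>2 + \<delta>) powr (-9/8)"

lemma profile_measurable[measurable]:
  "profile0 \<delta> \<in> borel_measurable borel" "profile1 \<delta> \<in> borel_measurable borel" "profile2 \<delta> \<in> borel_measurable borel"
  unfolding profile0_def[abs_def] profile1_def[abs_def] profile2_def[abs_def] by measurable

lemma profile_DERIV:
  assumes "\<delta> > 0"
  shows "(profile0 \<delta> has_real_derivative profile1 \<delta> s) (at s)"
    and "(profile1 \<delta> has_real_derivative profile2 \<delta> s) (at s)"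
proof -
  have pos: "s\<^sup>2 + \<delta> > 0" using assms by (simp add: add_nonneg_pos)
  have p: "((\<lambda>s. (s\<^sup>2 + \<delta>) powr q) has_real_derivative q * (s\<^sup>2 + \<delta>) powr (q - 1) * (2 * s)) (at s)" for q
    by (rule DERIV_chain2[where f = "\<lambda>z. z powr q" and g = "\<lambda>s. s\<^sup>2 + \<delta>" and x = s, OF has_real_derivative_powr[OF pos]]) (auto intro!: derivative_eq_intros)
  show "(profile0 \<delta> has_real_derivative profile1 \<delta> s) (at s)"
    unfolding profile0_def[abs_def] profile1_def by (rule DERIV_cong[OF p]) simp
  have "((\<lambda>s. 7/4 * s * (s\<^sup>2 + \<delta>) powr (-1/8)) has_real_derivative
      7/4 * (s\<^sup>2 + \<delta>) powr (-1/8) + (-1/8 * (s\<^sup>2 + \<delta>) powr (-1/8 - 1) * (2 * s)) * (7/4 * s)) (at s)"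
    by (intro DERIV_mult p) (auto intro!: derivative_eq_intros)
  then show "(profile1 \<delta> has_real_derivative profile2 \<delta> s) (at s)"
    unfolding profile1_def[abs_def] profile2_def by (rule DERIV_cong) (simp add: power2_eq_square)
qed

lemma profile_tendsto:
  assumes "s \<noteq> 0" "d \<longlonglongrightarrow> 0"
  shows "(\<lambda>n. profile0 (d n) s) \<longlonglongrightarrow> profile0 0 s" "(\<lambda>n. profile1 (d n) s) \<longlonglongrightarrow> profile1 0 s"
    "(\<lambda>n. profile2 (d n) s) \<longlonglongrightarrow> profile2 0 s"
proof -
  have "(\<lambda>n. s\<^sup>2 + d n) \<longlonglongrightarrow> s\<^sup>2 + 0" by (intro tendsto_intros assms(2))
  moreover have "s\<^sup>2 + 0 \<noteq> 0" using assms(1) by simp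
  ultimately have p: "(\<lambda>n. (s\<^sup>2 + d n) powr q) \<longlonglongrightarrow> (s\<^sup>2 + 0) powr q" for q
    by (intro tendsto_powr tendsto_const)
  show "(\<lambda>n. profile0 (d n) s) \<longlonglongrightarrow> profile0 0 s" "(\<lambda>n. profile1 (d n) s) \<longlonglongrightarrow> profile1 0 s"
    "(\<lambda>n. profile2 (d n) s) \<longlonglongrightarrow> profile2 0 s"
    unfolding profile0_def profile1_def profile2_def by (intro tendsto_intros p)+
qed

lemma profile_bounds:
  assumes "0 \<le> \<delta>" "\<delta> \<le> 1" "s \<noteq> 0" "\<bar>s\<bar> \<le> S"
  shows "\<bar>profile0 \<delta> s\<bar> \<le> 1 + S\<^sup>2" "\<bar>profile1 \<delta> s\<bar> \<le> 2 * S * (s\<^sup>2) powr (-1/8)"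
    "\<bar>profile2 \<delta> s\<bar> \<le> 3 * (s\<^sup>2) powr (-1/8)"
proof -
  have s2: "s\<^sup>2 \<le> S\<^sup>2" using assms(4) abs_le_square_iff[of s S] by linarith
  have pos: "s\<^sup>2 > 0" using assms by simp
  have "profile0 \<delta> s \<le> (1 + S\<^sup>2) powr (7/8)"
    unfolding profile0_def using s2 assms by (intro powr_mono2) auto
  also have "\<dots> \<le> (1 + S\<^sup>2) powr 1" by (intro powr_mono) auto
  finally show "\<bar>profile0 \<delta> s\<bar> \<le> 1 + S\<^sup>2" by (simp add: profile0_def add_nonneg_pos)
  have le: "(s\<^sup>2 + \<delta>) powr (-1/8) \<le> (s\<^sup>2) powr (-1/8)"
    using pos assms(1) by (intro powr_mono2') auto
  have "\<bar>profile1 \<delta> s\<bar> = (7/4 * \<bar>s\<bar>) * (s\<^sup>2 + \<delta>) powr (-1/8)" by (simp add: profile1_def abs_mult)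
  also have "\<dots> \<le> (2 * S) * (s\<^sup>2) powr (-1/8)" using assms(4) by (intro mult_mono le) auto
  finally show "\<bar>profile1 \<delta> s\<bar> \<le> 2 * S * (s\<^sup>2) powr (-1/8)" .
  have "s\<^sup>2 * (s\<^sup>2 + \<delta>) powr (-9/8) \<le> (s\<^sup>2 + \<delta>) * (s\<^sup>2 + \<delta>) powr (-9/8)"
    using assms(1) by (intro mult_right_mono) auto
  also have "\<dots> = (s\<^sup>2 + \<delta>) powr (-1/8)"
    using powr_add[of "s\<^sup>2 + \<delta>" 1 "-9/8"] pos assms(1) by simp
  finally have "s\<^sup>2 * (s\<^sup>2 + \<delta>) powr (-9/8) \<le> (s\<^sup>2 + \<delta>) powr (-1/8)" .
  moreover have "0 \<le> s\<^sup>2 * (s\<^sup>2 + \<delta>) powr (-9/8)" "0 \<le> (s\<^sup>2 + \<delta>) powr (-1/8)" by simp_all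
  moreover have "profile2 \<delta> s = 7/4 * (s\<^sup>2 + \<delta>) powr (-1/8) - 7/16 * (s\<^sup>2 * (s\<^sup>2 + \<delta>) powr (-9/8))"
    by (simp add: profile2_def)
  ultimately show "\<bar>profile2 \<delta> s\<bar> \<le> 3 * (s\<^sup>2) powr (-1/8)"
    using le by linarith
qed

lemma profile2_0: "s \<noteq> 0 \<Longrightarrow> profile2 0 s = 21/16 * (s\<^sup>2) powr (-1/8)"
  using powr_add[of "s\<^sup>2" 1 "-9/8"] by (simp add: profile2_def)

text \<open>In the Laplacian of a cutoff times the profile, the terms with at most one derivative on the
  profile are therefore bounded.\<close>

lemma profile1_0_bounded: "\<bar>s\<bar> \<le> S \<Longrightarrow> \<bar>profile1 0 s\<bar> \<le> 2 * (1 + S\<^sup>2)"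
proof -
  assume "\<bar>s\<bar> \<le> S"
  then have s2: "s\<^sup>2 \<le> S\<^sup>2" using abs_le_square_iff[of s S] by linarith
  have "\<bar>s\<bar> * (s\<^sup>2) powr (-1/8) = (s\<^sup>2) powr (3/8)"
  proof (cases "s = 0")
    case False
    then have "\<bar>s\<bar> = (s\<^sup>2) powr (1/2)" by (simp add: powr_half_sqrt)
    then have "\<bar>s\<bar> * (s\<^sup>2) powr (-1/8) = (s\<^sup>2) powr (1/2 + -1/8)"
      by (simp only: powr_add)
    then show ?thesis by simp
  qed simp
  also have "\<dots> \<le> (1 + S\<^sup>2) powr (3/8)" using s2 by (intro powr_mono2) auto
  also have "\<dots> \<le> (1 + S\<^sup>2) powr 1" by (intro powr_mono) auto
  finally have le: "\<bar>s\<bar> * (s\<^sup>2) powr (-1/8) \<le> 1 + S\<^sup>2" by (simp add: add_nonneg_pos)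
  have mono: "7/4 * u \<le> 2 * v" if "u \<le> v" "0 \<le> v" for u v :: real using that by linarith
  have "\<bar>profile1 0 s\<bar> = 7/4 * (\<bar>s\<bar> * (s\<^sup>2) powr (-1/8))" by (simp add: profile1_def abs_mult)
  also have "\<dots> \<le> 2 * (1 + S\<^sup>2)" by (rule mono[OF le]) simp
  finally show ?thesis .
qed

lemma AE_hyperplane:
  fixes \<Omega> :: "'a::euclidean_space set"
  assumes "\<Omega> \<in> sets lebesgue" "e \<in> Basis"
  shows "AE x in lebesgue_on \<Omega>. x \<bullet> e - a \<noteq> 0"
proof -
  have "negligible {x. x \<bullet> e = a}" using negligible_standard_hyperplane[OF assms(2)] by (simp add: inner_commute)
  then have "AE x in lebesgue. x \<notin> {x. x \<bullet> e = a}" by (intro AE_not_in) (simp add: negligible_iff_null_sets)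
  then show ?thesis using assms(1) by (auto simp: AE_restrict_space_iff elim: eventually_mono)
qed

text \<open>The datum is \<open>\<eta> x * \<bar>x \<bullet> e - a\<bar> powr (7/4)\<close>, the limit of the test functions in which the profile is
  regularised. Its Laplacian \<open>g\<close> is \<open>\<eta> x\<close> times the second derivative of the profile, up to terms
  bounded by \<open>B\<close>.\<close>

lemma singular_datum:
  fixes \<Omega> :: "'a::euclidean_space set"
  assumes \<Omega>: "open \<Omega>" "bounded \<Omega>" and \<eta>: "\<eta> \<in> test_functions \<Omega>" "\<And>x. \<eta> x \<ge> 0" and e: "e \<in> Basis"
  obtains y0 g B where "y0 \<in> H2_H10 \<Omega>" "g \<in> L2_space \<Omega>"
    "\<And>\<phi>. \<phi> \<in> test_functions \<Omega> \<Longrightarrow> (LINT x|lebesgue_on \<Omega>. y0 x * laplacian \<phi> x) = (LINT x|lebesgue_on \<Omega>. g x * \<phi> x)"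
    "AE x in lebesgue_on \<Omega>. \<eta> x * ((x \<bullet> e - a)\<^sup>2) powr (-1/8) - B \<le> \<bar>g x\<bar>"
proof -
  let ?M = "lebesgue_on \<Omega>"
  have \<Omega>': "\<Omega> \<in> sets lebesgue" using \<Omega>(1) by (rule sets_lebesgue_open)
  obtain R where R: "R > 0" "\<And>x. x \<in> \<Omega> \<Longrightarrow> norm x \<le> R" using \<Omega>(2) bounded_pos by metis
  define S where "S = R + \<bar>a\<bar>"
  have S: "S > 0" "\<And>x. x \<in> \<Omega> \<Longrightarrow> \<bar>x \<bullet> e - a\<bar> \<le> S"
  proof -
    show "\<bar>x \<bullet> e - a\<bar> \<le> S" if "x \<in> \<Omega>" for x
      using R(2)[OF that] Basis_le_norm[OF e, of x] by (simp add: S_def)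
  qed (use R in \<open>simp add: S_def\<close>)
  define \<eta>1 where "\<eta>1 i = pderivative i \<eta>" for i :: 'a
  define \<eta>2 where "\<eta>2 i j = pderivative j (pderivative i \<eta>)" for i j :: 'a
  have \<eta>1: "\<eta>1 i \<in> test_functions \<Omega>" if "i \<in> Basis" for i unfolding \<eta>1_def using test_functions_pderivative[OF \<eta>(1) that] .
  have \<eta>2: "\<eta>2 i j \<in> test_functions \<Omega>" if "i \<in> Basis" "j \<in> Basis" for i j
    unfolding \<eta>2_def using test_functions_pderivative[OF test_functions_pderivative[OF \<eta>(1) that(1)] that(2)] .
  have sm: "smooth_on \<eta> UNIV" "\<And>i. i \<in> Basis \<Longrightarrow> smooth_on (\<eta>1 i) UNIV"
    using test_functionsE[OF \<eta>(1)] \<eta>1 test_functionsE by metis+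
  note [measurable] = borel_measurable_lebesgue_on[OF test_functions_measurable[OF \<eta>(1)], of \<Omega>]
  have m1[measurable]: "\<eta>1 i \<in> borel_measurable ?M" if "i \<in> Basis" for i
    using test_functions_measurable_on[OF \<eta>1[OF that]] .
  have m2[measurable]: "\<eta>2 i j \<in> borel_measurable ?M" if "i \<in> Basis" "j \<in> Basis" for i j
    using test_functions_measurable_on[OF \<eta>2[OF that]] .
  have ms[measurable]: "(\<lambda>x. x \<bullet> e - a) \<in> borel_measurable ?M" by (rule borel_measurable_lebesgue_on) simp
  obtain M where M: "M \<ge> 0" "\<And>x. \<bar>\<eta> x\<bar> \<le> M" "\<And>i x. i \<in> Basis \<Longrightarrow> \<bar>\<eta>1 i x\<bar> \<le> M"
    "\<And>i j x. i \<in> Basis \<Longrightarrow> j \<in> Basis \<Longrightarrow> \<bar>\<eta>2 i j x\<bar> \<le> M"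
  proof -
    obtain b0 where b0: "\<And>x. \<bar>\<eta> x\<bar> \<le> b0" using test_functions_bounded[OF \<eta>(1)] by metis
    have "\<forall>i\<in>Basis. \<exists>b. \<forall>x. \<bar>\<eta>1 i x\<bar> \<le> b" using \<eta>1 test_functions_bounded by metis
    then obtain b1 where b1: "\<And>i x. i \<in> Basis \<Longrightarrow> \<bar>\<eta>1 i x\<bar> \<le> b1 i" by metis
    have "\<forall>i\<in>Basis. \<forall>j\<in>Basis. \<exists>b. \<forall>x. \<bar>\<eta>2 i j x\<bar> \<le> b" using \<eta>2 test_functions_bounded by metis
    then obtain b2 where b2: "\<And>i j x. i \<in> Basis \<Longrightarrow> j \<in> Basis \<Longrightarrow> \<bar>\<eta>2 i j x\<bar> \<le> b2 i j" by metis
    define F where "F = insert b0 (b1 ` Basis \<union> (\<lambda>(i, j). b2 i j) ` (Basis \<times> Basis))"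
    have F: "finite F" by (simp add: F_def)
    show thesis
    proof (rule that[of "Max F"])
      have le: "b0 \<le> Max F" using F by (intro Max_ge) (auto simp: F_def)
      show "\<bar>\<eta> x\<bar> \<le> Max F" for x using b0 le order_trans by blast
      then show "0 \<le> Max F" using abs_ge_zero order_trans by blast
      show "\<bar>\<eta>1 i x\<bar> \<le> Max F" if "i \<in> Basis" for i x
        using b1[OF that, of x] Max_ge[OF F, of "b1 i"] that by (auto simp: F_def)
      show "\<bar>\<eta>2 i j x\<bar> \<le> Max F" if "i \<in> Basis" "j \<in> Basis" for i j x
        using b2[OF that, of x] Max_ge[OF F, of "b2 i j"] that by (fastforce simp: F_def)
    qed
  qed
  define d where "d n = 1 / real (Suc n)" for n
  have d: "d n > 0" "d n \<le> 1" for n by (auto simp: d_def)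
  have d0: "d \<longlonglongrightarrow> 0" unfolding d_def by (rule LIMSEQ_Suc[OF lim_inverse_n'])
  define Y0 where "Y0 \<delta> x = \<eta> x * profile0 \<delta> (x \<bullet> e - a)" for \<delta> x
  define Y1 where "Y1 \<delta> i x = \<eta>1 i x * profile0 \<delta> (x \<bullet> e - a) + \<eta> x * (profile1 \<delta> (x \<bullet> e - a) * (e \<bullet> i))" for \<delta> i x
  define Y2 where "Y2 \<delta> i j x = (\<eta>2 i j x * profile0 \<delta> (x \<bullet> e - a) + \<eta>1 i x * (profile1 \<delta> (x \<bullet> e - a) * (e \<bullet> j)))
     + (\<eta>1 j x * (profile1 \<delta> (x \<bullet> e - a) * (e \<bullet> i)) + \<eta> x * (profile2 \<delta> (x \<bullet> e - a) * (e \<bullet> i) * (e \<bullet> j)))" for \<delta> i j x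
  have ridge: "smooth_on (\<lambda>x :: 'a. profile0 \<delta> (x \<bullet> e - a)) UNIV" if "\<delta> > 0" for \<delta>
    unfolding profile0_def by (rule smooth_ridge_powr[OF that])
  have ridge1: "pderivative i (\<lambda>x. profile0 \<delta> (x \<bullet> e - a)) = (\<lambda>x. profile1 \<delta> (x \<bullet> e - a) * (e \<bullet> i))"
    if "\<delta> > 0" for \<delta> i using pderivative_ridge[OF profile_DERIV(1)[OF that]] by blast
  have ridge2: "pderivative j (\<lambda>x. profile1 \<delta> (x \<bullet> e - a) * (e \<bullet> i)) = (\<lambda>x. profile2 \<delta> (x \<bullet> e - a) * (e \<bullet> i) * (e \<bullet> j))"
    if "\<delta> > 0" for \<delta> i j using pderivative_ridge[OF DERIV_cmult_right[OF profile_DERIV(2)[OF that]]] by blast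
  have Y0t: "Y0 \<delta> \<in> test_functions \<Omega>" if "\<delta> > 0" for \<delta>
    unfolding Y0_def[abs_def] by (rule test_functions_mult[OF \<eta>(1) ridge[OF that]])
  have Y1: "pderivative i (Y0 \<delta>) = Y1 \<delta> i" if "\<delta> > 0" for \<delta> i
    unfolding Y0_def[abs_def] Y1_def[abs_def] \<eta>1_def using pderivative_mult[OF sm(1) ridge[OF that]] ridge1[OF that] by simp
  have Y2: "pderivative j (Y1 \<delta> i) = Y2 \<delta> i j" if "\<delta> > 0" and i: "i \<in> Basis" for \<delta> i j
  proof -
    have r1: "smooth_on (\<lambda>x. profile1 \<delta> (x \<bullet> e - a) * (e \<bullet> i)) UNIV"
      using smooth_on_pderivative[OF ridge[OF that(1)] i] ridge1[OF that(1)] by simp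
    show ?thesis unfolding Y1_def[abs_def]
      using pderivative_add[OF smooth_on_mult[OF sm(2)[OF i] ridge[OF that(1)]] smooth_on_mult[OF sm(1) r1]]
        pderivative_mult[OF sm(2)[OF i] ridge[OF that(1)]] pderivative_mult[OF sm(1) r1] ridge1[OF that(1)] ridge2[OF that(1)]
      by (simp add: Y2_def[abs_def] \<eta>1_def \<eta>2_def)
  qed
  define P where "P x = ((x \<bullet> e - a)\<^sup>2) powr (-1/8)" for x
  \<comment> \<open>one majorant for the regularised data and their derivatives up to order two\<close>
  define w where "w x = (M * (1 + S\<^sup>2)) * 1 + (M * (4 * S + 3)) * P x" for x
  have P0: "P x \<ge> 0" for x by (simp add: P_def)
  have wL: "w \<in> L2_space \<Omega>"
  proof -
    have "(\<lambda>x. (P x)\<^sup>2) = (\<lambda>x. ((x \<bullet> e - a)\<^sup>2) powr (-1/4))"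
      by (simp add: P_def fun_eq_iff power2_eq_square flip: powr_add)
    then have "integrable ?M (\<lambda>x. (P x)\<^sup>2)" using integrable_hyperplane_singularity[OF \<Omega> e, of a] by simp
    moreover have "P \<in> borel_measurable ?M" unfolding P_def[abs_def] by measurable
    ultimately have "P \<in> L2_space \<Omega>" by (simp add: L2_space_def)
    moreover have "(\<lambda>x. 1) \<in> L2_space \<Omega>"
    proof -
      interpret finite_measure ?M using \<Omega> by (intro finite_measure_lebesgue_on) (auto simp: lmeasurable_open)
      show ?thesis by (simp add: L2_space_def)
    qed
    ultimately show ?thesis unfolding w_def[abs_def] by (rule L2_space_add[rotated])
  qed
  have ae: "AE x in ?M. x \<in> \<Omega> \<and> x \<bullet> e - a \<noteq> 0"
    using AE_hyperplane[OF \<Omega>' e] AE_space by eventually_elim simp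
  have ei: "\<bar>e \<bullet> i\<bar> \<le> 1" if "i \<in> Basis" for i using e that by (simp add: inner_Basis)
  have *: "\<bar>c * v\<bar> \<le> M * K" if "\<bar>c\<bar> \<le> M" "\<bar>v\<bar> \<le> K" for c v K
    unfolding abs_mult using that by (intro mult_mono) auto
  have **: "\<bar>v * b\<bar> \<le> K" if "\<bar>v\<bar> \<le> K" "\<bar>b\<bar> \<le> 1" for v b K :: real
    unfolding abs_mult using that mult_mono[of "\<bar>v\<bar>" K "\<bar>b\<bar>" 1] by linarith
  have bounds: "\<bar>Y0 \<delta> x\<bar> \<le> w x" "i \<in> Basis \<Longrightarrow> \<bar>Y1 \<delta> i x\<bar> \<le> w x" "i \<in> Basis \<Longrightarrow> j \<in> Basis \<Longrightarrow> \<bar>Y2 \<delta> i j x\<bar> \<le> w x"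
    if \<delta>: "0 < \<delta>" "\<delta> \<le> 1" and x: "x \<in> \<Omega>" "x \<bullet> e - a \<noteq> 0" for \<delta> x i j
  proof -
    note p = profile_bounds[OF less_imp_le[OF \<delta>(1)] \<delta>(2) x(2) S(2)[OF x(1)], folded P_def]
    have MP: "0 \<le> M * P x" "0 \<le> M * (S * P x)" using M P0 S by auto
    have "w x = M * (1 + S\<^sup>2) + 4 * (M * (S * P x)) + 3 * (M * P x)" by (simp add: w_def algebra_simps)
    note w = this
    show "\<bar>Y0 \<delta> x\<bar> \<le> w x"
      using *[OF M(2) p(1), of x] MP unfolding Y0_def w by linarith
    show "\<bar>Y1 \<delta> i x\<bar> \<le> w x" if i: "i \<in> Basis"
    proof -
      have "\<bar>\<eta>1 i x * profile0 \<delta> (x \<bullet> e - a)\<bar> \<le> M * (1 + S\<^sup>2)" by (rule *[OF M(3)[OF i] p(1)])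
      moreover have "\<bar>\<eta> x * (profile1 \<delta> (x \<bullet> e - a) * (e \<bullet> i))\<bar> \<le> M * (2 * S * P x)"
        by (rule *[OF M(2) **[OF p(2) ei[OF i]]])
      ultimately show ?thesis using MP unfolding Y1_def w by (simp add: algebra_simps)
    qed
    show "\<bar>Y2 \<delta> i j x\<bar> \<le> w x" if i: "i \<in> Basis" and j: "j \<in> Basis"
    proof -
      have "\<bar>\<eta>2 i j x * profile0 \<delta> (x \<bullet> e - a)\<bar> \<le> M * (1 + S\<^sup>2)" by (rule *[OF M(4)[OF i j] p(1)])
      moreover have "\<bar>\<eta>1 i x * (profile1 \<delta> (x \<bullet> e - a) * (e \<bullet> j))\<bar> \<le> M * (2 * S * P x)"
        by (rule *[OF M(3)[OF i] **[OF p(2) ei[OF j]]])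
      moreover have "\<bar>\<eta>1 j x * (profile1 \<delta> (x \<bullet> e - a) * (e \<bullet> i))\<bar> \<le> M * (2 * S * P x)"
        by (rule *[OF M(3)[OF j] **[OF p(2) ei[OF i]]])
      moreover have "\<bar>\<eta> x * (profile2 \<delta> (x \<bullet> e - a) * (e \<bullet> i) * (e \<bullet> j))\<bar> \<le> M * (3 * P x)"
        by (rule *[OF M(2) **[OF **[OF p(3) ei[OF i]] ei[OF j]]])
      ultimately show ?thesis unfolding Y2_def w by (simp add: algebra_simps)
    qed
  qed
  have lims: "(\<lambda>n. Y0 (d n) x) \<longlonglongrightarrow> Y0 0 x" "(\<lambda>n. Y1 (d n) i x) \<longlonglongrightarrow> Y1 0 i x" "(\<lambda>n. Y2 (d n) i j x) \<longlonglongrightarrow> Y2 0 i j x"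
    if "x \<bullet> e - a \<noteq> 0" for x i j
    unfolding Y0_def Y1_def Y2_def by (intro tendsto_intros profile_tendsto[OF that d0])+
  have Y2': "pderivative j (pderivative i (Y0 (d n))) = Y2 (d n) i j" if "i \<in> Basis" for i j n
    using Y1[OF d(1)] Y2[OF d(1) that] by simp
  have mY: "Y0 0 \<in> borel_measurable ?M" "\<And>i. i \<in> Basis \<Longrightarrow> Y1 0 i \<in> borel_measurable ?M"
    "\<And>i j. i \<in> Basis \<Longrightarrow> j \<in> Basis \<Longrightarrow> Y2 0 i j \<in> borel_measurable ?M"
    unfolding Y0_def[abs_def] Y1_def[abs_def] Y2_def[abs_def] by measurable
  define g where "g x = (\<Sum>i\<in>Basis. Y2 0 i i x)" for x
  have main: "Y0 0 \<in> H2_H10 \<Omega> \<and> (\<forall>\<phi>\<in>test_functions \<Omega>.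
      (LINT x|?M. Y0 0 x * laplacian \<phi> x) = (LINT x|?M. g x * \<phi> x))"
  proof -
    have 1: "\<And>n. Y0 (d n) \<in> test_functions \<Omega>" using Y0t d by blast
    have 2: "AE x in ?M. (\<lambda>n. Y0 (d n) x) \<longlonglongrightarrow> Y0 0 x"
      using ae by eventually_elim (use lims in blast)
    have 3: "AE x in ?M. (\<lambda>n. pderivative i (Y0 (d n)) x) \<longlonglongrightarrow> Y1 0 i x" for i
      unfolding Y1[OF d(1)] using ae by eventually_elim (use lims in blast)
    have 4: "AE x in ?M. (\<lambda>n. pderivative j (pderivative i (Y0 (d n))) x) \<longlonglongrightarrow> Y2 0 i j x" if "i \<in> Basis" for i j
      unfolding Y2'[OF that] using ae by eventually_elim (use lims in blast)
    have 5: "AE x in ?M. \<bar>Y0 (d n) x\<bar> \<le> w x" for n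
      using ae by eventually_elim (use bounds d in blast)
    have 6: "AE x in ?M. \<bar>pderivative i (Y0 (d n)) x\<bar> \<le> w x" if "i \<in> Basis" for i n
      unfolding Y1[OF d(1)] using ae by eventually_elim (use bounds d that in blast)
    have 7: "AE x in ?M. \<bar>pderivative j (pderivative i (Y0 (d n))) x\<bar> \<le> w x" if "i \<in> Basis" "j \<in> Basis" for i j n
      unfolding Y2'[OF that(1)] using ae by eventually_elim (use bounds d that in blast)
    note H = H2_H10_limit[where f = "\<lambda>n. Y0 (d n)" and u = "Y0 0" and g = "Y1 0" and h = "Y2 0",
      OF \<Omega> 1 wL mY 2 3 4 5 6 7]
    show ?thesis unfolding g_def using H by blast
  qed
  define B where "B = (\<Sum>i\<in>(Basis :: 'a set). M * (1 + S\<^sup>2) + 2 * (M * (2 * (1 + S\<^sup>2))))"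
  have gm: "g \<in> borel_measurable ?M" unfolding g_def[abs_def] using mY(3) by (intro borel_measurable_sum) auto
  have lower: "AE x in ?M. \<eta> x * P x - B \<le> \<bar>g x\<bar>"
    using ae
  proof eventually_elim
    case (elim x)
    let ?s = "x \<bullet> e - a"
    note S' = S(2)[of x]
    define r where "r i = \<eta>2 i i x * profile0 0 ?s + 2 * (\<eta>1 i x * (profile1 0 ?s * (e \<bullet> i)))" for i
    have "g x = (\<Sum>i\<in>Basis. r i) + (\<Sum>i\<in>Basis. \<eta> x * (profile2 0 ?s * (e \<bullet> i) * (e \<bullet> i)))"
      unfolding g_def Y2_def r_def sum.distrib[symmetric] by (rule sum.cong) (simp_all add: algebra_simps)
    also have "(\<Sum>i\<in>Basis. \<eta> x * (profile2 0 ?s * (e \<bullet> i) * (e \<bullet> i))) = \<eta> x * profile2 0 ?s * (e \<bullet> e)"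
      unfolding euclidean_inner[of e e] by (simp add: sum_distrib_left mult.assoc)
    also have "\<dots> = 21/16 * (\<eta> x * P x)" using e elim by (simp add: profile2_0 P_def)
    finally have g: "g x = (\<Sum>i\<in>Basis. r i) + 21/16 * (\<eta> x * P x)" .
    have "\<bar>r i\<bar> \<le> M * (1 + S\<^sup>2) + 2 * (M * (2 * (1 + S\<^sup>2)))" if i: "i \<in> Basis" for i
    proof -
      have "\<bar>\<eta>2 i i x * profile0 0 ?s\<bar> \<le> M * (1 + S\<^sup>2)"
        by (rule *[OF M(4)[OF i i] profile_bounds(1)]) (use elim S' in auto)
      moreover have "\<bar>\<eta>1 i x * (profile1 0 ?s * (e \<bullet> i))\<bar> \<le> M * (2 * (1 + S\<^sup>2))"
        by (rule *[OF M(3)[OF i] **[OF profile1_0_bounded ei[OF i]]]) (use elim S' in auto)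
      ultimately show ?thesis unfolding r_def by linarith
    qed
    then have "\<bar>\<Sum>i\<in>Basis. r i\<bar> \<le> B" unfolding B_def by (intro order_trans[OF sum_abs] sum_mono)
    moreover have "0 \<le> \<eta> x * P x" using \<eta>(2) P0 by simp
    ultimately show ?case unfolding g by linarith
  qed
  have gL: "g \<in> L2_space \<Omega>"
  proof (rule L2_space_dominated[OF _ gm])
    show "(\<lambda>x. real DIM('a) * w x + 0 * w x) \<in> L2_space \<Omega>" by (rule L2_space_add[OF wL wL])
    have "AE x in ?M. \<forall>i\<in>Basis. \<bar>Y2 0 i i x\<bar> \<le> w x"
    proof (rule AE_finite_allI[OF finite_Basis])
      fix i :: 'a assume i: "i \<in> Basis"
      show "AE x in ?M. \<bar>Y2 0 i i x\<bar> \<le> w x"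
      proof (rule AE_abs_limit_le)
        show "AE x in ?M. (\<lambda>n. Y2 (d n) i i x) \<longlonglongrightarrow> Y2 0 i i x" using ae by eventually_elim (use lims in blast)
        show "AE x in ?M. \<bar>Y2 (d n) i i x\<bar> \<le> w x" for n using ae by eventually_elim (use bounds d i in blast)
      qed
    qed
    then show "AE x in ?M. \<bar>g x\<bar> \<le> real DIM('a) * w x + 0 * w x"
    proof eventually_elim
      case (elim x)
      have "\<bar>g x\<bar> \<le> (\<Sum>i\<in>(Basis :: 'a set). w x)"
        unfolding g_def using elim by (intro order_trans[OF sum_abs] sum_mono) auto
      then show ?case by simp
    qed
  qed
  show thesis
    by (rule that[of "Y0 0" g B]) (use main gL lower in \<open>auto simp: P_def\<close>)
qed

section \<open>Choice of the hyperplane\<close>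

text \<open>Otherwise \<open>K\<close> is covered by countably many sets of points \<open>x\<close> at whose heights \<open>x \<bullet> e\<close> the slabs of
  half-width \<open>r\<close> meet \<open>K\<close> in measure at most \<open>C * r powr (3/2)\<close> for small \<open>r\<close>, with \<open>C\<close> fixed for each set. About \<open>1 / r\<close> such
  slabs cover one of these sets, so that its measure is at most a multiple of \<open>sqrt r\<close>, hence zero.\<close>

lemma thick_hyperplane_exists:
  fixes K :: "'a::euclidean_space set"
  assumes K: "K \<in> sets lebesgue" "bounded K" "\<not> negligible K" and e: "e \<in> Basis"
  obtains a where "\<And>C r0. C > 0 \<Longrightarrow> r0 > 0 \<Longrightarrow> \<exists>r. 0 < r \<and> r \<le> r0 \<and>
     measure lebesgue (K \<inter> {x. \<bar>x \<bullet> e - a\<bar> \<le> r}) > C * (r * sqrt r)"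
proof -
  let ?S = "\<lambda>a r. K \<inter> {x. \<bar>x \<bullet> e - a\<bar> \<le> r}"
  have S: "?S a r \<in> lmeasurable" for a r
  proof -
    have "closed {x. \<bar>x \<bullet> e - a\<bar> \<le> r}" by (intro closed_Collect_le continuous_intros)
    then have "{x. \<bar>x \<bullet> e - a\<bar> \<le> r} \<in> sets lebesgue" by (simp add: borel_closed sets_completionI_sets)
    then show ?thesis using K by (intro bounded_set_imp_lmeasurable) (auto intro: bounded_subset)
  qed
  obtain R where R: "R > 0" "\<And>x. x \<in> K \<Longrightarrow> norm x \<le> R" using K(2) bounded_pos by metis
  have "\<exists>a. \<forall>C>0. \<forall>r0>0. \<exists>r. 0 < r \<and> r \<le> r0 \<and> measure lebesgue (?S a r) > C * (r * sqrt r)"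
  proof (rule ccontr)
    assume "\<not> ?thesis"
    then have thin: "\<exists>C>0. \<exists>r0>0. \<forall>r. 0 < r \<longrightarrow> r \<le> r0 \<longrightarrow> measure lebesgue (?S a r) \<le> C * (r * sqrt r)" for a
      by (meson not_le)
    \<comment> \<open>heights whose slabs are thin, with constant \<open>n + 1\<close>, for all half-widths up to \<open>1 / (n + 1)\<close>\<close>
    define E where "E n = {a. \<forall>r. 0 < r \<longrightarrow> r \<le> 1 / real (Suc n) \<longrightarrow> measure lebesgue (?S a r) \<le> real (Suc n) * (r * sqrt r)}" for n
    have cover: "\<exists>n. a \<in> E n" for a
    proof -
      obtain C r0 where C: "C > 0" "r0 > 0" "\<And>r. 0 < r \<Longrightarrow> r \<le> r0 \<Longrightarrow> measure lebesgue (?S a r) \<le> C * (r * sqrt r)"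
        using thin[of a] by blast
      obtain n where n: "real n \<ge> max C (1 / r0)" using real_arch_simple by blast
      have "1 / r0 \<le> real (Suc n)" using n by simp
      then have n0: "1 / real (Suc n) \<le> r0" using C(2) by (simp add: divide_le_eq mult.commute)
      have "a \<in> E n" unfolding E_def
      proof (intro CollectI allI impI)
        fix r :: real assume r: "0 < r" "r \<le> 1 / real (Suc n)"
        have "measure lebesgue (?S a r) \<le> C * (r * sqrt r)" by (rule C(3)) (use r n0 in linarith)+
        also have "\<dots> \<le> real (Suc n) * (r * sqrt r)" using n r by (intro mult_right_mono) auto
        finally show "measure lebesgue (?S a r) \<le> real (Suc n) * (r * sqrt r)" .
      qed
      then show ?thesis ..
    qed
    have "negligible {x \<in> K. x \<bullet> e \<in> E n}" for n
      unfolding negligible_outer_le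
    proof (intro allI impI)
      fix \<epsilon> :: real assume \<epsilon>: "\<epsilon> > 0"
      define c where "c = (2 * R + 1) * real (Suc n)"
      have c: "c > 0" using R by (simp add: c_def)
      obtain m0 :: nat where m0: "real m0 \<ge> max (real (Suc n)) ((c / \<epsilon>)\<^sup>2)" using real_arch_simple by blast
      define m where "m = real m0"
      have m: "m \<ge> real (Suc n)" "m \<ge> (c / \<epsilon>)\<^sup>2" "m \<ge> 1" using m0 by (auto simp: m_def)
      \<comment> \<open>the heights are divided into cells of length \<open>1 / m\<close>\<close>
      define cell where "cell s = nat \<lfloor>(s + R) * m\<rfloor>" for s
      define L where "L = nat \<lfloor>2 * R * m\<rfloor>"
      have cell_close: "\<bar>s - t\<bar> \<le> 1 / m" if "cell s = cell t" "-R \<le> s" "-R \<le> t" for s t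
      proof -
        have "0 \<le> (s + R) * m" "0 \<le> (t + R) * m" using that m(3) by auto
        then have "\<lfloor>(s + R) * m\<rfloor> = \<lfloor>(t + R) * m\<rfloor>" using that(1) unfolding cell_def by (simp add: nat_eq_iff)
        then have "\<bar>(s + R) * m - (t + R) * m\<bar> \<le> 1" by linarith
        moreover have "(s + R) * m - (t + R) * m = (s - t) * m" by (simp add: algebra_simps)
        ultimately have "\<bar>s - t\<bar> * m \<le> 1" using m(3) by (simp add: abs_mult)
        then show ?thesis using m(3) by (simp add: le_divide_eq)
      qed
      \<comment> \<open>in each cell that meets \<open>E n\<close>, a point of \<open>E n\<close>; its slab of half-width \<open>1 / m\<close> covers the cell\<close>
      define pt where "pt j = (SOME a. a \<in> E n \<and> -R \<le> a \<and> cell a = j)" for j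
      define F where "F j = (if \<exists>a. a \<in> E n \<and> -R \<le> a \<and> cell a = j then ?S (pt j) (1 / m) else {})" for j
      have pt: "pt j \<in> E n" "-R \<le> pt j" "cell (pt j) = j" if "\<exists>a. a \<in> E n \<and> -R \<le> a \<and> cell a = j" for j
        using someI_ex[OF that] unfolding pt_def by auto
      have Fm: "F j \<in> lmeasurable" for j unfolding F_def using S by auto
      have Fle: "measure lebesgue (F j) \<le> real (Suc n) * (1 / m * sqrt (1 / m))" for j
      proof (cases "\<exists>a. a \<in> E n \<and> -R \<le> a \<and> cell a = j")
        case True
        have "1 / m \<le> 1 / real (Suc n)" using m by (intro divide_left_mono) auto
        moreover have "\<forall>r. 0 < r \<longrightarrow> r \<le> 1 / real (Suc n) \<longrightarrow> measure lebesgue (?S (pt j) r) \<le> real (Suc n) * (r * sqrt r)"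
          using pt(1)[OF True] unfolding E_def by blast
        ultimately have "measure lebesgue (?S (pt j) (1 / m)) \<le> real (Suc n) * (1 / m * sqrt (1 / m))"
          using m(3) by (metis divide_pos_pos less_le_trans zero_less_one)
        moreover have "F j = ?S (pt j) (1 / m)" unfolding F_def using True by (rule if_P)
        ultimately show ?thesis by (simp only:)
      next
        case False
        then have "F j = {}" unfolding F_def by (rule if_not_P)
        then show ?thesis using m(3) by simp
      qed
      show "\<exists>T. {x \<in> K. x \<bullet> e \<in> E n} \<subseteq> T \<and> T \<in> lmeasurable \<and> measure lebesgue T \<le> \<epsilon>"
      proof (intro exI conjI)
        show "{x \<in> K. x \<bullet> e \<in> E n} \<subseteq> (\<Union>j\<le>L. F j)"
        proof
          fix x assume x: "x \<in> {x \<in> K. x \<bullet> e \<in> E n}"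
          let ?s = "x \<bullet> e"
          have "\<bar>?s\<bar> \<le> R" using x R(2)[of x] Basis_le_norm[OF e, of x] by simp
          then have s: "-R \<le> ?s" "?s + R \<le> 2 * R" by linarith+
          have ex: "\<exists>a. a \<in> E n \<and> -R \<le> a \<and> cell a = cell ?s" using x s by blast
          have "x \<in> F (cell ?s)"
            using cell_close[OF pt(3)[OF ex] pt(2)[OF ex] s(1)] ex x unfolding F_def by (simp add: abs_minus_commute)
          moreover have "cell ?s \<le> L"
            unfolding cell_def L_def using s m(3) by (intro nat_mono floor_mono mult_right_mono) auto
          ultimately show "x \<in> (\<Union>j\<le>L. F j)" by blast
        qed
        show "(\<Union>j\<le>L. F j) \<in> lmeasurable" using Fm by (intro fmeasurable.finite_UN) auto
        have "measure lebesgue (\<Union>j\<le>L. F j) \<le> (\<Sum>j\<le>L. measure lebesgue (F j))"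
          using Fm by (intro measure_UNION_le) auto
        also have "\<dots> \<le> (\<Sum>j\<le>L. real (Suc n) * (1 / m * sqrt (1 / m)))" by (intro sum_mono Fle)
        also have "\<dots> = (real L + 1) * (real (Suc n) * (1 / m * sqrt (1 / m)))" by simp
        also have "\<dots> \<le> ((2 * R + 1) * m) * (real (Suc n) * (1 / m * sqrt (1 / m)))"
        proof (rule mult_right_mono)
          have "real L \<le> 2 * R * m" unfolding L_def using R m(3) by simp
          then show "real L + 1 \<le> (2 * R + 1) * m" using m(3) by (simp add: algebra_simps)
        qed (use m(3) in simp)
        also have "\<dots> = c / sqrt m" using m(3) by (simp add: c_def real_sqrt_divide)
        also have "\<dots> \<le> \<epsilon>"
        proof -
          have "c / \<epsilon> \<le> sqrt m" using m(2) c \<epsilon> by (simp add: real_le_rsqrt)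
          then show ?thesis using \<epsilon> m(3) by (simp add: divide_le_eq mult.commute)
        qed
        finally show "measure lebesgue (\<Union>j\<le>L. F j) \<le> \<epsilon>" .
      qed
    qed
    then have "negligible (\<Union>n. {x \<in> K. x \<bullet> e \<in> E n})" by (intro negligible_countable_Union) auto
    moreover have "(\<Union>n. {x \<in> K. x \<bullet> e \<in> E n}) = K" using cover by blast
    ultimately show False using K(3) by simp
  qed
  then show thesis using that by blast
qed

text \<open>On the slab of half-width \<open>r\<close> the square of \<open>Z\<close> is at least of size \<open>1 / sqrt r\<close> on \<open>K\<close>, whereas its
  integral is at most \<open>C * r\<close>.\<close>

lemma thin_if_singular:
  fixes \<Omega> :: "'a::euclidean_space set"
  assumes \<Omega>: "open \<Omega>" "bounded \<Omega>" and K: "K \<in> sets lebesgue" "K \<subseteq> \<Omega>" and e: "e \<in> Basis"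
    and Z: "Z \<in> L2_space \<Omega>" and \<delta>: "\<delta> > 0" and C: "C \<ge> 0"
    and low: "AE x in lebesgue_on \<Omega>. x \<in> K \<longrightarrow> \<delta> * ((x \<bullet> e - a)\<^sup>2) powr (-1/8) - B \<le> \<bar>Z x\<bar>"
    and slab: "\<And>r. r > 0 \<Longrightarrow> (LINT x|lebesgue_on \<Omega>. indicator {a-r..a+r} (x \<bullet> e) * (Z x)\<^sup>2) \<le> C * r"
  obtains C' r0 where "C' > 0" "r0 > 0"
    "\<forall>r. 0 < r \<longrightarrow> r \<le> r0 \<longrightarrow> measure lebesgue (K \<inter> {x. \<bar>x \<bullet> e - a\<bar> \<le> r}) \<le> C' * (r * sqrt r)"
proof -
  have \<Omega>': "\<Omega> \<in> sets lebesgue" using \<Omega>(1) by (rule sets_lebesgue_open)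
  \<comment> \<open>up to this width the singular term is at least twice the constant \<open>B\<close>\<close>
  define r0 where "r0 = (\<delta> / (2 * (\<bar>B\<bar> + 1))) ^ 4"
  have r0: "r0 > 0" using \<delta> by (simp add: r0_def)
  define C' where "C' = 4 * C / \<delta>\<^sup>2 + 1"
  have C': "C' > 0" using C \<delta> by (simp add: C'_def add_nonneg_pos)
  have main: "measure lebesgue (K \<inter> {x. \<bar>x \<bullet> e - a\<bar> \<le> r}) \<le> C' * (r * sqrt r)" if r: "0 < r" "r \<le> r0" for r
  proof -
    let ?M = "lebesgue_on \<Omega>" and ?S = "K \<inter> {x. \<bar>x \<bullet> e - a\<bar> \<le> r}"
    interpret finite_measure ?M using \<Omega> by (intro finite_measure_lebesgue_on) (auto simp: lmeasurable_open)
    define q where "q = r powr (-1/4)"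
    have q: "q > 0" using r by (simp add: q_def)
    have "r powr (1/4) \<le> \<delta> / (2 * (\<bar>B\<bar> + 1))"
    proof -
      have p: "\<delta> / (2 * (\<bar>B\<bar> + 1)) > 0" using \<delta> by simp
      have "r powr (1/4) \<le> r0 powr (1/4)" using r by (intro powr_mono2) auto
      also have "r0 = (\<delta> / (2 * (\<bar>B\<bar> + 1))) powr 4"
        unfolding r0_def by (rule powr_numeral[OF less_imp_le[OF p], symmetric])
      also have "\<dots> powr (1/4) = (\<delta> / (2 * (\<bar>B\<bar> + 1))) powr (4 * (1/4))" by (rule powr_powr)
      finally show ?thesis using p by simp
    qed
    then have "(\<bar>B\<bar> + 1) * r powr (1/4) \<le> \<delta> / 2" by (simp add: field_simps)
    then have "(\<bar>B\<bar> + 1) * r powr (1/4) * q \<le> \<delta> / 2 * q" using q by (intro mult_right_mono) auto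
    moreover have "r powr (1/4) * q = 1" unfolding q_def using r by (simp flip: powr_add)
    ultimately have Bq: "B \<le> \<delta> / 2 * q" by (simp add: mult.assoc)
    have q2: "q\<^sup>2 = 1 / sqrt r"
    proof -
      have "q\<^sup>2 = r powr (-1/2)" unfolding q_def power2_eq_square by (simp flip: powr_add)
      also have "\<dots> = 1 / sqrt r" using r by (simp add: powr_minus_divide powr_half_sqrt)
      finally show ?thesis .
    qed
    have Sm: "?S \<in> sets lebesgue"
    proof -
      have "closed {x. \<bar>x \<bullet> e - a\<bar> \<le> r}" by (intro closed_Collect_le continuous_intros)
      then show ?thesis using K by (simp add: borel_closed sets_completionI_sets sets.Int)
    qed
    then have Sm'[measurable]: "?S \<in> sets ?M" using K \<Omega>' by (auto simp: sets_restrict_space_iff)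
    note [measurable] = L2_spaceD(2)[OF Z]
    have xe[measurable]: "(\<lambda>x. x \<bullet> e) \<in> borel_measurable ?M" by (rule borel_measurable_lebesgue_on) simp
    have "\<delta>\<^sup>2 / 4 * q\<^sup>2 * measure lebesgue ?S = (LINT x|?M. \<delta>\<^sup>2 / 4 * q\<^sup>2 * indicator ?S x)"
    proof -
      have "?S \<inter> \<Omega> = ?S" using K(2) by blast
      then show ?thesis using K(2) \<Omega>' by (simp add: measure_restrict_space le_infI1)
    qed
    also have "\<dots> \<le> (LINT x|?M. indicator {a-r..a+r} (x \<bullet> e) * (Z x)\<^sup>2)"
    proof (rule integral_mono_AE)
      show "integrable ?M (\<lambda>x. \<delta>\<^sup>2 / 4 * q\<^sup>2 * indicator ?S x)"
        by (intro integrable_mult_right integrable_real_indicator) (auto simp: emeasure_finite less_top[symmetric])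
      show "integrable ?M (\<lambda>x. indicator {a-r..a+r} (x \<bullet> e) * (Z x)\<^sup>2)"
        by (rule Bochner_Integration.integrable_bound[OF L2_spaceD(1)[OF Z]]) (auto simp: indicator_def)
      show "AE x in ?M. \<delta>\<^sup>2 / 4 * q\<^sup>2 * indicator ?S x \<le> indicator {a-r..a+r} (x \<bullet> e) * (Z x)\<^sup>2"
        using low AE_hyperplane[OF \<Omega>' e, of a]
      proof eventually_elim
        case (elim x)
        show ?case
        proof (cases "x \<in> ?S")
          case True
          let ?s = "x \<bullet> e - a"
          have s: "\<bar>?s\<bar> \<le> r" "?s \<noteq> 0" using True elim by auto
          then have "?s\<^sup>2 \<le> r\<^sup>2" using abs_le_square_iff[of ?s r] r by simp
          then have "(r\<^sup>2) powr (-1/8) \<le> (?s\<^sup>2) powr (-1/8)" using s by (intro powr_mono2') auto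
          moreover have "(r\<^sup>2) powr (-1/8) = q"
          proof -
            have "r\<^sup>2 = r powr 2" using r by simp
            then show ?thesis unfolding q_def by (simp only: powr_powr) simp
          qed
          ultimately have "\<delta> * q \<le> \<delta> * (?s\<^sup>2) powr (-1/8)" using \<delta> by simp
          then have "\<delta> / 2 * q \<le> \<bar>Z x\<bar>" using elim(1) True Bq by simp
          then have "(\<delta> / 2 * q)\<^sup>2 \<le> \<bar>Z x\<bar>\<^sup>2" using \<delta> q by (intro power_mono) auto
          moreover have "x \<bullet> e \<in> {a-r..a+r}" using s(1) by (simp add: abs_le_iff)
          ultimately show ?thesis using True by (simp add: power_mult_distrib power_divide)
        qed simp
      qed
    qed
    also have "\<dots> \<le> C * r" by (rule slab[OF r(1)])
    finally have "\<delta>\<^sup>2 / 4 * (1 / sqrt r) * measure lebesgue ?S \<le> C * r" unfolding q2 .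
    then have "measure lebesgue ?S \<le> 4 * C / \<delta>\<^sup>2 * (r * sqrt r)" using \<delta> r by (simp add: field_simps)
    also have "\<dots> \<le> C' * (r * sqrt r)" using r by (intro mult_right_mono) (auto simp: C'_def)
    finally show ?thesis .
  qed
  show thesis using main by (intro that[OF C' r0]) blast
qed

section \<open>Integration in time\<close>

text \<open>The function \<open>v\<close> stands for the time derivative of a trajectory. Being Borel measurable on the whole
  space and zero outside the cylinder, it allows Fubini without regard to completions.\<close>

locale space_time_function =
  fixes \<Omega> :: "'a::euclidean_space set" and T :: real and v :: "'a \<times> real \<Rightarrow> real"
  assumes open_\<Omega>: "open \<Omega>" and bounded_\<Omega>: "bounded \<Omega>" and T_pos: "T > 0"
    and v_meas[measurable]: "v \<in> borel_measurable borel"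
    and v_outside: "\<And>p. p \<notin> \<Omega> \<times> {0<..<T} \<Longrightarrow> v p = 0"
    and v_L2: "(\<integral>\<^sup>+p. ennreal ((v p)\<^sup>2) \<partial>lborel) < \<infinity>"
begin

lemma v_pair_meas[measurable]: "v \<in> borel_measurable (lborel \<Otimes>\<^sub>M lborel)"
  by (simp add: lborel_prod)

lemma integrable_v_mult:
  assumes h[measurable]: "h \<in> borel_measurable (lborel \<Otimes>\<^sub>M lborel)"
    and B: "\<And>x t. x \<in> \<Omega> \<Longrightarrow> t \<in> {0<..<T} \<Longrightarrow> \<bar>h (x, t)\<bar> \<le> B"
  shows "integrable (lborel \<Otimes>\<^sub>M lborel) (\<lambda>p. v p * h p)"
proof -
  let ?Q = "\<Omega> \<times> {0<..<T}"
  have Q: "?Q \<in> sets lborel" using open_\<Omega> by (simp add: open_Times borel_open)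
  have "emeasure lborel ?Q < \<infinity>" using bounded_\<Omega> by (intro emeasure_bounded_finite bounded_Times) auto
  then have i1: "integrable lborel (indicator ?Q :: 'a \<times> real \<Rightarrow> real)" using Q by (intro integrable_real_indicator)
  have i2: "integrable lborel (\<lambda>p. (v p)\<^sup>2)" using v_L2 by (intro integrableI_bounded) simp_all
  have "integrable lborel (\<lambda>p. \<bar>B\<bar> * (indicator ?Q p + (v p)\<^sup>2))" using i1 i2 by simp
  then have "integrable lborel (\<lambda>p. v p * h p)"
  proof (rule Bochner_Integration.integrable_bound)
    show "(\<lambda>p. v p * h p) \<in> borel_measurable lborel" using h by (simp add: lborel_prod)
    show "AE p in lborel. norm (v p * h p) \<le> norm (\<bar>B\<bar> * (indicator ?Q p + (v p)\<^sup>2))"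
    proof (intro always_eventually allI)
      fix p :: "'a \<times> real"
      show "norm (v p * h p) \<le> norm (\<bar>B\<bar> * (indicator ?Q p + (v p)\<^sup>2))"
      proof (cases "p \<in> ?Q")
        case True
        have "\<bar>v p\<bar> \<le> 1 + (v p)\<^sup>2" by (rule abs_le_1_square)
        moreover have "\<bar>h p\<bar> \<le> \<bar>B\<bar>" using B[of "fst p" "snd p"] True by (cases p) auto
        ultimately have "\<bar>h p\<bar> * \<bar>v p\<bar> \<le> \<bar>B\<bar> * (1 + (v p)\<^sup>2)" by (intro mult_mono) auto
        then show ?thesis using True by (simp add: abs_mult mult.commute)
      qed (simp add: v_outside)
    qed
  qed
  then show ?thesis by (simp only: lborel_prod)
qed

definition moment :: "('a \<Rightarrow> real) \<Rightarrow> real \<Rightarrow> real" where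
  "moment \<psi> t = (LINT x|lborel. v (x, t) * \<psi> x)"

lemma moment_outside: "t \<notin> {0<..<T} \<Longrightarrow> moment \<psi> t = 0"
  by (simp add: moment_def v_outside)

text \<open>Fubini for the pairing with a function of space and a weight in time.\<close>

lemma moment_weighted:
  assumes \<psi>[measurable]: "\<psi> \<in> borel_measurable borel" and B: "\<And>x. \<bar>\<psi> x\<bar> \<le> B"
    and \<kappa>[measurable]: "\<kappa> \<in> borel_measurable borel" and K: "\<And>t. t \<in> {0<..<T} \<Longrightarrow> \<bar>\<kappa> t\<bar> \<le> K"
  shows "integrable lborel (\<lambda>t. \<kappa> t * moment \<psi> t)"
    and "(LINT t|lborel. \<kappa> t * moment \<psi> t) = (LINT x|lborel. (LINT t|lborel. \<kappa> t * v (x, t)) * \<psi> x)"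
proof -
  have "integrable (lborel \<Otimes>\<^sub>M lborel) (\<lambda>p. v p * (\<psi> (fst p) * \<kappa> (snd p)))"
  proof (rule integrable_v_mult)
    show "\<bar>\<psi> (fst (x, t)) * \<kappa> (snd (x, t))\<bar> \<le> B * K" if "t \<in> {0<..<T}" for x t
      using B[of x] K[OF that] by (auto simp: abs_mult intro!: mult_mono)
  qed measurable
  then have i: "integrable (lborel \<Otimes>\<^sub>M lborel) (case_prod (\<lambda>x t. v (x, t) * (\<psi> x * \<kappa> t)))"
    by (simp add: case_prod_beta')
  have eq: "(LINT x|lborel. v (x, t) * (\<psi> x * \<kappa> t)) = \<kappa> t * moment \<psi> t" for t
    unfolding moment_def integral_mult_right_zero[symmetric] by (rule Bochner_Integration.integral_cong) simp_all
  have eq': "(LINT t|lborel. v (x, t) * (\<psi> x * \<kappa> t)) = (LINT t|lborel. \<kappa> t * v (x, t)) * \<psi> x" for x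
    unfolding integral_mult_left_zero[symmetric] by (rule Bochner_Integration.integral_cong) simp_all
  show "integrable lborel (\<lambda>t. \<kappa> t * moment \<psi> t)"
    using lborel_pair.integrable_snd[OF i] unfolding eq .
  show "(LINT t|lborel. \<kappa> t * moment \<psi> t) = (LINT x|lborel. (LINT t|lborel. \<kappa> t * v (x, t)) * \<psi> x)"
    using lborel_pair.Fubini_integral[OF i] unfolding eq eq' .
qed

text \<open>Fubini, as the integral of \<open>exp\<close> from 0 to \<open>s\<close> is \<open>exp s - 1\<close>.\<close>

lemma integral_exp_tail:
  assumes \<mu>: "integrable lborel \<mu>" and out: "\<And>s. s \<notin> {0<..<T} \<Longrightarrow> \<mu> s = 0"
  shows "integrable lborel (\<lambda>t. indicator {0..T} t * (exp t * (LINT s|lborel. indicator {t..T} s * \<mu> s)))"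
    and "(LINT t|lborel. indicator {0..T} t * (exp t * (LINT s|lborel. indicator {t..T} s * \<mu> s)))
      = (LINT s|lborel. (exp s - 1) * \<mu> s)"
proof -
  have [measurable]: "\<mu> \<in> borel_measurable borel" using \<mu> by auto
  define k where "k t = exp T * indicator {0..T} t" for t :: real
  have [measurable]: "k \<in> borel_measurable borel" unfolding k_def by measurable
  have k: "integrable lborel k" unfolding k_def
    using T_pos by (intro integrable_mult_right integrable_real_indicator) auto
  have G: "integrable (lborel \<Otimes>\<^sub>M lborel) (\<lambda>p. \<mu> (fst p) * k (snd p))"
  proof (rule lborel_pair.Fubini_integrable)
    show "integrable lborel (\<lambda>s. LINT t|lborel. norm (\<mu> (fst (s, t)) * k (snd (s, t))))"
      using \<mu> by (simp add: abs_mult)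
    show "AE s in lborel. integrable lborel (\<lambda>t. \<mu> (fst (s, t)) * k (snd (s, t)))"
      using k by simp
  qed measurable
  define f where "f s t = indicator {0..s} t * exp t * \<mu> s" for s t :: real
  have fm: "(\<lambda>p. f (fst p) (snd p)) \<in> borel_measurable (lborel \<Otimes>\<^sub>M lborel)"
  proof -
    have "f s t = (if 0 \<le> t \<and> t \<le> s then exp t * \<mu> s else 0)" for s t by (simp add: f_def indicator_def)
    then show ?thesis by simp
  qed
  have f: "integrable (lborel \<Otimes>\<^sub>M lborel) (case_prod f)"
  proof (rule Bochner_Integration.integrable_bound[OF G])
    show "case_prod f \<in> borel_measurable (lborel \<Otimes>\<^sub>M lborel)" using fm by (simp add: case_prod_beta')
    show "AE p in lborel \<Otimes>\<^sub>M lborel. norm (case_prod f p) \<le> norm (\<mu> (fst p) * k (snd p))"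
    proof (intro always_eventually allI)
      fix p :: "real \<times> real"
      obtain s t where p: "p = (s, t)" by (cases p)
      show "norm (case_prod f p) \<le> norm (\<mu> (fst p) * k (snd p))"
      proof (cases "s \<in> {0<..<T} \<and> t \<in> {0..s}")
        case True
        then have "exp t \<le> exp T" by simp
        then have "\<bar>\<mu> s\<bar> * exp t \<le> \<bar>\<mu> s\<bar> * exp T" by (intro mult_left_mono) auto
        then show ?thesis using True unfolding p by (simp add: f_def k_def abs_mult mult.commute)
      next
        case False
        then have "f s t = 0" using out[of s] by (auto simp: f_def)
        then show ?thesis unfolding p by simp
      qed
    qed
  qed
  have eq: "(LINT s|lborel. f s t) = indicator {0..T} t * (exp t * (LINT s|lborel. indicator {t..T} s * \<mu> s))" for t
  proof -
    have "f s t = indicator {0..T} t * (exp t * (indicator {t..T} s * \<mu> s))" for s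
      using out[of s] by (cases "s \<in> {0<..<T}") (auto simp: f_def indicator_def)
    then show ?thesis by simp
  qed
  have eq': "(LINT t|lborel. f s t) = (exp s - 1) * \<mu> s" for s
  proof (cases "s \<in> {0<..<T}")
    case True
    then have "has_bochner_integral lborel (\<lambda>t. exp t * indicator {0..s} t) (exp s - exp 0)"
      by (intro has_bochner_integral_FTC_Icc_real) (auto intro!: derivative_eq_intros)
    then have "(LINT t|lborel. exp t * indicator {0..s} t) = exp s - 1" by (simp add: has_bochner_integral_iff)
    then show ?thesis by (simp add: f_def mult.commute[of "indicator _ _"])
  next
    case False
    then show ?thesis using out[of s] by (simp add: f_def)
  qed
  show "integrable lborel (\<lambda>t. indicator {0..T} t * (exp t * (LINT s|lborel. indicator {t..T} s * \<mu> s)))"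
    using lborel_pair.integrable_snd[OF f] unfolding eq .
  show "(LINT t|lborel. indicator {0..T} t * (exp t * (LINT s|lborel. indicator {t..T} s * \<mu> s)))
      = (LINT s|lborel. (exp s - 1) * \<mu> s)"
    using lborel_pair.Fubini_integral[OF f] unfolding eq eq' .
qed

text \<open>If \<open>v\<close> is the time derivative of a trajectory that ends at 0, then \<open>tail t\<close> is minus the state at
  time \<open>t\<close> and \<open>total\<close> is minus the initial state; \<open>exp_mean\<close> is the mean that turns out to be minus the
  Laplacian of the initial state where no control acts.\<close>

definition exp_mean :: "'a \<Rightarrow> real" where
  "exp_mean x = (LINT t|lborel. exp t * v (x, t))"

definition total :: "'a \<Rightarrow> real" where
  "total x = (LINT t|lborel. v (x, t))"

definition tail :: "real \<Rightarrow> 'a \<Rightarrow> real" where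
  "tail t x = (LINT s|lborel. indicator {t..T} s * v (x, s))"

lemma mean_measurable[measurable]:
  "exp_mean \<in> borel_measurable borel" "total \<in> borel_measurable borel" "tail t \<in> borel_measurable borel"
proof -
  have "(\<lambda>x. LINT t|lborel. exp t * v (x, t)) \<in> borel_measurable lborel"
    "(\<lambda>x. LINT t|lborel. v (x, t)) \<in> borel_measurable lborel"
    "(\<lambda>x. LINT s|lborel. indicator {t..T} s * v (x, s)) \<in> borel_measurable lborel"
    by measurable
  then show "exp_mean \<in> borel_measurable borel" "total \<in> borel_measurable borel" "tail t \<in> borel_measurable borel"
    unfolding exp_mean_def[abs_def] total_def[abs_def] tail_def[abs_def] by simp_all
qed

lemma mean_outside: "x \<notin> \<Omega> \<Longrightarrow> exp_mean x = 0" "x \<notin> \<Omega> \<Longrightarrow> total x = 0" "x \<notin> \<Omega> \<Longrightarrow> tail t x = 0"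
  by (simp_all add: exp_mean_def total_def tail_def v_outside)

lemma integral_tail_moment:
  assumes \<psi>: "\<psi> \<in> borel_measurable borel" "\<And>x. \<bar>\<psi> x\<bar> \<le> B"
  shows "(LINT x|lborel. tail t x * \<psi> x) = (LINT s|lborel. indicator {t..T} s * moment \<psi> s)"
  unfolding tail_def using moment_weighted(2)[OF \<psi>, of "\<lambda>s. indicator {t..T} s" 1] by (simp add: indicator_def)

text \<open>For \<open>\<psi>\<close> the Laplacian of \<open>\<phi>\<close>, the left side is the weak form of the equation, weighted by \<open>exp t\<close>. The
  weights of \<open>moment \<psi>\<close> are \<open>- exp t\<close> and, from the tails, \<open>exp t - 1\<close>; they sum to \<open>- 1\<close>, so that
  just \<open>total\<close> survives.\<close>

lemma time_integrated_identity:
  assumes \<phi>: "\<phi> \<in> borel_measurable borel" "\<And>x. \<bar>\<phi> x\<bar> \<le> B" and \<psi>: "\<psi> \<in> borel_measurable borel" "\<And>x. \<bar>\<psi> x\<bar> \<le> B'"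
  shows "integrable lborel (\<lambda>t. indicator {0..T} t * (exp t * (moment \<phi> t - moment \<psi> t + (LINT x|lborel. tail t x * \<psi> x))))"
    and "(LINT t|lborel. indicator {0..T} t * (exp t * (moment \<phi> t - moment \<psi> t + (LINT x|lborel. tail t x * \<psi> x))))
    = (LINT x|lborel. exp_mean x * \<phi> x) - (LINT x|lborel. total x * \<psi> x)"
proof -
  let ?f = "\<lambda>t. indicator {0..T} t * (exp t * (moment \<phi> t - moment \<psi> t + (LINT x|lborel. tail t x * \<psi> x)))"
  have e: "\<bar>exp t\<bar> \<le> exp T" if "t \<in> {0<..<T}" for t :: real using that by simp
  have e1: "\<bar>exp t - 1\<bar> \<le> exp T" if "t \<in> {0<..<T}" for t :: real
  proof -
    have "1 \<le> exp t" "exp t \<le> exp T" using that by simp_all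
    then show ?thesis by linarith
  qed
  note m1 = moment_weighted[OF \<phi>, of exp "exp T", OF _ e] and m2 = moment_weighted[OF \<psi>, of exp "exp T", OF _ e]
  have i: "integrable lborel (moment \<psi>)" using moment_weighted(1)[OF \<psi>, of "\<lambda>_. 1" 1] by simp
  have m3: "integrable lborel (\<lambda>t. (exp t - 1) * moment \<psi> t)"
    by (rule moment_weighted(1)[OF \<psi>, where K = "exp T"]) (use e1 in auto)
  note tl = integral_exp_tail[OF i moment_outside, folded integral_tail_moment[OF \<psi>]]
  have ind: "indicator {0..T} t * (exp t * moment \<theta> t) = exp t * moment \<theta> t" for t \<theta>
    using moment_outside[of t \<theta>] by (cases "t \<in> {0<..<T}") auto
  have split: "?f t
     = exp t * moment \<phi> t - exp t * moment \<psi> t + indicator {0..T} t * (exp t * (LINT x|lborel. tail t x * \<psi> x))" for t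
    by (simp add: ring_distribs ind)
  show "integrable lborel ?f"
    unfolding split using m1(1) m2(1) tl(1) by simp
  have "(LINT t|lborel. ?f t)
     = (LINT t|lborel. exp t * moment \<phi> t - exp t * moment \<psi> t + indicator {0..T} t * (exp t * (LINT x|lborel. tail t x * \<psi> x)))"
    unfolding split ..
  also have "\<dots> = (LINT t|lborel. exp t * moment \<phi> t) - (LINT t|lborel. exp t * moment \<psi> t)
      + (LINT t|lborel. (exp t - 1) * moment \<psi> t)"
    using m1(1) m2(1) tl by simp
  also have "\<dots> = (LINT t|lborel. exp t * moment \<phi> t) - (LINT t|lborel. moment \<psi> t)"
    using m2(1) i by (simp add: left_diff_distrib)
  also have "(LINT t|lborel. exp t * moment \<phi> t) = (LINT x|lborel. exp_mean x * \<phi> x)"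
    unfolding exp_mean_def using m1(2) by simp
  also have "(LINT t|lborel. moment \<psi> t) = (LINT x|lborel. total x * \<psi> x)"
    unfolding total_def using moment_weighted(2)[OF \<psi>, of "\<lambda>_. 1" 1] by simp
  finally show "(LINT t|lborel. ?f t)
    = (LINT x|lborel. exp_mean x * \<phi> x) - (LINT x|lborel. total x * \<psi> x)" .
qed

text \<open>Cauchy-Schwarz in time, then Tonelli.\<close>

lemma exp_mean_square_le:
  fixes i :: "'a \<Rightarrow> ennreal"
  assumes [measurable]: "i \<in> borel_measurable borel"
  shows "(\<integral>\<^sup>+x. i x * ennreal ((exp_mean x)\<^sup>2) \<partial>lborel)
    \<le> ennreal (T * exp (2 * T)) * (\<integral>\<^sup>+t. (\<integral>\<^sup>+x. i x * ennreal ((v (x, t))\<^sup>2) \<partial>lborel) \<partial>lborel)"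
proof -
  have *: "ennreal ((exp_mean x)\<^sup>2) \<le> ennreal (T * exp (2 * T)) * (\<integral>\<^sup>+t. ennreal ((v (x, t))\<^sup>2) \<partial>lborel)" for x
  proof -
    have vm: "(\<lambda>t. v (x, t)) \<in> borel_measurable borel" by measurable
    have "exp_mean x = (LINT t|lborel. (exp t * v (x, t)) * indicator {0<..<T} t)"
    proof -
      have "exp t * v (x, t) = (exp t * v (x, t)) * indicator {0<..<T} t" for t
        using v_outside[of "(x, t)"] by (cases "t \<in> {0<..<T}") auto
      then show ?thesis unfolding exp_mean_def by (intro Bochner_Integration.integral_cong refl)
    qed
    then have "ennreal ((exp_mean x)\<^sup>2) \<le> emeasure lborel {0<..<T} *
        (\<integral>\<^sup>+t. indicator {0<..<T} t * ennreal ((exp t * v (x, t))\<^sup>2) \<partial>lborel)"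
      using vm by (simp only:) (intro square_integral_le, measurable)
    also have "\<dots> \<le> ennreal T * (\<integral>\<^sup>+t. ennreal (exp (2 * T)) * ennreal ((v (x, t))\<^sup>2) \<partial>lborel)"
    proof (rule mult_mono)
      have "indicator {0<..<T} t * ennreal ((exp t * v (x, t))\<^sup>2) \<le> ennreal (exp (2 * T)) * ennreal ((v (x, t))\<^sup>2)" for t
      proof (cases "t \<in> {0<..<T}")
        case True
        have "(exp t)\<^sup>2 = exp (2 * t)" by (simp add: exp_double)
        also have "\<dots> \<le> exp (2 * T)" using True by simp
        finally have "(exp t * v (x, t))\<^sup>2 \<le> exp (2 * T) * (v (x, t))\<^sup>2"
          unfolding power_mult_distrib by (intro mult_right_mono) auto
        then show ?thesis using True by (simp flip: ennreal_mult')
      qed simp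
      then show "(\<integral>\<^sup>+t. indicator {0<..<T} t * ennreal ((exp t * v (x, t))\<^sup>2) \<partial>lborel)
          \<le> (\<integral>\<^sup>+t. ennreal (exp (2 * T)) * ennreal ((v (x, t))\<^sup>2) \<partial>lborel)"
        by (rule nn_integral_mono)
    qed (use T_pos in auto)
    also have "\<dots> = ennreal (T * exp (2 * T)) * (\<integral>\<^sup>+t. ennreal ((v (x, t))\<^sup>2) \<partial>lborel)"
      using vm T_pos by (subst nn_integral_cmult) (auto simp: ennreal_mult mult.assoc)
    finally show ?thesis .
  qed
  have "(\<integral>\<^sup>+x. i x * ennreal ((exp_mean x)\<^sup>2) \<partial>lborel)
     \<le> (\<integral>\<^sup>+x. ennreal (T * exp (2 * T)) * (\<integral>\<^sup>+t. i x * ennreal ((v (x, t))\<^sup>2) \<partial>lborel) \<partial>lborel)"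
  proof (rule nn_integral_mono)
    fix x :: 'a
    have "i x * ennreal ((exp_mean x)\<^sup>2) \<le> i x * (ennreal (T * exp (2 * T)) * (\<integral>\<^sup>+t. ennreal ((v (x, t))\<^sup>2) \<partial>lborel))"
      by (rule mult_left_mono[OF *]) simp
    also have "\<dots> = ennreal (T * exp (2 * T)) * (i x * (\<integral>\<^sup>+t. ennreal ((v (x, t))\<^sup>2) \<partial>lborel))"
      by (simp add: mult.left_commute)
    also have "i x * (\<integral>\<^sup>+t. ennreal ((v (x, t))\<^sup>2) \<partial>lborel) = (\<integral>\<^sup>+t. i x * ennreal ((v (x, t))\<^sup>2) \<partial>lborel)"
      by (rule nn_integral_cmult[symmetric]) measurable
    finally show "i x * ennreal ((exp_mean x)\<^sup>2) \<le> ennreal (T * exp (2 * T)) * (\<integral>\<^sup>+t. i x * ennreal ((v (x, t))\<^sup>2) \<partial>lborel)" .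
  qed
  also have "\<dots> = ennreal (T * exp (2 * T)) * (\<integral>\<^sup>+x. (\<integral>\<^sup>+t. i x * ennreal ((v (x, t))\<^sup>2) \<partial>lborel) \<partial>lborel)"
    by (rule nn_integral_cmult) measurable
  also have "(\<integral>\<^sup>+x. (\<integral>\<^sup>+t. i x * ennreal ((v (x, t))\<^sup>2) \<partial>lborel) \<partial>lborel) = (\<integral>\<^sup>+t. (\<integral>\<^sup>+x. i x * ennreal ((v (x, t))\<^sup>2) \<partial>lborel) \<partial>lborel)"
    by (rule lborel_pair.Fubini'[symmetric]) measurable
  finally show ?thesis .
qed

end

section \<open>Slices in the second Sobolev space\<close>

text \<open>The bound \<open>\<bar>u\<bar> \<le> 1 + u\<^sup>2\<close> in place of Cauchy-Schwarz makes the right side affine in the squared norm,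
  the quantity that is integrable in time.\<close>

lemma integral_abs_le:
  assumes S: "S \<in> lmeasurable" and u: "u \<in> L2_space S"
  shows "(LINT x|lebesgue_on S. \<bar>u x\<bar>) \<le> measure lebesgue S + (LINT x|lebesgue_on S. (u x)\<^sup>2)"
proof -
  interpret finite_measure "lebesgue_on S" by (rule finite_measure_lebesgue_on[OF S])
  have "(LINT x|lebesgue_on S. \<bar>u x\<bar>) \<le> (LINT x|lebesgue_on S. 1 + (u x)\<^sup>2)"
    using L2_space_integrable[OF S u] L2_spaceD(1)[OF u] by (intro integral_mono abs_le_1_square) auto
  also have "\<dots> = measure (lebesgue_on S) S + (LINT x|lebesgue_on S. (u x)\<^sup>2)"
    using L2_spaceD(1)[OF u] by simp
  also have "measure (lebesgue_on S) S = measure lebesgue S"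
    using S by (intro measure_restrict_space) auto
  finally show ?thesis .
qed

text \<open>The iterated choice in \<open>wlaplacian\<close> still gives the distributional Laplacian.\<close>

lemma wlaplacian_L2:
  assumes \<Omega>: "open \<Omega>" "bounded \<Omega>" and u: "u \<in> Sobolev_H 2 \<Omega>"
  shows "wlaplacian \<Omega> u \<in> L2_space \<Omega>"
    and "\<And>\<phi>. \<phi> \<in> test_functions \<Omega> \<Longrightarrow>
      (LINT x|lebesgue_on \<Omega>. wlaplacian \<Omega> u x * \<phi> x) = (LINT x|lebesgue_on \<Omega>. u x * laplacian \<phi> x)"
    and "(LINT x|lebesgue_on \<Omega>. \<bar>wlaplacian \<Omega> u x\<bar>) \<le> real DIM('a) * measure lebesgue \<Omega> + Sobolev_sqnorm 2 (\<Omega> :: 'a::euclidean_space set) u"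
proof -
  let ?h = "\<lambda>i. wpartial \<Omega> i (wpartial \<Omega> i u)"
  have \<Omega>m: "\<Omega> \<in> lmeasurable" using \<Omega> by (simp add: lmeasurable_open)
  have u2: "u \<in> Sobolev_H (Suc (Suc 0)) \<Omega>" using u by (simp only: numeral_2_eq_2)
  have uL: "u \<in> L2_space \<Omega>" using Sobolev_H_imp_L2[OF u] .
  note w1 = Sobolev_H_wpartial[OF u2] and w2 = Sobolev_H_wpartial[OF Sobolev_H_Suc_wpartial[OF \<Omega> u2]]
  have h: "?h i \<in> L2_space \<Omega>" if "i \<in> Basis" for i using w2(1)[OF that that] .
  have sumL: "(\<lambda>x. \<Sum>i\<in>I. ?h i x) \<in> L2_space \<Omega>" if "I \<subseteq> Basis" for I
    using finite_subset[OF that finite_Basis] that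
  proof (induction I rule: finite_induct)
    case empty
    then show ?case by (simp add: L2_space_def)
  next
    case (insert i I)
    then show ?case using L2_space_add[of "?h i" \<Omega> "\<lambda>x. \<Sum>i\<in>I. ?h i x" 1 1] h by simp
  qed
  show L: "wlaplacian \<Omega> u \<in> L2_space \<Omega>" unfolding wlaplacian_def[abs_def] by (rule sumL) simp
  show "(LINT x|lebesgue_on \<Omega>. wlaplacian \<Omega> u x * \<phi> x) = (LINT x|lebesgue_on \<Omega>. u x * laplacian \<phi> x)"
    if "\<phi> \<in> test_functions \<Omega>" for \<phi>
    unfolding wlaplacian_def using weak_laplacian[OF \<Omega> that uL, of "\<lambda>i. wpartial \<Omega> i u" ?h] w1 w2 by simp
  have "(LINT x|lebesgue_on \<Omega>. \<bar>wlaplacian \<Omega> u x\<bar>) \<le> (LINT x|lebesgue_on \<Omega>. (\<Sum>i\<in>Basis. \<bar>?h i x\<bar>))"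
  proof (rule integral_mono)
    show "integrable (lebesgue_on \<Omega>) (\<lambda>x. \<bar>wlaplacian \<Omega> u x\<bar>)" using L2_space_integrable[OF \<Omega>m L] by simp
    show "integrable (lebesgue_on \<Omega>) (\<lambda>x. \<Sum>i\<in>Basis. \<bar>?h i x\<bar>)"
      using L2_space_integrable[OF \<Omega>m h] by (intro Bochner_Integration.integrable_sum) simp
  qed (simp add: wlaplacian_def sum_abs)
  also have "\<dots> = (\<Sum>i\<in>Basis. LINT x|lebesgue_on \<Omega>. \<bar>?h i x\<bar>)"
    using L2_space_integrable[OF \<Omega>m h] by (intro Bochner_Integration.integral_sum) simp
  also have "\<dots> \<le> (\<Sum>i\<in>Basis. measure lebesgue \<Omega> + Sobolev_sqnorm 1 \<Omega> (wpartial \<Omega> i u))"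
  proof (rule sum_mono)
    fix i :: 'a assume i: "i \<in> Basis"
    have "(LINT x|lebesgue_on \<Omega>. (?h i x)\<^sup>2) \<le> Sobolev_sqnorm 1 \<Omega> (wpartial \<Omega> i u)"
      using Sobolev_sqnorm_Suc_ge(2)[OF i, of 0 \<Omega> "wpartial \<Omega> i u"] by (simp only: Sobolev_sqnorm.simps(1) One_nat_def)
    then show "(LINT x|lebesgue_on \<Omega>. \<bar>?h i x\<bar>) \<le> measure lebesgue \<Omega> + Sobolev_sqnorm 1 \<Omega> (wpartial \<Omega> i u)"
      using integral_abs_le[OF \<Omega>m h[OF i]] by linarith
  qed
  also have "\<dots> \<le> real DIM('a) * measure lebesgue \<Omega> + Sobolev_sqnorm 2 \<Omega> u"
  proof -
    have "Sobolev_sqnorm 2 \<Omega> u = (LINT x|lebesgue_on \<Omega>. (u x)\<^sup>2) + (\<Sum>i\<in>Basis. Sobolev_sqnorm 1 \<Omega> (wpartial \<Omega> i u))"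
      by (simp only: numeral_2_eq_2 One_nat_def Sobolev_sqnorm.simps(2)[of "Suc 0"])
    moreover have "0 \<le> (LINT x|lebesgue_on \<Omega>. (u x)\<^sup>2)" by simp
    ultimately show ?thesis by (simp add: sum.distrib)
  qed
  finally show "(LINT x|lebesgue_on \<Omega>. \<bar>wlaplacian \<Omega> u x\<bar>) \<le> real DIM('a) * measure lebesgue \<Omega> + Sobolev_sqnorm 2 \<Omega> u" .
qed

lemma AE_lborel_imp_lebesgue_on:
  assumes "S \<in> sets lebesgue" "AE x in lborel. x \<in> S \<longrightarrow> P x"
  shows "AE x in lebesgue_on S. P x"
  using assms by (simp add: AE_restrict_space_iff AE_completion)

lemma integral_slice:
  fixes w :: "'a::euclidean_space \<Rightarrow> real"
  assumes \<Omega>: "\<Omega> \<in> sets lebesgue" and u: "u \<in> borel_measurable (lebesgue_on \<Omega>)"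
    and w: "w \<in> borel_measurable borel" "\<And>x. x \<notin> \<Omega> \<Longrightarrow> w x = 0" "AE x in lborel. x \<in> \<Omega> \<longrightarrow> w x = u x"
    and \<psi>: "\<psi> \<in> borel_measurable borel"
  shows "(LINT x|lebesgue_on \<Omega>. u x * \<psi> x) = (LINT x|lborel. w x * \<psi> x)"
proof -
  note [measurable] = u borel_measurable_lebesgue_on[OF w(1)] borel_measurable_lebesgue_on[OF \<psi>]
  have "AE x in lebesgue_on \<Omega>. w x = u x" by (rule AE_lborel_imp_lebesgue_on[OF \<Omega> w(3)])
  then have "AE x in lebesgue_on \<Omega>. u x * \<psi> x = w x * \<psi> x" by eventually_elim simp
  then have "(LINT x|lebesgue_on \<Omega>. u x * \<psi> x) = (LINT x|lebesgue_on \<Omega>. w x * \<psi> x)"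
    by (intro integral_cong_AE) measurable
  also have "\<dots> = (LINT x|lborel. w x * \<psi> x)"
    using w \<psi> by (intro integral_lebesgue_on_eq_lborel[OF \<Omega>]) auto
  finally show ?thesis .
qed

lemma nn_integral_slice:
  fixes w :: "'a::euclidean_space \<Rightarrow> real"
  assumes \<Omega>: "\<Omega> \<in> sets lebesgue" and u: "u \<in> L2_space \<Omega>"
    and w: "w \<in> borel_measurable borel" "\<And>x. x \<notin> \<Omega> \<Longrightarrow> w x = 0" "AE x in lborel. x \<in> \<Omega> \<longrightarrow> w x = u x"
    and i: "i \<in> borel_measurable borel" "\<And>x. 0 \<le> i x" "\<And>x. i x \<le> 1"
  shows "(\<integral>\<^sup>+x. ennreal (i x) * ennreal ((w x)\<^sup>2) \<partial>lborel) = ennreal (LINT x|lebesgue_on \<Omega>. i x * (u x)\<^sup>2)"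
proof -
  note [measurable] = L2_spaceD(2)[OF u] borel_measurable_lebesgue_on[OF i(1)]
  have int: "integrable (lebesgue_on \<Omega>) (\<lambda>x. i x * (u x)\<^sup>2)"
    by (rule Bochner_Integration.integrable_bound[OF L2_spaceD(1)[OF u]])
      (use i in \<open>auto simp: abs_mult mult_left_le_one_le\<close>)
  have "(\<integral>\<^sup>+x. ennreal (i x) * ennreal ((w x)\<^sup>2) \<partial>lborel) = (\<integral>\<^sup>+x. ennreal (i x * (u x)\<^sup>2) * indicator \<Omega> x \<partial>lborel)"
  proof (rule nn_integral_cong_AE)
    show "AE x in lborel. ennreal (i x) * ennreal ((w x)\<^sup>2) = ennreal (i x * (u x)\<^sup>2) * indicator \<Omega> x"
      using w(3)
    proof eventually_elim
      case (elim x)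
      then show ?case using i(2)[of x] w(2)[of x] by (cases "x \<in> \<Omega>") (auto simp: ennreal_mult)
    qed
  qed
  also have "\<dots> = (\<integral>\<^sup>+x. ennreal (i x * (u x)\<^sup>2) * indicator \<Omega> x \<partial>lebesgue)" by (rule nn_integral_completion[symmetric])
  also have "\<dots> = (\<integral>\<^sup>+x. ennreal (i x * (u x)\<^sup>2) \<partial>lebesgue_on \<Omega>)" using \<Omega> by (simp add: nn_integral_restrict_space)
  also have "\<dots> = ennreal (LINT x|lebesgue_on \<Omega>. i x * (u x)\<^sup>2)"
    using i(2) by (intro nn_integral_eq_integral[OF int]) auto
  finally show ?thesis .
qed

text \<open>Here \<open>b\<close> is a Borel representative of the squared norm of \<open>z t\<close> in \<open>H\<^sup>2\<close>.\<close>

locale Sobolev_slices = space_time_function \<Omega> T v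
  for \<Omega> :: "'a::euclidean_space set" and T and v +
  fixes z :: "real \<Rightarrow> 'a \<Rightarrow> real" and b :: "real \<Rightarrow> real"
  assumes slices: "AE t in lborel. t \<in> {0<..<T} \<longrightarrow>
      z t \<in> H2_H10 \<Omega> \<and> Sobolev_sqnorm 2 \<Omega> (z t) = b t \<and> (AE x in lborel. x \<in> \<Omega> \<longrightarrow> v (x, t) = z t x)"
    and b_int: "integrable lborel b" and b_nonneg: "\<And>t. b t \<ge> 0"
begin

lemma \<Omega>_sets: "\<Omega> \<in> sets lebesgue" and \<Omega>_lmeasurable: "\<Omega> \<in> lmeasurable"
  using open_\<Omega> bounded_\<Omega> by (auto simp: sets_lebesgue_open lmeasurable_open)

lemma moment_slice:
  assumes "z t \<in> H2_H10 \<Omega>" "AE x in lborel. x \<in> \<Omega> \<longrightarrow> v (x, t) = z t x" "\<psi> \<in> borel_measurable borel"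
  shows "moment \<psi> t = (LINT x|lebesgue_on \<Omega>. z t x * \<psi> x)"
proof -
  have "z t \<in> L2_space \<Omega>" using assms(1) Sobolev_H_imp_L2 unfolding H2_H10_def by blast
  moreover have "(\<lambda>x. v (x, t)) \<in> borel_measurable borel" by measurable
  ultimately show ?thesis unfolding moment_def
    using assms(2,3) v_outside by (intro integral_slice[OF \<Omega>_sets, symmetric] L2_spaceD(2)) auto
qed

text \<open>The bounds are uniform in \<open>\<phi>\<close>, which is what dominated convergence in time needs. For the second
  one, the derivatives have to be moved from \<open>\<phi>\<close> to \<open>z t\<close>.\<close>

lemma moment_bounds:
  assumes t: "z t \<in> H2_H10 \<Omega>" "AE x in lborel. x \<in> \<Omega> \<longrightarrow> v (x, t) = z t x"
    and \<phi>: "\<phi> \<in> test_functions \<Omega>" "\<And>x. \<bar>\<phi> x\<bar> \<le> 1"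
  shows "\<bar>moment \<phi> t\<bar> \<le> measure lebesgue \<Omega> + Sobolev_sqnorm 2 \<Omega> (z t)"
    and "\<bar>moment (laplacian \<phi>) t\<bar> \<le> real DIM('a) * measure lebesgue \<Omega> + Sobolev_sqnorm 2 \<Omega> (z t)"
proof -
  have le: "\<bar>LINT x|lebesgue_on \<Omega>. u x * \<phi> x\<bar> \<le> (LINT x|lebesgue_on \<Omega>. \<bar>u x\<bar>)" if u: "u \<in> L2_space \<Omega>" for u
  proof -
    have "\<bar>LINT x|lebesgue_on \<Omega>. u x * \<phi> x\<bar> \<le> (LINT x|lebesgue_on \<Omega>. \<bar>u x * \<phi> x\<bar>)"
      by (rule integral_abs_bound)
    also have "\<dots> \<le> (LINT x|lebesgue_on \<Omega>. \<bar>u x\<bar>)"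
    proof (rule integral_mono)
      show "integrable (lebesgue_on \<Omega>) (\<lambda>x. \<bar>u x * \<phi> x\<bar>)"
        by (intro integrable_abs integrable_L2_mult_test[OF open_\<Omega> bounded_\<Omega> u \<phi>(1)])
      show "integrable (lebesgue_on \<Omega>) (\<lambda>x. \<bar>u x\<bar>)"
        by (intro integrable_abs L2_space_integrable[OF \<Omega>_lmeasurable u])
    qed (use \<phi>(2) in \<open>auto simp: abs_mult mult_left_le\<close>)
    finally show ?thesis .
  qed
  have z2: "z t \<in> Sobolev_H 2 \<Omega>" using t(1) unfolding H2_H10_def by blast
  have zL: "z t \<in> L2_space \<Omega>" using Sobolev_H_imp_L2[OF z2] .
  have m: "moment \<phi> t = (LINT x|lebesgue_on \<Omega>. z t x * \<phi> x)"
    by (rule moment_slice[OF t test_functions_measurable[OF \<phi>(1)]])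
  show "\<bar>moment \<phi> t\<bar> \<le> measure lebesgue \<Omega> + Sobolev_sqnorm 2 \<Omega> (z t)"
    unfolding m using le[OF zL] integral_abs_le[OF \<Omega>_lmeasurable zL] Sobolev_sqnorm_Suc_ge(1)[of \<Omega> "z t" 2] by linarith
  have "moment (laplacian \<phi>) t = (LINT x|lebesgue_on \<Omega>. wlaplacian \<Omega> (z t) x * \<phi> x)"
    using moment_slice[OF t test_functions_measurable[OF laplacian_test_function[OF \<phi>(1)]]]
      wlaplacian_L2(2)[OF open_\<Omega> bounded_\<Omega> z2 \<phi>(1)] by simp
  then show "\<bar>moment (laplacian \<phi>) t\<bar> \<le> real DIM('a) * measure lebesgue \<Omega> + Sobolev_sqnorm 2 \<Omega> (z t)"
    using le[OF wlaplacian_L2(1)[OF open_\<Omega> bounded_\<Omega> z2]] wlaplacian_L2(3)[OF open_\<Omega> bounded_\<Omega> z2] by linarith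
qed

text \<open>Almost every slice is in \<open>H\<^sup>1\<^sub>0\<close>, so that the slab estimate can be averaged in time.\<close>

lemma exp_mean_slab:
  assumes e: "e \<in> Basis"
  obtains C where "C \<ge> 0" "\<And>a r. r > 0 \<Longrightarrow> (LINT x|lebesgue_on \<Omega>. indicator {a-r..a+r} (x \<bullet> e) * (exp_mean x)\<^sup>2) \<le> C * r"
proof -
  obtain D where D: "D \<ge> 0" "\<forall>u\<in>Sobolev_H10 \<Omega>. \<forall>I\<in>sets borel. \<forall>l\<ge>0. emeasure lborel I \<le> ennreal l \<longrightarrow>
    (LINT x|lebesgue_on \<Omega>. indicator I (x \<bullet> e) * (u x)\<^sup>2) \<le> D * l * (LINT x|lebesgue_on \<Omega>. (wpartial \<Omega> e u x)\<^sup>2)"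
    using Sobolev_H10_slab[OF open_\<Omega> bounded_\<Omega> e] by blast
  define c where "c = T * exp (2 * T)"
  have c: "c \<ge> 0" using T_pos by (simp add: c_def)
  define \<beta> where "\<beta> = integral\<^sup>L lborel b"
  have \<beta>: "\<beta> \<ge> 0" unfolding \<beta>_def using b_nonneg by simp
  have main: "(LINT x|lebesgue_on \<Omega>. indicator {a-r..a+r} (x \<bullet> e) * (exp_mean x)\<^sup>2) \<le> (c * D * 2 * \<beta>) * r" if r: "r > 0" for a r
  proof -
    let ?i = "\<lambda>x. indicator {a-r..a+r} (x \<bullet> e) :: real"
    have im[measurable]: "?i \<in> borel_measurable borel" by measurable
    have "(\<integral>\<^sup>+x. ennreal (?i x) * ennreal ((exp_mean x)\<^sup>2) \<partial>lborel)
      \<le> ennreal c * (\<integral>\<^sup>+t. (\<integral>\<^sup>+x. ennreal (?i x) * ennreal ((v (x, t))\<^sup>2) \<partial>lborel) \<partial>lborel)"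
      unfolding c_def by (rule exp_mean_square_le) measurable
    also have "(\<integral>\<^sup>+t. (\<integral>\<^sup>+x. ennreal (?i x) * ennreal ((v (x, t))\<^sup>2) \<partial>lborel) \<partial>lborel) \<le> (\<integral>\<^sup>+t. ennreal (D * (2 * r) * b t) \<partial>lborel)"
    proof (rule nn_integral_mono_AE)
      show "AE t in lborel. (\<integral>\<^sup>+x. ennreal (?i x) * ennreal ((v (x, t))\<^sup>2) \<partial>lborel) \<le> ennreal (D * (2 * r) * b t)"
        using slices
      proof eventually_elim
        case (elim t)
        show ?case
        proof (cases "t \<in> {0<..<T}")
          case True
          then have z: "z t \<in> H2_H10 \<Omega>" "Sobolev_sqnorm 2 \<Omega> (z t) = b t" "AE x in lborel. x \<in> \<Omega> \<longrightarrow> v (x, t) = z t x"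
            using elim by auto
          have zL: "z t \<in> L2_space \<Omega>" and z1: "z t \<in> Sobolev_H10 \<Omega>" using z(1) Sobolev_H_imp_L2 unfolding H2_H10_def by blast+
          have vm: "(\<lambda>x. v (x, t)) \<in> borel_measurable borel" by measurable
          have "(\<integral>\<^sup>+x. ennreal (?i x) * ennreal ((v (x, t))\<^sup>2) \<partial>lborel) = ennreal (LINT x|lebesgue_on \<Omega>. ?i x * (z t x)\<^sup>2)"
            by (rule nn_integral_slice[OF \<Omega>_sets zL vm _ z(3) im]) (auto simp: v_outside)
          also have "(LINT x|lebesgue_on \<Omega>. ?i x * (z t x)\<^sup>2) \<le> D * (2 * r) * (LINT x|lebesgue_on \<Omega>. (wpartial \<Omega> e (z t) x)\<^sup>2)"
            by (rule D(2)[rule_format, OF z1]) (use r in auto)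
          also have "\<dots> \<le> D * (2 * r) * b t"
          proof (rule mult_left_mono)
            have "(LINT x|lebesgue_on \<Omega>. (wpartial \<Omega> e (z t) x)\<^sup>2) \<le> Sobolev_sqnorm (Suc 0) \<Omega> (wpartial \<Omega> e (z t))"
              by (rule Sobolev_sqnorm_Suc_ge(1))
            also have "\<dots> \<le> Sobolev_sqnorm (Suc (Suc 0)) \<Omega> (z t)" by (rule Sobolev_sqnorm_Suc_ge(2)[OF e])
            finally show "(LINT x|lebesgue_on \<Omega>. (wpartial \<Omega> e (z t) x)\<^sup>2) \<le> b t"
              using z(2) by (simp only: numeral_2_eq_2)
          qed (use D r in simp)
          finally show ?thesis by (simp add: ennreal_leI)
        next
          case False
          then show ?thesis by (simp add: v_outside)
        qed
      qed
    qed
    also have "\<dots> = ennreal (LINT t|lborel. D * (2 * r) * b t)"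
      using b_int b_nonneg D r by (intro nn_integral_eq_integral) auto
    also have "(LINT t|lborel. D * (2 * r) * b t) = D * (2 * r) * \<beta>" by (simp add: \<beta>_def)
    also have "ennreal c * ennreal (D * (2 * r) * \<beta>) = ennreal ((c * D * 2 * \<beta>) * r)"
      using c D r \<beta> by (simp add: ennreal_mult[symmetric] algebra_simps)
    finally have le: "(\<integral>\<^sup>+x. ennreal (?i x) * ennreal ((exp_mean x)\<^sup>2) \<partial>lborel) \<le> ennreal ((c * D * 2 * \<beta>) * r)"
      by (simp add: mult_left_mono)
    have "(LINT x|lebesgue_on \<Omega>. ?i x * (exp_mean x)\<^sup>2) = (LINT x|lborel. ?i x * (exp_mean x)\<^sup>2)"
      using mean_outside(1) by (intro integral_lebesgue_on_eq_lborel[OF \<Omega>_sets]) auto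
    also have "\<dots> = enn2real (\<integral>\<^sup>+x. ennreal (?i x * (exp_mean x)\<^sup>2) \<partial>lborel)"
      by (rule integral_eq_nn_integral) auto
    also have "\<dots> = enn2real (\<integral>\<^sup>+x. ennreal (?i x) * ennreal ((exp_mean x)\<^sup>2) \<partial>lborel)" by (simp add: ennreal_mult)
    also have "\<dots> \<le> (c * D * 2 * \<beta>) * r" using le c D \<beta> r by (intro enn2real_leI) auto
    finally show ?thesis .
  qed
  show thesis by (rule that[of "c * D * 2 * \<beta>", OF _ main]) (use c D \<beta> in auto)
qed

lemma exp_mean_L2: "exp_mean \<in> L2_space \<Omega>"
proof -
  have "(\<integral>\<^sup>+x. 1 * ennreal ((exp_mean x)\<^sup>2) \<partial>lborel)
     \<le> ennreal (T * exp (2 * T)) * (\<integral>\<^sup>+t. (\<integral>\<^sup>+x. 1 * ennreal ((v (x, t))\<^sup>2) \<partial>lborel) \<partial>lborel)"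
    by (rule exp_mean_square_le) simp
  also have "(\<integral>\<^sup>+t. (\<integral>\<^sup>+x. 1 * ennreal ((v (x, t))\<^sup>2) \<partial>lborel) \<partial>lborel) = (\<integral>\<^sup>+p. ennreal ((v p)\<^sup>2) \<partial>(lborel \<Otimes>\<^sub>M lborel))"
    using lborel_pair.nn_integral_snd[of "\<lambda>p. ennreal ((v p)\<^sup>2)"] by simp
  also have "\<dots> = (\<integral>\<^sup>+p. ennreal ((v p)\<^sup>2) \<partial>lborel)" by (simp only: lborel_prod)
  also have "ennreal (T * exp (2 * T)) * \<dots> < \<infinity>" using v_L2 by (simp add: ennreal_mult_less_top)
  finally have "integrable lborel (\<lambda>x. (exp_mean x)\<^sup>2)" by (intro integrableI_bounded) auto
  then have "integrable (lebesgue_on \<Omega>) (\<lambda>x. (exp_mean x)\<^sup>2)"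
    using mean_outside(1) by (subst integrable_lebesgue_on_iff_lborel[OF \<Omega>_sets]) auto
  then show ?thesis using borel_measurable_lebesgue_on[OF mean_measurable(1)] by (simp add: L2_space_def)
qed

end

lemma integrable_borel_version:
  fixes h :: "'a::euclidean_space \<Rightarrow> real"
  assumes S: "S \<in> sets lebesgue" and h: "integrable (lebesgue_on S) h" "\<And>x. h x \<ge> 0"
  obtains b where "integrable lborel b" "\<And>x. b x \<ge> 0" "AE x in lborel. x \<in> S \<longrightarrow> h x = b x"
proof -
  have int: "integrable lebesgue (\<lambda>x. indicator S x * h x)"
    using h(1) S by (simp add: integrable_restrict_space)
  then have m: "(\<lambda>x. indicator S x * h x) \<in> borel_measurable lebesgue" by auto
  obtain b where b: "b \<in> borel_measurable lborel" "AE x in lborel. indicator S x * h x = b x"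
    using completion_ex_borel_measurable_real[OF m] by blast
  have bm: "(\<lambda>x. \<bar>b x\<bar>) \<in> borel_measurable lborel" using b(1) by measurable
  have ae: "AE x in lborel. indicator S x * h x = \<bar>b x\<bar>"
    using b(2)
  proof eventually_elim
    case (elim x)
    have "0 \<le> b x" unfolding elim[symmetric] using h(2)[of x] by simp
    then show ?case using elim by simp
  qed
  have "integrable lebesgue (\<lambda>x. \<bar>b x\<bar>)"
    using Bochner_Integration.integrable_cong_AE[OF m measurable_completion[OF bm] AE_completion[OF ae]] int by simp
  then have "integrable lborel (\<lambda>x. \<bar>b x\<bar>)" using bm by (simp only: integrable_completion)
  moreover have "AE x in lborel. x \<in> S \<longrightarrow> h x = \<bar>b x\<bar>" using ae by eventually_elim auto
  ultimately show thesis using that[of "\<lambda>x. \<bar>b x\<bar>"] by simp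
qed

text \<open>A jointly Lebesgue measurable function agrees with a Borel function off a null set \<open>N\<close>. By Fubini
  almost every section of \<open>N\<close> is null, in either variable; sections at fixed \<open>t\<close> serve the equation,
  those at fixed \<open>x\<close> the reconstruction of the trajectory from its derivative.\<close>

lemma L2_time_slices:
  fixes \<Omega> :: "'a::euclidean_space set"
  assumes \<Omega>: "open \<Omega>" "bounded \<Omega>" and T: "T > 0" and z: "z \<in> L2_time T \<Omega>"
  obtains v b N where "Sobolev_slices \<Omega> T v z b" "N \<in> null_sets lborel"
    "\<And>x t. (x, t) \<notin> N \<Longrightarrow> x \<in> \<Omega> \<Longrightarrow> t \<in> {0<..<T} \<Longrightarrow> v (x, t) = z t x"
proof -
  let ?Q = "\<Omega> \<times> {0<..<T}"
  have Q: "?Q \<in> sets borel" using \<Omega>(1) by (simp add: open_Times borel_open)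
  then have Q': "?Q \<in> sets lebesgue" by (simp add: sets_completionI_sets)
  have "(\<lambda>(x, t). z t x) \<in> borel_measurable (lebesgue_on ?Q)" using z by (simp add: L2_time_def)
  then have m: "(\<lambda>p. indicator ?Q p * z (snd p) (fst p)) \<in> borel_measurable lebesgue"
    using Q' by (simp add: borel_measurable_restrict_space_iff case_prod_beta')
  obtain v0 where v0: "v0 \<in> borel_measurable lborel" "AE p in lborel. indicator ?Q p * z (snd p) (fst p) = v0 p"
    using completion_ex_borel_measurable_real[OF m] by blast
  obtain N where N: "N \<in> null_sets lborel" "{p \<in> space lborel. \<not> indicator ?Q p * z (snd p) (fst p) = v0 p} \<subseteq> N"
    using v0(2) unfolding eventually_ae_filter by blast
  define v where "v p = indicator ?Q p * v0 p" for p
  have vm: "v \<in> borel_measurable borel" unfolding v_def[abs_def] using v0(1) Q by (simp add: borel_measurable_indicator borel_measurable_times)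
  have out: "v p = 0" if "p \<notin> ?Q" for p using that by (simp add: v_def)
  have eq: "v (x, t) = z t x" if "(x, t) \<notin> N" "x \<in> \<Omega>" "t \<in> {0<..<T}" for x t
  proof -
    have "(x, t) \<notin> {p \<in> space lborel. \<not> indicator ?Q p * z (snd p) (fst p) = v0 p}" using N(2) that(1) by blast
    then show ?thesis using that(2,3) by (simp add: v_def)
  qed
  have nN: "AE p in lborel \<Otimes>\<^sub>M lborel. p \<notin> N" unfolding lborel_prod by (rule AE_not_in[OF N(1)])
  have N': "N \<in> sets (lborel \<Otimes>\<^sub>M lborel)" unfolding lborel_prod using N(1) by auto
  have "AE x in lborel. AE t in lborel. (x, t) \<notin> N" by (rule lborel_pair.AE_pair[OF nN])
  then have slice: "AE t in lborel. AE x in lborel. (x, t) \<notin> N"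
  proof (subst lborel_pair.AE_commute[symmetric])
    have "{p \<in> space (lborel \<Otimes>\<^sub>M lborel). (fst p, snd p) \<notin> N} = space (lborel \<Otimes>\<^sub>M lborel) - N" by auto
    then show "{p \<in> space (lborel \<Otimes>\<^sub>M lborel). (fst p, snd p) \<notin> N} \<in> sets (lborel \<Otimes>\<^sub>M lborel)"
      using sets.compl_sets[OF N'] by metis
  qed
  have n: "(\<lambda>t. Sobolev_norm 2 \<Omega> (z t)) \<in> L2_space {0<..<T}" using z by (simp add: L2_time_def)
  have "(\<lambda>t. (Sobolev_norm 2 \<Omega> (z t))\<^sup>2) = (\<lambda>t. Sobolev_sqnorm 2 \<Omega> (z t))"
    unfolding Sobolev_norm_def using Sobolev_sqnorm_nonneg by (intro ext real_sqrt_pow2)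
  then have nint: "integrable (lebesgue_on {0<..<T}) (\<lambda>t. Sobolev_sqnorm 2 \<Omega> (z t))"
    using L2_spaceD(1)[OF n] by simp
  obtain b where b: "integrable lborel b" "\<And>t. b t \<ge> 0" "AE t in lborel. t \<in> {0<..<T} \<longrightarrow> Sobolev_sqnorm 2 \<Omega> (z t) = b t"
    by (rule integrable_borel_version[OF _ nint Sobolev_sqnorm_nonneg]) auto
  have "AE t in lebesgue_on {0<..<T}. z t \<in> H2_H10 \<Omega>" using z by (simp add: L2_time_def)
  then have zH: "AE t in lborel. t \<in> {0<..<T} \<longrightarrow> z t \<in> H2_H10 \<Omega>"
    by (simp add: AE_restrict_space_iff AE_completion_iff)
  have sl: "AE t in lborel. t \<in> {0<..<T} \<longrightarrow>
      z t \<in> H2_H10 \<Omega> \<and> Sobolev_sqnorm 2 \<Omega> (z t) = b t \<and> (AE x in lborel. x \<in> \<Omega> \<longrightarrow> v (x, t) = z t x)"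
    using slice b(3) zH
  proof eventually_elim
    case (elim t)
    show ?case
    proof
      assume t: "t \<in> {0<..<T}"
      have "AE x in lborel. x \<in> \<Omega> \<longrightarrow> v (x, t) = z t x"
        using elim(1) by eventually_elim (use eq t in blast)
      then show "z t \<in> H2_H10 \<Omega> \<and> Sobolev_sqnorm 2 \<Omega> (z t) = b t \<and> (AE x in lborel. x \<in> \<Omega> \<longrightarrow> v (x, t) = z t x)"
        using elim t by blast
    qed
  qed
  have vpm: "v \<in> borel_measurable (lborel \<Otimes>\<^sub>M lborel)" using vm by (simp add: lborel_prod)
  have vx: "(\<lambda>x. v (x, t)) \<in> borel_measurable borel" for t
  proof -
    note [measurable] = vpm
    have "(\<lambda>x. v (x, t)) \<in> borel_measurable lborel" by measurable
    then show ?thesis by simp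
  qed
  have "(\<integral>\<^sup>+p. ennreal ((v p)\<^sup>2) \<partial>lborel) = (\<integral>\<^sup>+p. ennreal ((v p)\<^sup>2) \<partial>(lborel \<Otimes>\<^sub>M lborel))" by (simp only: lborel_prod)
  also have "\<dots> = (\<integral>\<^sup>+t. (\<integral>\<^sup>+x. ennreal ((v (x, t))\<^sup>2) \<partial>lborel) \<partial>lborel)"
  proof (rule lborel_pair.nn_integral_snd[symmetric])
    note [measurable] = vpm
    show "(\<lambda>p. ennreal ((v p)\<^sup>2)) \<in> borel_measurable (lborel \<Otimes>\<^sub>M lborel)" by measurable
  qed
  also have "\<dots> \<le> (\<integral>\<^sup>+t. ennreal (b t) \<partial>lborel)"
  proof (rule nn_integral_mono_AE)
    show "AE t in lborel. (\<integral>\<^sup>+x. ennreal ((v (x, t))\<^sup>2) \<partial>lborel) \<le> ennreal (b t)"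
      using sl
    proof eventually_elim
      case (elim t)
      show ?case
      proof (cases "t \<in> {0<..<T}")
        case True
        then have zt: "z t \<in> H2_H10 \<Omega>" "Sobolev_sqnorm 2 \<Omega> (z t) = b t" "AE x in lborel. x \<in> \<Omega> \<longrightarrow> v (x, t) = z t x"
          using elim by auto
        have zL: "z t \<in> L2_space \<Omega>" using zt(1) Sobolev_H_imp_L2 unfolding H2_H10_def by blast
        have "(\<integral>\<^sup>+x. ennreal 1 * ennreal ((v (x, t))\<^sup>2) \<partial>lborel) = ennreal (LINT x|lebesgue_on \<Omega>. 1 * (z t x)\<^sup>2)"
          by (rule nn_integral_slice[OF sets_lebesgue_open[OF \<Omega>(1)] zL vx _ zt(3)]) (auto simp: out)
        also have "(LINT x|lebesgue_on \<Omega>. 1 * (z t x)\<^sup>2) \<le> b t"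
          unfolding zt(2)[symmetric] mult_1 by (rule Sobolev_sqnorm_Suc_ge(1))
        finally show ?thesis by (simp add: ennreal_leI)
      next
        case False
        then show ?thesis by (simp add: out)
      qed
    qed
  qed
  also have "\<dots> = ennreal (integral\<^sup>L lborel b)" using b by (intro nn_integral_eq_integral) auto
  also have "\<dots> < \<infinity>" by simp
  finally have "Sobolev_slices \<Omega> T v z b"
    using \<Omega> T vm out sl b by unfold_locales auto
  then show thesis using that N(1) eq by blast
qed

section \<open>Trajectories that are steered to rest\<close>

context Sobolev_slices
begin

text \<open>The final condition allows integration backwards from \<open>T\<close>.\<close>

lemma trajectory_from_derivative:
  assumes N: "N \<in> null_sets lborel" "\<And>x t. (x, t) \<notin> N \<Longrightarrow> x \<in> \<Omega> \<Longrightarrow> t \<in> {0<..<T} \<Longrightarrow> v (x, t) = z t x"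
    and y: "has_time_derivative T \<Omega> y z" "AE x in lebesgue_on \<Omega>. y T x = 0" and t: "t \<in> {0..T}"
  shows "AE x in lebesgue_on \<Omega>. y t x = - tail t x" "AE x in lebesgue_on \<Omega>. y 0 x = - total x"
proof -
  have nN: "AE p in lborel \<Otimes>\<^sub>M lborel. p \<notin> N" unfolding lborel_prod by (rule AE_not_in[OF N(1)])
  have ae1: "AE x in lborel. AE s in lborel. (x, s) \<notin> N" by (rule lborel_pair.AE_pair[OF nN])
  have "integrable (lborel \<Otimes>\<^sub>M lborel) v" using integrable_v_mult[of "\<lambda>_. 1" 1] by simp
  then have ae2: "AE x in lborel. integrable lborel (\<lambda>s. v (x, s))" by (rule lborel_pair.AE_integrable_fst')
  have prim: "AE x in lebesgue_on \<Omega>. y \<tau> x = y 0 x + (LINT s|lborel. indicator {0..\<tau>} s * v (x, s))" if \<tau>: "\<tau> \<in> {0..T}" for \<tau>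
  proof -
    have "AE x in lebesgue_on \<Omega>. (LINT s|lebesgue_on {0..\<tau>}. z s x) = (LINT s|lborel. indicator {0..\<tau>} s * v (x, s))"
    proof (rule AE_lborel_imp_lebesgue_on[OF \<Omega>_sets])
      show "AE x in lborel. x \<in> \<Omega> \<longrightarrow> (LINT s|lebesgue_on {0..\<tau>}. z s x) = (LINT s|lborel. indicator {0..\<tau>} s * v (x, s))"
        using ae1
      proof (eventually_elim, intro impI)
        fix x assume x: "AE s in lborel. (x, s) \<notin> N" "x \<in> \<Omega>"
        have vm: "(\<lambda>s. indicator {0..\<tau>} s * v (x, s)) \<in> borel_measurable lborel" by measurable
        have "AE s in lborel. s \<noteq> 0" "AE s in lborel. s \<noteq> T" by (rule AE_lborel_singleton)+
        with x(1) have "AE s in lborel. indicator {0..\<tau>} s * v (x, s) = indicator {0..\<tau>} s * z s x"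
        proof eventually_elim
          case (elim s)
          show ?case
          proof (cases "s \<in> {0..\<tau>}")
            case True
            then have "s \<in> {0<..<T}" using elim \<tau> by auto
            then show ?thesis using N(2)[OF elim(1) x(2)] by simp
          qed simp
        qed
        then have ae: "AE s in lebesgue. indicator {0..\<tau>} s * v (x, s) = indicator {0..\<tau>} s * z s x" by (rule AE_completion)
        have vm': "(\<lambda>s. indicator {0..\<tau>} s * v (x, s)) \<in> borel_measurable lebesgue" by (rule measurable_completion[OF vm])
        have zm: "(\<lambda>s. indicator {0..\<tau>} s * z s x) \<in> borel_measurable lebesgue" by (rule borel_measurable_AE[OF vm' ae])
        have "(LINT s|lebesgue_on {0..\<tau>}. z s x) = (LINT s|lebesgue. indicator {0..\<tau>} s * z s x)"
          by (simp add: integral_restrict_space)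
        also have "\<dots> = (LINT s|lebesgue. indicator {0..\<tau>} s * v (x, s))"
          by (rule integral_cong_AE[OF zm vm']) (use ae in \<open>auto elim: eventually_mono\<close>)
        also have "\<dots> = (LINT s|lborel. indicator {0..\<tau>} s * v (x, s))" by (rule integral_completion[OF vm])
        finally show "(LINT s|lebesgue_on {0..\<tau>}. z s x) = (LINT s|lborel. indicator {0..\<tau>} s * v (x, s))" .
      qed
    qed
    moreover have "AE x in lebesgue_on \<Omega>. y \<tau> x = y 0 x + (LINT s|lebesgue_on {0..\<tau>}. z s x)"
      using y(1) \<tau> unfolding has_time_derivative_def by blast
    ultimately show ?thesis by eventually_elim simp
  qed
  have ae2': "AE x in lebesgue_on \<Omega>. integrable lborel (\<lambda>s. v (x, s))"
    by (rule AE_lborel_imp_lebesgue_on[OF \<Omega>_sets]) (use ae2 in \<open>auto elim: eventually_mono\<close>)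
  have T: "T \<in> {0..T}" using T_pos by simp
  have ind_T: "indicator {0..T} s * v (x, s) = v (x, s)" for x s using v_outside[of "(x, s)"] by (cases "s \<in> {0<..<T}") auto
  show "AE x in lebesgue_on \<Omega>. y 0 x = - total x"
    using prim[OF T] y(2) by eventually_elim (simp add: total_def ind_T)
  show "AE x in lebesgue_on \<Omega>. y t x = - tail t x"
    using prim[OF T] prim[OF t] y(2) ae2'
  proof eventually_elim
    case (elim x)
    have i: "integrable lborel (\<lambda>s. indicator A s * v (x, s))" if "A \<in> sets borel" for A
      using integrable_mult_indicator[OF _ elim(4), of A] that by simp
    have "tail t x = (LINT s|lborel. indicator {0..T} s * v (x, s) - indicator {0..t} s * v (x, s))"
      unfolding tail_def
    proof (rule integral_cong_AE)
      have "AE s in lborel. s \<noteq> t" by (rule AE_lborel_singleton)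
      then show "AE s in lborel. indicator {t..T} s * v (x, s) = indicator {0..T} s * v (x, s) - indicator {0..t} s * v (x, s)"
        by eventually_elim (use t in \<open>auto simp: indicator_def\<close>)
    qed measurable
    also have "\<dots> = (LINT s|lborel. indicator {0..T} s * v (x, s)) - (LINT s|lborel. indicator {0..t} s * v (x, s))"
      by (intro Bochner_Integration.integral_diff i) auto
    finally show ?case using elim(1-3) by simp
  qed
qed

text \<open>As \<open>K\<close> need not contain an open set, no test function is supported in it. Instead, take test functions
  that approximate the indicator of a subset \<open>E\<close> of \<open>K\<close>: for each of them the derivatives can be moved and
  the time integrated identity applies, and in the limit the weak form of the equation tends to the
  integral over \<open>E\<close> of the equation itself, which is 0. Dominated convergence in time is justified by
  bounds in terms of the norm of \<open>z t\<close> only.\<close>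

lemma exp_mean_uncontrolled:
  assumes N: "N \<in> null_sets lborel" "\<And>x t. (x, t) \<notin> N \<Longrightarrow> x \<in> \<Omega> \<Longrightarrow> t \<in> {0<..<T} \<Longrightarrow> v (x, t) = z t x"
    and y: "has_time_derivative T \<Omega> y z" "AE x in lebesgue_on \<Omega>. y T x = 0"
    and yH: "\<And>t. t \<in> {0..T} \<Longrightarrow> y t \<in> H2_H10 \<Omega>"
    and eq: "AE t in lborel. t \<in> {0<..<T} \<longrightarrow> (AE x in lebesgue_on \<Omega>.
        x \<in> K \<longrightarrow> z t x - wlaplacian \<Omega> (z t) x - wlaplacian \<Omega> (y t) x = 0)"
    and K: "K \<in> sets lebesgue" "K \<subseteq> \<Omega>"
    and g: "g \<in> L2_space \<Omega>" "\<And>\<phi>. \<phi> \<in> test_functions \<Omega> \<Longrightarrow>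
        (LINT x|lebesgue_on \<Omega>. y 0 x * laplacian \<phi> x) = (LINT x|lebesgue_on \<Omega>. g x * \<phi> x)"
  shows "AE x in lebesgue_on \<Omega>. x \<in> K \<longrightarrow> exp_mean x + g x = 0"
proof -
  let ?M = "lebesgue_on \<Omega>"
  let ?F = "\<lambda>x. exp_mean x + g x"
  \<comment> \<open>the residual of the equation without control\<close>
  define q where "q t x = z t x - wlaplacian \<Omega> (z t) x - wlaplacian \<Omega> (y t) x" for t x
  note [measurable] = borel_measurable_lebesgue_on[OF mean_measurable(1), of \<Omega>] L2_spaceD(2)[OF g(1)]
  have FL: "?F \<in> L2_space \<Omega>" using L2_space_add[OF exp_mean_L2 g(1), of 1 1] by simp
  have Fi: "integrable ?M ?F" by (rule L2_space_integrable[OF \<Omega>_lmeasurable FL])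
  define P where "P \<phi> t = moment \<phi> t - moment (laplacian \<phi>) t + (LINT x|lborel. tail t x * laplacian \<phi> x)" for \<phi> t
  have y0L: "y 0 \<in> L2_space \<Omega>" using yH[of 0] T_pos Sobolev_H_imp_L2 unfolding H2_H10_def by auto
  have identity: "integrable lborel (\<lambda>t. indicator {0..T} t * (exp t * P \<phi> t))"
      "(LINT t|lborel. indicator {0..T} t * (exp t * P \<phi> t)) = (LINT x|?M. ?F x * \<phi> x)"
    if \<phi>: "\<phi> \<in> test_functions \<Omega>" for \<phi>
  proof -
    note L\<phi> = laplacian_test_function[OF \<phi>]
    obtain B B' where B: "\<And>x. \<bar>\<phi> x\<bar> \<le> B" "\<And>x. \<bar>laplacian \<phi> x\<bar> \<le> B'"
      using test_functions_bounded[OF \<phi>] test_functions_bounded[OF L\<phi>] by metis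
    note id = time_integrated_identity[OF test_functions_measurable[OF \<phi>] B(1) test_functions_measurable[OF L\<phi>] B(2), folded P_def]
    show "integrable lborel (\<lambda>t. indicator {0..T} t * (exp t * P \<phi> t))" by (rule id(1))
    have 1: "(LINT x|lborel. exp_mean x * \<phi> x) = (LINT x|?M. exp_mean x * \<phi> x)"
      using mean_outside(1) test_functions_measurable[OF \<phi>]
      by (intro integral_lebesgue_on_eq_lborel[OF \<Omega>_sets, symmetric]) auto
    have 2: "(LINT x|lborel. total x * laplacian \<phi> x) = - (LINT x|?M. y 0 x * laplacian \<phi> x)"
    proof -
      have "(LINT x|lborel. total x * laplacian \<phi> x) = (LINT x|?M. total x * laplacian \<phi> x)"
        using mean_outside(2) test_functions_measurable[OF L\<phi>]
        by (intro integral_lebesgue_on_eq_lborel[OF \<Omega>_sets, symmetric]) auto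
      also have "\<dots> = (LINT x|?M. - (y 0 x * laplacian \<phi> x))"
      proof (rule integral_cong_AE)
        show "AE x in ?M. total x * laplacian \<phi> x = - (y 0 x * laplacian \<phi> x)"
          using trajectory_from_derivative(2)[OF N y, of T] T_pos by (auto elim!: eventually_mono)
      qed (use L2_spaceD(2)[OF y0L] borel_measurable_lebesgue_on[OF mean_measurable(2)]
             test_functions_measurable_on[OF L\<phi>] in measurable)
      finally show ?thesis by simp
    qed
    show "(LINT t|lborel. indicator {0..T} t * (exp t * P \<phi> t)) = (LINT x|?M. ?F x * \<phi> x)"
      using id(2) 1 2 g(2)[OF \<phi>] integrable_L2_mult_test[OF open_\<Omega> bounded_\<Omega> exp_mean_L2 \<phi>]
        integrable_L2_mult_test[OF open_\<Omega> bounded_\<Omega> g(1) \<phi>] by (simp add: distrib_right)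
  qed
  have qL: "q t \<in> L2_space \<Omega>" and Pq: "\<And>\<phi>. \<phi> \<in> test_functions \<Omega> \<Longrightarrow> P \<phi> t = (LINT x|?M. q t x * \<phi> x)"
    if t: "t \<in> {0<..<T}" "z t \<in> H2_H10 \<Omega>" "AE x in lborel. x \<in> \<Omega> \<longrightarrow> v (x, t) = z t x" for t
  proof -
    have z2: "z t \<in> Sobolev_H 2 \<Omega>" and y2: "y t \<in> Sobolev_H 2 \<Omega>"
      using t(1,2) yH[of t] unfolding H2_H10_def by auto
    note zL = Sobolev_H_imp_L2[OF z2] and yL = Sobolev_H_imp_L2[OF y2]
    note wz = wlaplacian_L2[OF open_\<Omega> bounded_\<Omega> z2] and wy = wlaplacian_L2[OF open_\<Omega> bounded_\<Omega> y2]
    show "q t \<in> L2_space \<Omega>" unfolding q_def[abs_def]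
      using L2_space_add[OF L2_space_add[OF zL wz(1), of 1 "-1"] wy(1), of 1 "-1"] by simp
    show "P \<phi> t = (LINT x|?M. q t x * \<phi> x)" if \<phi>: "\<phi> \<in> test_functions \<Omega>" for \<phi>
    proof -
      note L\<phi> = laplacian_test_function[OF \<phi>]
      note int = integrable_L2_mult_test[OF open_\<Omega> bounded_\<Omega> _ \<phi>]
      have "(LINT x|?M. y t x * laplacian \<phi> x) = (LINT x|?M. - (tail t x * laplacian \<phi> x))"
      proof (rule integral_cong_AE)
        show "AE x in ?M. y t x * laplacian \<phi> x = - (tail t x * laplacian \<phi> x)"
          using trajectory_from_derivative(1)[OF N y, of t] t(1) by (auto elim!: eventually_mono)
      qed (use L2_spaceD(2)[OF yL] borel_measurable_lebesgue_on[OF mean_measurable(3)]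
             test_functions_measurable_on[OF L\<phi>] in measurable)
      also have "\<dots> = - (LINT x|lborel. tail t x * laplacian \<phi> x)"
        using mean_outside(3) test_functions_measurable[OF L\<phi>]
        by (subst integral_lebesgue_on_eq_lborel[OF \<Omega>_sets]) auto
      finally have "(LINT x|?M. wlaplacian \<Omega> (y t) x * \<phi> x) = - (LINT x|lborel. tail t x * laplacian \<phi> x)"
        using wy(2)[OF \<phi>] by simp
      moreover have "moment \<phi> t = (LINT x|?M. z t x * \<phi> x)"
        by (rule moment_slice[OF t(2,3) test_functions_measurable[OF \<phi>]])
      moreover have "moment (laplacian \<phi>) t = (LINT x|?M. wlaplacian \<Omega> (z t) x * \<phi> x)"
        using moment_slice[OF t(2,3) test_functions_measurable[OF L\<phi>]] wz(2)[OF \<phi>] by simp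
      ultimately show ?thesis
        using int[OF zL] int[OF wz(1)] int[OF wy(1)] by (simp add: P_def q_def left_diff_distrib)
    qed
  qed
  define m where "m = real DIM('a) * measure lebesgue \<Omega>"
  define c where "c = (LINT s|lborel. indicator {0..T} s * m + b s)"
  have m: "m \<ge> 0" by (simp add: m_def)
  have mb: "integrable lborel (\<lambda>s. indicator {0..T} s * m + b s)"
    using T_pos b_int by (intro Bochner_Integration.integrable_add integrable_mult_left integrable_real_indicator) auto
  \<comment> \<open>the majorant in time, independent of the test function\<close>
  define w where "w t = exp T * (indicator {0..T} t * (measure lebesgue \<Omega> + m + c) + 2 * b t)" for t
  have w: "integrable lborel w" unfolding w_def[abs_def]
    using T_pos b_int by (intro integrable_mult_right Bochner_Integration.integrable_add integrable_mult_left integrable_real_indicator) auto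
  have bound: "AE t in lborel. norm (indicator {0..T} t * (exp t * P \<phi> t)) \<le> w t"
    if \<phi>: "\<phi> \<in> test_functions \<Omega>" "\<And>x. \<bar>\<phi> x\<bar> \<le> 1" for \<phi>
  proof -
    note L\<phi> = laplacian_test_function[OF \<phi>(1)]
    obtain B where B: "\<And>x. \<bar>laplacian \<phi> x\<bar> \<le> B" using test_functions_bounded[OF L\<phi>] by metis
    have Lb: "AE s in lborel. \<bar>moment (laplacian \<phi>) s\<bar> \<le> indicator {0..T} s * m + b s"
      using slices
    proof eventually_elim
      case (elim s)
      show ?case
      proof (cases "s \<in> {0<..<T}")
        case True
        then show ?thesis using moment_bounds(2)[OF _ _ \<phi>, of s] elim by (simp add: m_def)
      next
        case False
        then show ?thesis using moment_outside[of s] m b_nonneg[of s] by simp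
      qed
    qed
    have tl: "\<bar>LINT x|lborel. tail t x * laplacian \<phi> x\<bar> \<le> c" for t
    proof -
      have "\<bar>LINT x|lborel. tail t x * laplacian \<phi> x\<bar> = \<bar>LINT s|lborel. indicator {t..T} s * moment (laplacian \<phi>) s\<bar>"
        using integral_tail_moment[OF test_functions_measurable[OF L\<phi>] B] by simp
      also have "\<dots> \<le> (LINT s|lborel. \<bar>indicator {t..T} s * moment (laplacian \<phi>) s\<bar>)" by (rule integral_abs_bound)
      also have "\<dots> \<le> c" unfolding c_def
      proof (rule integral_mono_AE)
        show "integrable lborel (\<lambda>s. \<bar>indicator {t..T} s * moment (laplacian \<phi>) s\<bar>)"
          by (intro integrable_abs moment_weighted(1)[OF test_functions_measurable[OF L\<phi>] B, where K = 1]) (auto simp: indicator_def)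
        show "AE s in lborel. \<bar>indicator {t..T} s * moment (laplacian \<phi>) s\<bar> \<le> indicator {0..T} s * m + b s"
          using Lb by eventually_elim (use m b_nonneg in \<open>auto simp: indicator_def abs_mult\<close>)
      qed (rule mb)
      finally show ?thesis .
    qed
    have c0: "c \<ge> 0" using tl[of 0] by linarith
    have "AE t in lborel. t \<noteq> 0" "AE t in lborel. t \<noteq> T" by (rule AE_lborel_singleton)+
    with slices Lb show ?thesis
    proof eventually_elim
      case (elim t)
      show ?case
      proof (cases "t \<in> {0..T}")
        case True
        then have t: "t \<in> {0<..<T}" using elim by auto
        have 1: "\<bar>moment \<phi> t\<bar> \<le> measure lebesgue \<Omega> + b t"
          using moment_bounds(1)[OF _ _ \<phi>, of t] elim(1) t by simp
        have "\<bar>P \<phi> t\<bar> \<le> measure lebesgue \<Omega> + m + c + 2 * b t"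
          unfolding P_def using 1 elim(2) tl[of t] True by simp
        moreover have "exp t \<le> exp T" using True by simp
        ultimately have "exp t * \<bar>P \<phi> t\<bar> \<le> exp T * (measure lebesgue \<Omega> + m + c + 2 * b t)"
          by (intro mult_mono) auto
        then show ?thesis using True by (simp add: w_def abs_mult)
      next
        case False
        then show ?thesis using b_nonneg[of t] by (simp add: w_def)
      qed
    qed
  qed
  have zero: "(LINT x|?M. ?F x * indicator E x) = 0" if E: "E \<in> sets lebesgue" "E \<subseteq> K" for E
  proof -
    have E\<Omega>: "E \<subseteq> \<Omega>" using E(2) K(2) by blast
    then have [measurable]: "E \<in> sets ?M" using E(1) \<Omega>_sets by (auto simp: sets_restrict_space_iff)
    obtain \<phi> :: "nat \<Rightarrow> 'a \<Rightarrow> real" where \<phi>: "\<And>n. \<phi> n \<in> test_functions \<Omega>" "\<And>n x. 0 \<le> \<phi> n x" "\<And>n x. \<phi> n x \<le> 1"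
      "AE x in lebesgue. (\<lambda>n. \<phi> n x) \<longlonglongrightarrow> indicator E x"
      using indicator_limit_of_test_functions[OF open_\<Omega> E(1) E\<Omega>] by metis
    have \<phi>1: "\<bar>\<phi> n x\<bar> \<le> 1" for n x using \<phi>(2,3)[of n x] by simp
    note [measurable] = test_functions_measurable_on[OF \<phi>(1)]
    have \<phi>lim: "AE x in ?M. (\<lambda>n. \<phi> n x) \<longlonglongrightarrow> indicator E x"
      using \<phi>(4) \<Omega>_sets by (auto simp: AE_restrict_space_iff elim: eventually_mono)
    have lim: "(\<lambda>n. LINT x|?M. u x * \<phi> n x) \<longlonglongrightarrow> (LINT x|?M. u x * indicator E x)" if u: "integrable ?M u" for u
    proof (rule integral_dominated_convergence[where w = "\<lambda>x. \<bar>u x\<bar>"])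
      have [measurable]: "u \<in> borel_measurable ?M" using u by auto
      show "(\<lambda>x. u x * indicator E x) \<in> borel_measurable ?M" by measurable
      show "(\<lambda>x. u x * \<phi> n x) \<in> borel_measurable ?M" for n by measurable
      show "AE x in ?M. (\<lambda>n. u x * \<phi> n x) \<longlonglongrightarrow> u x * indicator E x"
        using \<phi>lim by eventually_elim (intro tendsto_intros)
      show "AE x in ?M. norm (u x * \<phi> n x) \<le> \<bar>u x\<bar>" for n
        using \<phi>1[of n] by (intro always_eventually allI) (auto simp: abs_mult mult_left_le)
      show "integrable ?M (\<lambda>x. \<bar>u x\<bar>)" using u by simp
    qed
    have "(\<lambda>n. LINT t|lborel. indicator {0..T} t * (exp t * P (\<phi> n) t)) \<longlonglongrightarrow> integral\<^sup>L lborel (\<lambda>t :: real. 0 :: real)"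
    proof (rule integral_dominated_convergence[where w = w])
      show "integrable lborel w" by (rule w)
      show "(\<lambda>t. indicator {0..T} t * (exp t * P (\<phi> n) t)) \<in> borel_measurable lborel" for n
        using identity(1)[OF \<phi>(1)] by auto
      show "AE t in lborel. norm (indicator {0..T} t * (exp t * P (\<phi> n) t)) \<le> w t" for n by (rule bound[OF \<phi>(1) \<phi>1])
      have "AE t in lborel. t \<noteq> 0" "AE t in lborel. t \<noteq> T" by (rule AE_lborel_singleton)+
      with slices eq show "AE t in lborel. (\<lambda>n. indicator {0..T} t * (exp t * P (\<phi> n) t)) \<longlonglongrightarrow> 0"
      proof eventually_elim
        case (elim t)
        show ?case
        proof (cases "t \<in> {0..T}")
          case True
          then have t: "t \<in> {0<..<T}" using elim by auto
          then have zt: "z t \<in> H2_H10 \<Omega>" "AE x in lborel. x \<in> \<Omega> \<longrightarrow> v (x, t) = z t x" using elim(1) by auto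
          note qL = qL[OF t zt] and Pq = Pq[OF t zt]
          have "(\<lambda>n. P (\<phi> n) t) \<longlonglongrightarrow> (LINT x|?M. q t x * indicator E x)"
            unfolding Pq[OF \<phi>(1)] by (rule lim[OF L2_space_integrable[OF \<Omega>_lmeasurable qL]])
          also have "(LINT x|?M. q t x * indicator E x) = (LINT x|?M. 0)"
          proof (rule integral_cong_AE)
            have "AE x in ?M. x \<in> K \<longrightarrow> q t x = 0" using elim(2) t by (simp add: q_def)
            then show "AE x in ?M. q t x * indicator E x = 0"
              by eventually_elim (use E(2) in \<open>auto simp: indicator_def\<close>)
          qed (use L2_spaceD(2)[OF qL] in measurable)
          finally have "(\<lambda>n. P (\<phi> n) t) \<longlonglongrightarrow> 0" by simp
          then have "(\<lambda>n. indicator {0..T} t * (exp t * P (\<phi> n) t)) \<longlonglongrightarrow> indicator {0..T} t * (exp t * 0)"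
            by (intro tendsto_intros)
          then show ?thesis by simp
        qed simp
      qed
    qed simp
    then have "(\<lambda>n. LINT x|?M. ?F x * \<phi> n x) \<longlonglongrightarrow> 0" unfolding identity(2)[OF \<phi>(1)] by simp
    with lim[OF Fi] show ?thesis by (rule LIMSEQ_unique)
  qed
  have "AE x in ?M. ?F x * indicator K x = 0"
  proof (rule AE_zero_if_all_integrals_zero)
    have [measurable]: "K \<in> sets ?M" using K \<Omega>_sets by (auto simp: sets_restrict_space_iff)
    show "integrable ?M (\<lambda>x. ?F x * indicator K x)"
      using integrable_mult_indicator[OF _ Fi, of K] by (simp add: mult.commute)
    fix E assume "E \<in> sets ?M"
    then have E: "E \<inter> K \<in> sets lebesgue" using K(1) \<Omega>_sets by (auto simp: sets_restrict_space_iff)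
    have "(LINT x|?M. indicator E x * (?F x * indicator K x)) = (LINT x|?M. ?F x * indicator (E \<inter> K) x)"
      by (simp add: indicator_inter_arith mult.left_commute)
    also have "\<dots> = 0" by (rule zero[OF E]) simp
    finally show "(LINT x|?M. indicator E x * (?F x * indicator K x)) = 0" .
  qed
  then show ?thesis by eventually_elim (auto simp: indicator_def split: if_splits)
qed

end

section \<open>Failure of null controllability\<close>

theorem theorem1p1:
  fixes \<Omega> \<omega> :: "'a::euclidean_space set"
    and T :: real
    and Q \<O> :: "('a \<times> real) set"
    and chi :: "'a \<times> real \<Rightarrow> real"
  assumes "open \<Omega>" and "bounded \<Omega>" and "connected \<Omega>" and "C2_boundary \<Omega>"
    and "T > 0"
    and "open \<omega>" and "\<omega> \<subset> \<Omega>" and "\<not> negligible (\<Omega> - \<omega>)"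
    and "Q = \<Omega> \<times> {0<..<T}"
    and "\<O> = \<omega> \<times> {0<..<T}" and "\<O> \<noteq> {}"
    and "smooth_on chi Q" and "closure (support_on Q chi) \<subseteq> closure \<O>"
  shows "\<exists>y0\<in>H2_H10 \<Omega>. \<not> null_controllable T \<Omega> \<O> chi y0"
proof -
  have \<Omega>: "open \<Omega>" "bounded \<Omega>" and T: "T > 0" using assms(1,2,5) .
  have \<Omega>': "\<Omega> \<in> sets lebesgue" using \<Omega>(1) by (rule sets_lebesgue_open)
  obtain e :: 'a where e: "e \<in> Basis" using SOME_Basis by blast
  \<comment> \<open>The uncontrolled region is cut down to a compact subset of \<open>\<Omega>\<close>, where the cutoff is bounded below.\<close>
  obtain F :: "nat \<Rightarrow> 'a set" where F: "\<And>n. compact (F n)" "\<And>n. F n \<subseteq> \<Omega>" "(\<Union>n. F n) = \<Omega>"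
    using open_Union_compact_subsets[OF \<Omega>(1)] by metis
  obtain n where n: "\<not> negligible ((\<Omega> - \<omega>) \<inter> F n)"
  proof -
    have "(\<Union>n. (\<Omega> - \<omega>) \<inter> F n) = \<Omega> - \<omega>" using F(3) by blast
    then show thesis using that negligible_Union_nat[of "\<lambda>n. (\<Omega> - \<omega>) \<inter> F n"] assms(8) by auto
  qed
  define K where "K = (\<Omega> - \<omega>) \<inter> F n"
  have "F n \<in> sets lebesgue" using F(1) by (simp add: borel_compact sets_completionI_sets)
  then have K: "K \<in> sets lebesgue" "K \<subseteq> \<Omega>" "bounded K" "\<not> negligible K"
    using \<Omega>' sets_lebesgue_open[OF assms(6)] n bounded_subset[OF \<Omega>(2), of K] unfolding K_def by auto
  obtain \<eta> \<delta> where \<eta>: "\<eta> \<in> test_functions \<Omega>" "\<And>x. \<eta> x \<ge> 0" and \<delta>: "\<delta> > 0" "\<And>x. x \<in> F n \<Longrightarrow> \<eta> x \<ge> \<delta>"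
    using test_function_positive_on_compact[of "F n" \<Omega>] F(1,2) \<Omega>(1) by metis
  obtain a where a: "\<And>C r0. C > 0 \<Longrightarrow> r0 > 0 \<Longrightarrow> \<exists>r. 0 < r \<and> r \<le> r0 \<and>
     measure lebesgue (K \<inter> {x. \<bar>x \<bullet> e - a\<bar> \<le> r}) > C * (r * sqrt r)"
    using thick_hyperplane_exists[OF K(1,3,4) e] by metis
  obtain y0 g B where y0: "y0 \<in> H2_H10 \<Omega>" "g \<in> L2_space \<Omega>"
    "\<And>\<phi>. \<phi> \<in> test_functions \<Omega> \<Longrightarrow> (LINT x|lebesgue_on \<Omega>. y0 x * laplacian \<phi> x) = (LINT x|lebesgue_on \<Omega>. g x * \<phi> x)"
    "AE x in lebesgue_on \<Omega>. \<eta> x * ((x \<bullet> e - a)\<^sup>2) powr (-1/8) - B \<le> \<bar>g x\<bar>"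
    by (rule singular_datum[OF \<Omega> \<eta> e, of a]) blast
  have "\<not> null_controllable T \<Omega> \<O> chi y0"
  proof
    assume "null_controllable T \<Omega> \<O> chi y0"
    then obtain u y where sol: "is_solution T \<Omega> (\<lambda>p. indicat_real \<O> p * u p * chi p) y0 y"
      and yT: "AE x in lebesgue_on \<Omega>. y T x = 0"
      unfolding null_controllable_def by blast
    from sol obtain z where yC: "y \<in> C_time T \<Omega>" and init: "AE x in lebesgue_on \<Omega>. y 0 x = y0 x"
      and z: "z \<in> L2_time T \<Omega>" and yz: "has_time_derivative T \<Omega> y z"
      and pde: "AE t in lebesgue_on {0<..<T}. AE x in lebesgue_on \<Omega>.
           z t x - wlaplacian \<Omega> (z t) x - wlaplacian \<Omega> (y t) x = indicat_real \<O> (x, t) * u (x, t) * chi (x, t)"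
      unfolding is_solution_def by blast
    have yH: "y t \<in> H2_H10 \<Omega>" if "t \<in> {0..T}" for t using yC that unfolding C_time_def by blast
    obtain v b N where sl: "Sobolev_slices \<Omega> T v z b" and N: "N \<in> null_sets lborel"
      "\<And>x t. (x, t) \<notin> N \<Longrightarrow> x \<in> \<Omega> \<Longrightarrow> t \<in> {0<..<T} \<Longrightarrow> v (x, t) = z t x"
      by (rule L2_time_slices[OF \<Omega> T z]) blast
    interpret Sobolev_slices \<Omega> T v z b by (rule sl)
    have eq: "AE t in lborel. t \<in> {0<..<T} \<longrightarrow> (AE x in lebesgue_on \<Omega>.
        x \<in> K \<longrightarrow> z t x - wlaplacian \<Omega> (z t) x - wlaplacian \<Omega> (y t) x = 0)"
    proof -
      have "AE t in lborel. t \<in> {0<..<T} \<longrightarrow> (AE x in lebesgue_on \<Omega>.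
          z t x - wlaplacian \<Omega> (z t) x - wlaplacian \<Omega> (y t) x = indicat_real \<O> (x, t) * u (x, t) * chi (x, t))"
        using pde by (simp add: AE_restrict_space_iff AE_completion_iff)
      then show ?thesis
      proof eventually_elim
        case (elim t)
        show ?case
        proof
          assume "t \<in> {0<..<T}"
          then have "AE x in lebesgue_on \<Omega>. z t x - wlaplacian \<Omega> (z t) x - wlaplacian \<Omega> (y t) x
              = indicat_real \<O> (x, t) * u (x, t) * chi (x, t)" using elim by blast
          then show "AE x in lebesgue_on \<Omega>. x \<in> K \<longrightarrow> z t x - wlaplacian \<Omega> (z t) x - wlaplacian \<Omega> (y t) x = 0"
            by eventually_elim (simp add: K_def assms(10) indicator_def)
        qed
      qed
    qed
    have y0L: "y0 \<in> L2_space \<Omega>" and yL: "y 0 \<in> L2_space \<Omega>"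
      using y0(1) yH[of 0] T Sobolev_H_imp_L2 unfolding H2_H10_def by auto
    have weak: "(LINT x|lebesgue_on \<Omega>. y 0 x * laplacian \<phi> x) = (LINT x|lebesgue_on \<Omega>. g x * \<phi> x)"
      if \<phi>: "\<phi> \<in> test_functions \<Omega>" for \<phi>
    proof -
      have "(LINT x|lebesgue_on \<Omega>. y 0 x * laplacian \<phi> x) = (LINT x|lebesgue_on \<Omega>. y0 x * laplacian \<phi> x)"
      proof (rule integral_cong_AE)
        show "AE x in lebesgue_on \<Omega>. y 0 x * laplacian \<phi> x = y0 x * laplacian \<phi> x"
          using init by eventually_elim simp
      qed (use L2_spaceD(2)[OF yL] L2_spaceD(2)[OF y0L]
          test_functions_measurable_on[OF laplacian_test_function[OF \<phi>]] in measurable)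
      then show ?thesis using y0(3)[OF \<phi>] by simp
    qed
    have uncontrolled: "AE x in lebesgue_on \<Omega>. x \<in> K \<longrightarrow> exp_mean x + g x = 0"
      by (rule exp_mean_uncontrolled[OF N yz yT yH eq K(1,2) y0(2) weak])
    obtain C where C: "C \<ge> 0" "\<And>a r. r > 0 \<Longrightarrow>
        (LINT x|lebesgue_on \<Omega>. indicator {a-r..a+r} (x \<bullet> e) * (exp_mean x)\<^sup>2) \<le> C * r"
      by (rule exp_mean_slab[OF e]) blast
    have low: "AE x in lebesgue_on \<Omega>. x \<in> K \<longrightarrow> \<delta> * ((x \<bullet> e - a)\<^sup>2) powr (-1/8) - B \<le> \<bar>exp_mean x\<bar>"
      using uncontrolled y0(4)
    proof eventually_elim
      case (elim x)
      show ?case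
      proof
        assume x: "x \<in> K"
        then have "exp_mean x = - g x" using elim(1) by linarith
        moreover have "\<delta> * ((x \<bullet> e - a)\<^sup>2) powr (-1/8) \<le> \<eta> x * ((x \<bullet> e - a)\<^sup>2) powr (-1/8)"
          using \<delta>(2)[of x] x by (intro mult_right_mono) (auto simp: K_def)
        ultimately show "\<delta> * ((x \<bullet> e - a)\<^sup>2) powr (-1/8) - B \<le> \<bar>exp_mean x\<bar>" using elim(2) by simp
      qed
    qed
    obtain C' r0 where C': "C' > 0" "r0 > 0"
      "\<forall>r. 0 < r \<longrightarrow> r \<le> r0 \<longrightarrow> measure lebesgue (K \<inter> {x. \<bar>x \<bullet> e - a\<bar> \<le> r}) \<le> C' * (r * sqrt r)"
      by (rule thin_if_singular[OF \<Omega> K(1,2) e exp_mean_L2 \<delta>(1) C(1) low C(2)])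
    obtain r where "0 < r" "r \<le> r0" "measure lebesgue (K \<inter> {x. \<bar>x \<bullet> e - a\<bar> \<le> r}) > C' * (r * sqrt r)"
      using a[OF C'(1,2)] by blast
    then show False using C'(3) by fastforce
  qed
  then show ?thesis using y0(1) by blast
qed

end
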